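(* Let $n\ge2$, let $S$ be a finite dimensional abelian Lie algebra over $\mathbb{C}$, and let $B$ be a finitely generated commutative associative unital algebra over $\mathbb{C}$. Let $K\subseteq\mathbb{Z}^n$ be a subgroup and $\beta\in\mathbb{Z}^n$ with $\mathbb{Z}^n=K\oplus\mathbb{Z}\beta$, and let $L_{\mathfrak{L}_{S,n}(B)}(K,\beta,Z)$ be an irreducible highest weight $\mathfrak{L}_{S,n}(B)$-module with finite dimensional weight spaces. Then $L_{\mathfrak{L}_{S,n}(B)}(K,\beta,Z)$ is a single point evaluation $\mathfrak{L}_{S,n}(B)$-module.
   Context: $A_n=\mathbb{C}[t_1^{\pm1},\dots,t_n^{\pm1}]$, $t^{m}=t_1^{m_1}\cdots t_n^{m_n}$ for $m\in\mathbb{Z}^n$, $d_i=t_i\frac{d}{dt_i}$, $W_n=\mathrm{Der}(A_n)$. For $u\in\mathbb{C}^n$, $r\in\mathbb{Z}^n$ put $D(u,r)=\sum_i u_i t^{r}d_i$; then $[D(u,r),D(v,s)]=D((u|s)v-(v|r)u,r+s)$, $(u|v)=\sum_i u_iv_i$. $\mathfrak{L}_{S,n}=W_n\ltimes(S\otimes A_n)$, with $S\otimes A_n$ an abelian ideal and $[D(u,r),s\otimes t^{m}]=(u|m)s\otimes t^{m+r}$. $\mathfrak{L}_{S,n}(B)=\mathfrak{L}_{S,n}\otimes B$ with $[x\otimes b,y\otimes b']=[x,y]\otimes bb'$. Weights are taken with respect to $H=\bigoplus_i\mathbb{C}d_i$ (acting as $H\otimes 1$); weight modules are direct sums of weight spaces.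 For $m\in\mathbb{Z}^n$, $\mathfrak{L}_{S,n}(B)_m$ is the span of all $t^md_i\otimes b$ and $s\otimes t^m\otimes b$. Put $\mathfrak{L}_{S,n}(B)_K=\bigoplus_{r\in K}\mathfrak{L}_{S,n}(B)_r$ and $\mathfrak{L}_{S,n}(B)^{\pm}=\bigoplus_{d\in\mathbb{N}}\bigoplus_{r\in K}\mathfrak{L}_{S,n}(B)_{r\pm d\beta}$. Let $Z$ be an irreducible (weight) module for $\mathfrak{L}_{S,n}(B)_K$, extended to $\mathfrak{L}_{S,n}(B)_K\oplus\mathfrak{L}_{S,n}(B)^+$ by letting $\mathfrak{L}_{S,n}(B)^+$ act as zero. $L_{\mathfrak{L}_{S,n}(B)}(K,\beta,Z)$ is the unique irreducible quotient of the generalised Verma module induced from $Z$ to $U(\mathfrak{L}_{S,n}(B))$. A $\mathfrak{g}\otimes B$-module $V$ is a single point evaluation module if there is an algebra homomorphism $\eta:B\to\mathbb{C}$ with $(x\otimes b)v=\eta(b)(x\otimes1)v$ for all $x\in\mathfrak{g}$, $b\in B$, $v\in V$. *)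

theory Defs
  imports "HOL-Analysis.Analysis" "HOL-Library.Poly_Mapping"
begin


section \<open>Complex vector spaces\<close>

class complex_vector = ab_group_add +
  fixes scaleC :: "complex \<Rightarrow> 'a \<Rightarrow> 'a" (infixr \<open>*\<^sub>C\<close> 75)
  assumes scaleC_add_right: "a *\<^sub>C (x + y) = a *\<^sub>C x + a *\<^sub>C y"
    and scaleC_add_left: "(a + b) *\<^sub>C x = a *\<^sub>C x + b *\<^sub>C x"
    and scaleC_scaleC: "a *\<^sub>C (b *\<^sub>C x) = (a * b) *\<^sub>C x"
    and scaleC_one: "1 *\<^sub>C x = x"

global_interpretation complex_vector: vector_space "scaleC :: complex \<Rightarrow> 'a \<Rightarrow> 'a::complex_vector"
  by unfold_locales (simp_all add: scaleC_add_right scaleC_add_left scaleC_scaleC scaleC_one)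

abbreviation cspan :: "'a::complex_vector set \<Rightarrow> 'a set"
  where "cspan \<equiv> module.span scaleC"

abbreviation csubspace :: "'a::complex_vector set \<Rightarrow> bool"
  where "csubspace \<equiv> module.subspace scaleC"

abbreviation clinear :: "('a::complex_vector \<Rightarrow> 'b::complex_vector) \<Rightarrow> bool"
  where "clinear \<equiv> Vector_Spaces.linear scaleC scaleC"

definition finite_dim :: "'a::complex_vector set \<Rightarrow> bool"
  where "finite_dim W \<longleftrightarrow> (\<exists>F. finite F \<and> W \<subseteq> cspan F)"

lemma clinearI:
  assumes "\<And>x y. f (x + y) = f x + f y" and "\<And>c x. f (c *\<^sub>C x) = c *\<^sub>C f x"
  shows "clinear f"
  using assms by unfold_locales

lemma clinear_add: "clinear f \<Longrightarrow> f (x + y) = f x + f y"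
  and clinear_scale: "clinear f \<Longrightarrow> f (c *\<^sub>C x) = c *\<^sub>C f x"
  using module_hom.add module_hom.scale Vector_Spaces.linear_iff_module_hom by metis+

instantiation complex :: complex_vector
begin
definition scaleC_complex :: "complex \<Rightarrow> complex \<Rightarrow> complex"
  where "scaleC_complex a x = a * x"
instance by standard (simp_all add: scaleC_complex_def algebra_simps)
end

instantiation poly_mapping :: (type, complex_vector) complex_vector
begin
lift_definition scaleC_poly_mapping :: "complex \<Rightarrow> ('a \<Rightarrow>\<^sub>0 'b) \<Rightarrow> ('a \<Rightarrow>\<^sub>0 'b)"
  is "\<lambda>c f k. c *\<^sub>C f k"
  by (rule finite_subset[rotated]) auto
instance
  by standard (transfer; simp add: fun_eq_iff scaleC_add_right scaleC_add_left scaleC_scaleC scaleC_one)+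
end

lemma lookup_scaleC [simp]: "Poly_Mapping.lookup (c *\<^sub>C p) k = c *\<^sub>C Poly_Mapping.lookup p k"
  by transfer simp

lemma scaleC_single: "c *\<^sub>C Poly_Mapping.single k d = Poly_Mapping.single k (c * d :: complex)"
  by (rule poly_mapping_eqI) (simp add: lookup_single when_def scaleC_complex_def)

lemma scaleC_conv_mult: "c *\<^sub>C p = Poly_Mapping.single 0 c * (p :: 'a::monoid_add \<Rightarrow>\<^sub>0 complex)"
proof -
  have "c *\<^sub>C p = Poly_Mapping.map ((*) c) p"
    by (rule poly_mapping_eqI) (simp add: Poly_Mapping.map.rep_eq scaleC_complex_def when_def)
  then show ?thesis by (simp add: mult_map_scale_conv_mult)
qed

lemma poly_mapping_add_induct [case_names single add]:
  fixes p :: "'a \<Rightarrow>\<^sub>0 'b::ab_group_add"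
  assumes "\<And>k c. P (Poly_Mapping.single k c)" and "\<And>p q. P p \<Longrightarrow> P q \<Longrightarrow> P (p + q)"
  shows "P p"
proof (induction "Poly_Mapping.keys p" arbitrary: p rule: infinite_finite_induct)
  case infinite then show ?case by simp
next
  case empty
  then have "p = Poly_Mapping.single undefined 0" by (metis keys_eq_empty single_zero)
  then show ?case using assms(1) by metis
next
  case (insert k A)
  let ?q = "p - Poly_Mapping.single k (Poly_Mapping.lookup p k)"
  have "Poly_Mapping.keys ?q = A"
  proof (rule set_eqI)
    fix x
    have "x \<in> Poly_Mapping.keys ?q \<longleftrightarrow> x \<noteq> k \<and> x \<in> Poly_Mapping.keys p"
      by (auto simp: in_keys_iff lookup_minus lookup_single when_def)
    then show "x \<in> Poly_Mapping.keys ?q \<longleftrightarrow> x \<in> A" using insert by (metis insert_iff)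
  qed
  then have "P ?q" using insert by blast
  then have "P (?q + Poly_Mapping.single k (Poly_Mapping.lookup p k))" using assms by blast
  then show ?case by simp
qed

lemma mult_scaleC_left: "(c *\<^sub>C p) * q = c *\<^sub>C (p * q :: 'a::monoid_add \<Rightarrow>\<^sub>0 complex)"
  by (simp add: scaleC_conv_mult mult.assoc)

lemma mult_scaleC_right: "p * (c *\<^sub>C q) = c *\<^sub>C (p * q :: 'a::monoid_add \<Rightarrow>\<^sub>0 complex)"
proof -
  have "p * Poly_Mapping.single 0 c = Poly_Mapping.single 0 c * p"
    by (induction p rule: poly_mapping_add_induct)
       (simp_all add: mult_single algebra_simps)
  then show ?thesis by (metis scaleC_conv_mult mult.assoc)
qed

section \<open>Tensor products over the complex numbers\<close>

definition tensor_rels :: "('a::complex_vector \<times> 'b::complex_vector \<Rightarrow>\<^sub>0 complex) set" where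
  "tensor_rels =
     {Poly_Mapping.single (x + x', y) 1 - Poly_Mapping.single (x, y) 1 - Poly_Mapping.single (x', y) 1 | x x' y. True} \<union>
     {Poly_Mapping.single (x, y + y') 1 - Poly_Mapping.single (x, y) 1 - Poly_Mapping.single (x, y') 1 | x y y'. True} \<union>
     {Poly_Mapping.single (c *\<^sub>C x, y) 1 - c *\<^sub>C Poly_Mapping.single (x, y) 1 | c x y. True} \<union>
     {Poly_Mapping.single (x, c *\<^sub>C y) 1 - c *\<^sub>C Poly_Mapping.single (x, y) 1 | c x y. True}"

lemma equivp_diff_cspan: "equivp (\<lambda>p q. p - q \<in> cspan S)"
proof (rule equivpI)
  show "reflp (\<lambda>p q. p - q \<in> cspan S)"
    by (auto intro!: reflpI complex_vector.span_zero)
  show "symp (\<lambda>p q. p - q \<in> cspan S)"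
    by (rule sympI) (metis complex_vector.span_neg minus_diff_eq)
  show "transp (\<lambda>p q. p - q \<in> cspan S)"
    by (rule transpI) (use complex_vector.span_add in fastforce)
qed

quotient_type (overloaded) ('a, 'b) tensor (infixr \<open>\<otimes>\<close> 25) =
  "('a::complex_vector) \<times> ('b::complex_vector) \<Rightarrow>\<^sub>0 complex" / "\<lambda>p q. p - q \<in> cspan tensor_rels"
  by (rule equivp_diff_cspan)

lemma cspan_diff_cong:
  "p - p' \<in> cspan S \<Longrightarrow> q - q' \<in> cspan S \<Longrightarrow> (p + q) - (p' + q') \<in> cspan S"
  using complex_vector.span_add[of "p - p'" S "q - q'"] by (simp add: algebra_simps)

lemma cspan_diff_cong2:
  assumes "p - p' \<in> cspan S" "q - q' \<in> cspan S"
  shows "(p - q) - (p' - q') \<in> cspan S"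
proof -
  have "(p - q) - (p' - q') = (p - p') - (q - q')" by simp
  then show ?thesis using assms by (simp only: complex_vector.span_diff)
qed

lemma cspan_neg_cong: "p - p' \<in> cspan S \<Longrightarrow> - p - - p' \<in> cspan S"
  using complex_vector.span_neg[of "p - p'" S] by simp

lemma cspan_scale_cong: "p - p' \<in> cspan S \<Longrightarrow> c *\<^sub>C p - c *\<^sub>C p' \<in> cspan S"
  using complex_vector.span_scale[of "p - p'" S c] by (simp add: complex_vector.scale_right_diff_distrib)

lemma cspan_eqI: "p = q \<Longrightarrow> p - q \<in> cspan S"
  by (simp add: complex_vector.span_zero)

instantiation tensor :: (complex_vector, complex_vector) complex_vector
begin
lift_definition zero_tensor :: "'a \<otimes> 'b" is 0 .
lift_definition plus_tensor :: "'a \<otimes> 'b \<Rightarrow> 'a \<otimes> 'b \<Rightarrow> 'a \<otimes> 'b" is "(+)"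
  by (rule cspan_diff_cong)
lift_definition uminus_tensor :: "'a \<otimes> 'b \<Rightarrow> 'a \<otimes> 'b" is uminus
  by (rule cspan_neg_cong)
lift_definition minus_tensor :: "'a \<otimes> 'b \<Rightarrow> 'a \<otimes> 'b \<Rightarrow> 'a \<otimes> 'b" is "(-)"
  by (rule cspan_diff_cong2)
lift_definition scaleC_tensor :: "complex \<Rightarrow> 'a \<otimes> 'b \<Rightarrow> 'a \<otimes> 'b" is scaleC
  by (rule cspan_scale_cong)
instance
proof
  fix s t u :: "'a \<otimes> 'b" and a b :: complex
  show "s + t + u = s + (t + u)" by transfer (rule cspan_eqI, rule add.assoc)
  show "s + t = t + s" by transfer (rule cspan_eqI, rule add.commute)
  show "0 + s = s" by transfer (rule cspan_eqI, simp)
  show "- s + s = 0" by transfer (rule cspan_eqI, simp)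
  show "s - t = s + - t" by transfer (rule cspan_eqI, simp)
  show "a *\<^sub>C (s + t) = a *\<^sub>C s + a *\<^sub>C t" by transfer (rule cspan_eqI, rule scaleC_add_right)
  show "(a + b) *\<^sub>C s = a *\<^sub>C s + b *\<^sub>C s" by transfer (rule cspan_eqI, rule scaleC_add_left)
  show "a *\<^sub>C (b *\<^sub>C s) = (a * b) *\<^sub>C s" by transfer (rule cspan_eqI, rule scaleC_scaleC)
  show "1 *\<^sub>C s = s" by transfer (rule cspan_eqI, rule scaleC_one)
qed
end

lift_definition tensor :: "'a::complex_vector \<Rightarrow> 'b::complex_vector \<Rightarrow> 'a \<otimes> 'b" (infixr \<open>\<otimes>\<close> 72)
  is "\<lambda>x y. Poly_Mapping.single (x, y) 1" .

lemma tensor_add_left: "(x + x') \<otimes> y = x \<otimes> y + x' \<otimes> y"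
  by transfer (rule complex_vector.span_base, unfold tensor_rels_def diff_diff_eq, blast)

lemma tensor_add_right: "x \<otimes> (y + y') = x \<otimes> y + x \<otimes> y'"
  by transfer (rule complex_vector.span_base, unfold tensor_rels_def diff_diff_eq, blast)

lemma tensor_scale_left: "(c *\<^sub>C x) \<otimes> y = c *\<^sub>C (x \<otimes> y)"
  by transfer (rule complex_vector.span_base, unfold tensor_rels_def, blast)

lemma tensor_scale_right: "x \<otimes> (c *\<^sub>C y) = c *\<^sub>C (x \<otimes> y)"
  by transfer (rule complex_vector.span_base, unfold tensor_rels_def, blast)

lemma tensor_induct [case_names pure add]:
  fixes t :: "'a::complex_vector \<otimes> 'b::complex_vector"
  assumes "\<And>x y. P (x \<otimes> y)" and "\<And>s t. P s \<Longrightarrow> P t \<Longrightarrow> P (s + t)"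
  shows "P t"
proof (induction t rule: tensor.abs_induct)
  case (1 p)
  show ?case
  proof (induction p rule: poly_mapping_add_induct)
    case (single k c)
    obtain x y where k: "k = (x, y)" by force
    have "abs_tensor (Poly_Mapping.single k c) = c *\<^sub>C (x \<otimes> y)"
      by (simp add: k tensor.abs_eq scaleC_tensor.abs_eq scaleC_single)
    then show ?case using assms(1) by (metis tensor_scale_left)
  next
    case (add p q)
    then show ?case using assms(2) by (metis plus_tensor.abs_eq)
  qed
qed

definition bilinear_map :: "('a::complex_vector \<Rightarrow> 'b::complex_vector \<Rightarrow> 'c::complex_vector) \<Rightarrow> bool"
  where "bilinear_map f \<longleftrightarrow> (\<forall>x. clinear (f x)) \<and> (\<forall>y. clinear (\<lambda>x. f x y))"

lemma bilinear_mapI: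
  assumes "\<And>x x' y. f (x + x') y = f x y + f x' y" "\<And>x y y'. f x (y + y') = f x y + f x y'"
    "\<And>c x y. f (c *\<^sub>C x) y = c *\<^sub>C f x y" "\<And>c x y. f x (c *\<^sub>C y) = c *\<^sub>C f x y"
  shows "bilinear_map f"
  unfolding bilinear_map_def by (auto intro!: clinearI simp: assms)

definition free_lift :: "('k \<Rightarrow> 'c::complex_vector) \<Rightarrow> ('k \<Rightarrow>\<^sub>0 complex) \<Rightarrow> 'c"
  where "free_lift f p = (\<Sum>k\<in>Poly_Mapping.keys p. Poly_Mapping.lookup p k *\<^sub>C f k)"

lemma free_lift_superset:
  assumes "finite A" "Poly_Mapping.keys p \<subseteq> A"
  shows "free_lift f p = (\<Sum>k\<in>A. Poly_Mapping.lookup p k *\<^sub>C f k)"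
  unfolding free_lift_def
  by (rule sum.mono_neutral_left) (use assms in \<open>auto simp: in_keys_iff\<close>)

lemma free_lift_add: "free_lift f (p + q) = free_lift f p + free_lift f q"
proof -
  let ?A = "Poly_Mapping.keys p \<union> Poly_Mapping.keys q"
  have "free_lift f (p + q) = (\<Sum>k\<in>?A. Poly_Mapping.lookup (p + q) k *\<^sub>C f k)"
    by (rule free_lift_superset) (auto simp: keys_add)
  also have "\<dots> = free_lift f p + free_lift f q"
    by (simp add: free_lift_superset[of ?A] lookup_add scaleC_add_left sum.distrib)
  finally show ?thesis .
qed

lemma free_lift_scale: "free_lift f (c *\<^sub>C p) = c *\<^sub>C free_lift f p"
proof -
  have "free_lift f (c *\<^sub>C p) = (\<Sum>k\<in>Poly_Mapping.keys p. Poly_Mapping.lookup (c *\<^sub>C p) k *\<^sub>C f k)"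
    by (rule free_lift_superset) (auto simp: in_keys_iff scaleC_complex_def)
  then show ?thesis
    by (simp add: free_lift_def complex_vector.scale_sum_right scaleC_scaleC scaleC_complex_def)
qed

lemma clinear_free_lift: "clinear (free_lift f)"
  by (rule clinearI) (simp_all add: free_lift_add free_lift_scale)

lemma free_lift_diff: "free_lift f (p - q) = free_lift f p - free_lift f q"
  by (metis add_diff_cancel_right' diff_add_cancel free_lift_add)

lemma free_lift_single: "free_lift f (Poly_Mapping.single k c) = c *\<^sub>C f k"
  by (simp add: free_lift_def)

text \<open>For bilinear \<open>f\<close> this is the linear map with \<open>x \<otimes> y \<mapsto> f x y\<close>; for other \<open>f\<close> the
  value depends on the chosen representative.\<close>

definition tensor_lift :: "('a::complex_vector \<Rightarrow> 'b::complex_vector \<Rightarrow> 'c::complex_vector) \<Rightarrow> 'a \<otimes> 'b \<Rightarrow> 'c"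
  where "tensor_lift f t = free_lift (\<lambda>k. f (fst k) (snd k)) (rep_tensor t)"

lemma tensor_lift_abs:
  assumes "bilinear_map f"
  shows "tensor_lift f (abs_tensor p) = free_lift (\<lambda>k. f (fst k) (snd k)) p"
proof -
  let ?F = "free_lift (\<lambda>k. f (fst k) (snd k))"
  have f: "clinear (f x)" "clinear (\<lambda>x. f x y)" for x y
    using assms by (auto simp: bilinear_map_def)
  have add: "f (x + x') y = f x y + f x' y" "f x (y + y') = f x y + f x y'" for x x' y y'
    using clinear_add[OF f(1)] clinear_add[OF f(2)] by auto
  have scale: "f (c *\<^sub>C x) y = c *\<^sub>C f x y" "f x (c *\<^sub>C y) = c *\<^sub>C f x y" for c x y
    using clinear_scale[OF f(1)] clinear_scale[OF f(2)] by auto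
  have rel: "?F r = 0" if "r \<in> tensor_rels" for r
    using that unfolding tensor_rels_def
    by (auto simp: free_lift_diff free_lift_single free_lift_scale add scale scaleC_one)
  have zero: "?F 0 = 0"
    by (simp add: free_lift_def)
  have "?F r = 0" if "r \<in> cspan tensor_rels" for r
    using that
    by (induction rule: complex_vector.span_induct_alt)
       (simp_all add: free_lift_add free_lift_scale rel zero)
  moreover have "rep_tensor (abs_tensor p) - p \<in> cspan tensor_rels"
    using Quotient_rel_rep[OF Quotient_tensor] Quotient_rep_abs[OF Quotient_tensor]
      complex_vector.span_zero by (metis (no_types, lifting) diff_self)
  ultimately have "?F (rep_tensor (abs_tensor p) - p) = 0" by blast
  then show ?thesis by (simp add: tensor_lift_def free_lift_diff)
qed

lemma tensor_lift_tensor: "bilinear_map f \<Longrightarrow> tensor_lift f (x \<otimes> y) = f x y"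
  by (simp add: tensor.abs_eq tensor_lift_abs free_lift_single scaleC_one)

lemma tensor_lift_add: "bilinear_map f \<Longrightarrow> tensor_lift f (s + t) = tensor_lift f s + tensor_lift f t"
proof (induction s rule: tensor.abs_induct)
  case (1 p)
  then show ?case
    by (induction t rule: tensor.abs_induct) (simp add: plus_tensor.abs_eq tensor_lift_abs free_lift_add)
qed

lemma tensor_lift_scale: "bilinear_map f \<Longrightarrow> tensor_lift f (c *\<^sub>C s) = c *\<^sub>C tensor_lift f s"
  by (induction s rule: tensor.abs_induct) (simp add: scaleC_tensor.abs_eq tensor_lift_abs free_lift_scale)

lemma tensor_lift_fun_add: "tensor_lift (\<lambda>x y. f x y + g x y) t = tensor_lift f t + tensor_lift g t"
  by (simp add: tensor_lift_def free_lift_def scaleC_add_right sum.distrib)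

lemma tensor_lift_fun_scale: "tensor_lift (\<lambda>x y. c *\<^sub>C f x y) t = c *\<^sub>C tensor_lift f t"
  by (simp add: tensor_lift_def free_lift_def complex_vector.scale_sum_right mult.commute[of c])

definition tensor_map :: "('a \<Rightarrow> 'c) \<Rightarrow> ('b \<Rightarrow> 'd)
    \<Rightarrow> 'a::complex_vector \<otimes> 'b::complex_vector \<Rightarrow> 'c::complex_vector \<otimes> 'd::complex_vector"
  where "tensor_map f g = tensor_lift (\<lambda>x y. f x \<otimes> g y)"

lemma bilinear_tensor_map: "clinear f \<Longrightarrow> clinear g \<Longrightarrow> bilinear_map (\<lambda>x y. f x \<otimes> g y)"
  by (rule bilinear_mapI)
     (simp_all add: clinear_add clinear_scale tensor_add_left tensor_add_right
        tensor_scale_left tensor_scale_right)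

lemma tensor_map_tensor: "clinear f \<Longrightarrow> clinear g \<Longrightarrow> tensor_map f g (x \<otimes> y) = f x \<otimes> g y"
  by (simp add: tensor_map_def tensor_lift_tensor bilinear_tensor_map)

lemma clinear_tensor_map: "clinear f \<Longrightarrow> clinear g \<Longrightarrow> clinear (tensor_map f g)"
  by (rule clinearI)
     (simp_all add: tensor_map_def tensor_lift_add tensor_lift_scale bilinear_tensor_map)

section \<open>Lie algebras and current algebras\<close>

class lie_algebra = complex_vector +
  fixes lie :: "'a \<Rightarrow> 'a \<Rightarrow> 'a"
  assumes lie_add_left: "lie (x + y) z = lie x z + lie y z"
    and lie_add_right: "lie x (y + z) = lie x y + lie x z"
    and lie_scale_left: "lie (c *\<^sub>C x) y = c *\<^sub>C lie x y"
    and lie_scale_right: "lie x (c *\<^sub>C y) = c *\<^sub>C lie x y"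
    and lie_self: "lie x x = 0"
    and lie_jacobi: "lie x (lie y z) + lie y (lie z x) + lie z (lie x y) = 0"

lemma lie_antisym: "lie y x = - lie x (y :: 'a::lie_algebra)"
proof -
  have "0 = lie (x + y) (x + y)" by (simp only: lie_self)
  also have "\<dots> = (lie x x + lie y x) + (lie x y + lie y y)"
    by (metis lie_add_left lie_add_right)
  also have "\<dots> = lie x y + lie y x" by (simp add: lie_self add.commute)
  finally show ?thesis by (metis add.commute eq_neg_iff_add_eq_0)
qed

class comm_complex_algebra = complex_vector + comm_ring_1 +
  assumes scaleC_mult_left: "(c *\<^sub>C x) * y = c *\<^sub>C (x * y)"

lemma scaleC_mult_right: "x * (c *\<^sub>C y) = c *\<^sub>C (x * y :: 'a::comm_complex_algebra)"
  by (metis scaleC_mult_left mult.commute)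

text \<open>For a Lie algebra \<open>\<gg>\<close> and a commutative algebra \<open>B\<close>, the type \<open>\<gg> \<otimes> B\<close> carries the bracket
  \<open>[x \<otimes> b, y \<otimes> c] = [x, y] \<otimes> b c\<close>.\<close>

instantiation tensor :: (lie_algebra, comm_complex_algebra) lie_algebra
begin

definition lie_tensor :: "'a \<otimes> 'b \<Rightarrow> 'a \<otimes> 'b \<Rightarrow> 'a \<otimes> 'b"
  where "lie_tensor s t = tensor_lift (\<lambda>x b. tensor_lift (\<lambda>y c. lie x y \<otimes> (b * c)) t) s"

lemma bilinear_current_inner: "bilinear_map (\<lambda>y c. lie x y \<otimes> (b * c))"
  for x :: 'a and b :: 'b
  by (rule bilinear_mapI)
     (simp_all add: lie_add_right lie_scale_right scaleC_mult_right distrib_left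
       tensor_add_left tensor_add_right tensor_scale_left tensor_scale_right)

lemma bilinear_current_outer: "bilinear_map (\<lambda>x b. tensor_lift (\<lambda>y c. lie x y \<otimes> (b * c)) t)"
  for t :: "'a \<otimes> 'b"
  by (rule bilinear_mapI)
     (simp_all add: lie_add_left lie_scale_left scaleC_mult_left distrib_right
       tensor_add_left tensor_add_right tensor_scale_left tensor_scale_right
       tensor_lift_fun_add tensor_lift_fun_scale)

lemma lie_current: "lie (x \<otimes> b) (y \<otimes> c) = lie x y \<otimes> (b * c)"
  for x y :: 'a and b c :: 'b
  unfolding lie_tensor_def
  by (subst tensor_lift_tensor[OF bilinear_current_outer], subst tensor_lift_tensor[OF bilinear_current_inner])
     (rule refl)

instance
proof
  fix s t u :: "'a \<otimes> 'b" and a :: complex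
  have add_left: "lie (s + t) u = lie s u + lie t u" for s t u :: "'a \<otimes> 'b"
    by (simp add: lie_tensor_def tensor_lift_add bilinear_current_outer)
  have add_right: "lie s (t + u) = lie s t + lie s u" for s t u :: "'a \<otimes> 'b"
    by (simp add: lie_tensor_def tensor_lift_add bilinear_current_inner tensor_lift_fun_add)
  have scale_right: "lie s (a *\<^sub>C t) = a *\<^sub>C lie s t" for a and s t :: "'a \<otimes> 'b"
    by (simp add: lie_tensor_def tensor_lift_scale bilinear_current_inner tensor_lift_fun_scale)
  show "lie (s + t) u = lie s u + lie t u" by (rule add_left)
  show "lie s (t + u) = lie s t + lie s u" by (rule add_right)
  show "lie (a *\<^sub>C s) t = a *\<^sub>C lie s t"
    by (simp add: lie_tensor_def tensor_lift_scale bilinear_current_outer)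
  show "lie s (a *\<^sub>C t) = a *\<^sub>C lie s t" by (rule scale_right)
  have tensor_uminus: "(- x) \<otimes> b = - (x \<otimes> b)" for x :: 'a and b :: 'b
    by (metis add.right_inverse add_eq_0_iff complex_vector.scale_zero_left tensor_add_left tensor_scale_left)
  have anti: "lie s t + lie t s = 0" for s t :: "'a \<otimes> 'b"
  proof (induction s rule: tensor_induct)
    case (pure x b)
    show ?case
    proof (induction t rule: tensor_induct)
      case (pure y c)
      show ?case
        by (simp add: lie_current lie_antisym[of y x] mult.commute tensor_uminus)
    next
      case (add t t')
      have "lie (x \<otimes> b) (t + t') + lie (t + t') (x \<otimes> b)
          = (lie (x \<otimes> b) t + lie t (x \<otimes> b)) + (lie (x \<otimes> b) t' + lie t' (x \<otimes> b))"
        by (simp only: add_left add_right add.assoc add.left_commute)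
      then show ?case using add by simp
    qed
  next
    case (add s s')
    have "lie (s + s') t + lie t (s + s') = (lie s t + lie t s) + (lie s' t + lie t s')"
      by (simp only: add_left add_right add.assoc add.left_commute)
    then show ?case using add by simp
  qed
  show "lie s s = 0"
  proof (induction s rule: tensor_induct)
    case (pure x b)
    show ?case
      by (simp add: lie_current lie_self) (metis complex_vector.scale_zero_left tensor_scale_left)
  next
    case (add s t)
    then show ?case using anti[of s t] by (simp add: add_left add_right add.commute)
  qed
  have zero_left: "0 \<otimes> b = (0 :: 'a \<otimes> 'b)" for b :: 'b
    by (metis complex_vector.scale_zero_left tensor_scale_left)
  define J where "J s t u = lie s (lie t u) + lie t (lie u s) + lie u (lie s t)" for s t u :: "'a \<otimes> 'b"
  have J_add: "J (s + s') t u = J s t u + J s' t u" for s s' t u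
    unfolding J_def by (simp only: add_left add_right) (simp add: algebra_simps)
  have J_rot: "J s t u = J t u s" for s t u
    unfolding J_def by (simp add: algebra_simps)
  have J_pure: "J (x \<otimes> b) (y \<otimes> c) (z \<otimes> d) = 0" for x y z b c d
  proof -
    have "J (x \<otimes> b) (y \<otimes> c) (z \<otimes> d)
        = (lie x (lie y z) + lie y (lie z x) + lie z (lie x y)) \<otimes> (b * c * d)"
      unfolding J_def by (simp add: lie_current tensor_add_left mult_ac)
    then show ?thesis by (simp add: lie_jacobi zero_left)
  qed
  have J1: "J (x \<otimes> b) (y \<otimes> c) u = 0" for x b y c u
  proof (induction u rule: tensor_induct)
    case (pure z d)
    show ?case by (rule J_pure)
  next
    case (add u u')
    then show ?case by (metis J_rot J_add add.right_neutral)
  qed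
  have J2: "J (x \<otimes> b) t u = 0" for x b t u
  proof (induction t rule: tensor_induct)
    case (pure z d)
    show ?case by (rule J1)
  next
    case (add t t')
    then show ?case by (metis J_rot J_add add.right_neutral)
  qed
  have "J s t u = 0"
  proof (induction s rule: tensor_induct)
    case (pure z d)
    show ?case by (rule J2)
  next
    case (add s s')
    then show ?case by (simp add: J_add)
  qed
  then show "lie s (lie t u) + lie t (lie u s) + lie u (lie s t) = 0"
    by (simp add: J_def)
qed

end

section \<open>Laurent polynomials and their derivations\<close>

text \<open>Since \<open>int ^ 'n\<close> is the additive group \<open>\<int>\<^sup>n\<close>, the convolution algebra
  \<open>(int ^ 'n) \<Rightarrow>\<^sub>0 complex\<close> is the algebra \<open>A\<^sub>n\<close> of Laurent polynomials, \<open>t\<^sup>m\<close> being the basis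
  element at \<open>m\<close>.\<close>

type_synonym 'n laurent = "(int ^ 'n) \<Rightarrow>\<^sub>0 complex"

definition tpow :: "int ^ 'n \<Rightarrow> 'n::finite laurent"
  where "tpow m = Poly_Mapping.single m 1"

definition derivation :: "('n::finite laurent \<Rightarrow> 'n laurent) \<Rightarrow> bool"
  where "derivation D \<longleftrightarrow> clinear D \<and> (\<forall>f g. D (f * g) = D f * g + f * D g)"

typedef (overloaded) 'n witt = "{D :: 'n::finite laurent \<Rightarrow> 'n laurent. derivation D}"
  morphisms der_apply Abs_witt
proof
  show "(\<lambda>_. 0) \<in> {D :: 'n laurent \<Rightarrow> 'n laurent. derivation D}"
    by (simp add: derivation_def) (rule clinearI, simp_all)
qed

setup_lifting type_definition_witt

lemma derivationI:
  assumes "\<And>f g. D (f + g) = D f + D g" "\<And>c f. D (c *\<^sub>C f) = c *\<^sub>C D f"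
    and "\<And>f g. D (f * g) = D f * g + f * D g"
  shows "derivation D"
  using assms by (simp add: derivation_def clinearI)

lemma derivationD:
  assumes "derivation D"
  shows "D (f + g) = D f + D g" "D (c *\<^sub>C f) = c *\<^sub>C D f" "D (f * g) = D f * g + f * D g"
    "D (f - g) = D f - D g"
proof -
  show "D (f + g) = D f + D g" for f g
    using assms clinear_add unfolding derivation_def by blast
  then have "D (f - g) + D g = D f" by (metis diff_add_cancel)
  then show "D (f - g) = D f - D g" by (simp add: algebra_simps)
qed (use assms clinear_scale in \<open>auto simp: derivation_def\<close>)

instantiation witt :: (finite) lie_algebra
begin
lift_definition zero_witt :: "'a witt" is "\<lambda>_. 0"
  by (rule derivationI) simp_all
lift_definition plus_witt :: "'a witt \<Rightarrow> 'a witt \<Rightarrow> 'a witt" is "\<lambda>D E f. D f + E f"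
  by (rule derivationI) (simp_all add: derivationD scaleC_add_right algebra_simps)
lift_definition uminus_witt :: "'a witt \<Rightarrow> 'a witt" is "\<lambda>D f. - D f"
  by (rule derivationI) (simp_all add: derivationD)
lift_definition minus_witt :: "'a witt \<Rightarrow> 'a witt \<Rightarrow> 'a witt" is "\<lambda>D E f. D f - E f"
  by (rule derivationI) (simp_all add: derivationD complex_vector.scale_right_diff_distrib algebra_simps)
lift_definition scaleC_witt :: "complex \<Rightarrow> 'a witt \<Rightarrow> 'a witt" is "\<lambda>c D f. c *\<^sub>C D f"
  by (rule derivationI)
     (simp_all add: derivationD scaleC_add_right mult_scaleC_left mult_scaleC_right mult.commute)
lift_definition lie_witt :: "'a witt \<Rightarrow> 'a witt \<Rightarrow> 'a witt" is "\<lambda>D E f. D (E f) - E (D f)"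
  by (rule derivationI)
     (simp_all add: derivationD complex_vector.scale_right_diff_distrib algebra_simps)
instance
  by standard
     (transfer; simp add: fun_eq_iff derivationD scaleC_add_right scaleC_add_left
        complex_vector.scale_right_diff_distrib)+
end

lemma lie_witt_apply: "der_apply (lie D E) f = der_apply D (der_apply E f) - der_apply E (der_apply D f)"
  by transfer simp

lemma derivation_der_apply: "derivation (der_apply D)"
  using der_apply by auto

lemma clinear_der_apply: "clinear (der_apply D)"
  using derivation_der_apply derivation_def by blast

lemma witt_eqI: "(\<And>f. der_apply D f = der_apply E f) \<Longrightarrow> D = E"
  by transfer auto

lifting_forget poly_mapping.lifting

text \<open>\<open>W\<^sub>n\<close> is an \<open>A\<^sub>n\<close>-module: \<open>(a D) f = a (D f)\<close>.\<close>

lift_definition witt_mult :: "'n::finite laurent \<Rightarrow> 'n witt \<Rightarrow> 'n witt" is "\<lambda>a D f. a * D f"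
  by (rule derivationI) (simp_all add: derivationD mult_scaleC_right algebra_simps)

definition euler_fun :: "'n::finite \<Rightarrow> 'n laurent \<Rightarrow> 'n laurent"
  where "euler_fun i = Poly_Mapping.mapp (\<lambda>m c. of_int (m $ i) * c)"

lemma lookup_euler_fun: "Poly_Mapping.lookup (euler_fun i f) m = of_int (m $ i) * Poly_Mapping.lookup f m"
  by (simp add: euler_fun_def lookup_mapp when_def in_keys_iff)

lemma euler_fun_add: "euler_fun i (f + g) = euler_fun i f + euler_fun i g"
  by (rule poly_mapping_eqI) (simp add: lookup_euler_fun lookup_add algebra_simps)

lemma euler_fun_single: "euler_fun i (Poly_Mapping.single m c) = Poly_Mapping.single m (of_int (m $ i) * c)"
  by (rule poly_mapping_eqI) (simp add: lookup_euler_fun lookup_single when_def)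

lemma euler_fun_mult: "euler_fun i (f * g) = euler_fun i f * g + f * euler_fun i g"
proof (induction f rule: poly_mapping_add_induct)
  case (single m c)
  show ?case
  proof (induction g rule: poly_mapping_add_induct)
    case (single m' c')
    show ?case
      by (simp add: mult_single euler_fun_single single_add[symmetric] algebra_simps)
  qed (simp add: euler_fun_add algebra_simps)
qed (simp add: euler_fun_add algebra_simps)

text \<open>\<open>d\<^sub>i = t\<^sub>i d/dt\<^sub>i\<close>, i.e. \<open>d\<^sub>i t\<^sup>m = m\<^sub>i t\<^sup>m\<close>.\<close>

lift_definition euler :: "'n::finite \<Rightarrow> 'n witt" is euler_fun
proof (rule derivationI)
  fix i :: 'n and c and f :: "'n laurent"
  show "euler_fun i (c *\<^sub>C f) = c *\<^sub>C euler_fun i f"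
    by (rule poly_mapping_eqI) (simp add: lookup_euler_fun scaleC_complex_def)
qed (simp_all add: euler_fun_add euler_fun_mult)

section \<open>The Lie algebra \<open>W\<^sub>n \<ltimes> (S \<otimes> A\<^sub>n)\<close>\<close>

definition witt_act :: "'n::finite witt \<Rightarrow> 's::complex_vector \<otimes> 'n laurent \<Rightarrow> 's \<otimes> 'n laurent"
  where "witt_act D = tensor_map id (der_apply D)"

lemma clinear_id: "clinear id"
  by (rule clinearI) simp_all

lemma witt_act_tensor: "witt_act D (s \<otimes> f) = s \<otimes> der_apply D f"
  by (simp add: witt_act_def tensor_map_tensor clinear_id clinear_der_apply)

lemma witt_act_add: "witt_act D (x + y) = witt_act D x + witt_act D y"
  and witt_act_scale: "witt_act D (c *\<^sub>C x) = c *\<^sub>C witt_act D x"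
  by (simp_all add: witt_act_def clinear_add clinear_scale clinear_tensor_map clinear_id clinear_der_apply)

lemma witt_act_diff: "witt_act D (x - y) = witt_act D x - witt_act D y"
  by (metis add_diff_cancel_right' diff_add_cancel witt_act_add)

lemma witt_act_add_left: "witt_act (D + E) x = witt_act D x + witt_act E x"
  by (induction x rule: tensor_induct)
     (simp_all add: witt_act_tensor witt_act_add plus_witt.rep_eq tensor_add_right)

lemma witt_act_scale_left: "witt_act (c *\<^sub>C D) x = c *\<^sub>C witt_act D x"
  by (induction x rule: tensor_induct)
     (simp_all add: witt_act_tensor witt_act_add scaleC_witt.rep_eq tensor_scale_right scaleC_add_right)

lemma tensor_diff_right: "x \<otimes> (y - y') = x \<otimes> y - x \<otimes> y'"
  by (metis add_diff_cancel_right' diff_add_cancel tensor_add_right)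

lemma witt_act_lie: "witt_act (lie D E) x = witt_act D (witt_act E x) - witt_act E (witt_act D x)"
  by (induction x rule: tensor_induct)
     (simp_all add: witt_act_tensor witt_act_add lie_witt_apply tensor_diff_right)

context
  notes [[typedef_overloaded]]
begin

datatype (dead 's, dead 'n) ext_witt =
  Ext_Witt (witt_part: "'n::finite witt") (abelian_part: "'s::complex_vector \<otimes> 'n laurent")

end

instantiation ext_witt :: (complex_vector, finite) lie_algebra
begin
definition zero_ext_witt :: "('a, 'b) ext_witt"
  where "zero_ext_witt = Ext_Witt 0 0"
definition plus_ext_witt :: "('a, 'b) ext_witt \<Rightarrow> ('a, 'b) ext_witt \<Rightarrow> ('a, 'b) ext_witt"
  where "plus_ext_witt X Y = Ext_Witt (witt_part X + witt_part Y) (abelian_part X + abelian_part Y)"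
definition uminus_ext_witt :: "('a, 'b) ext_witt \<Rightarrow> ('a, 'b) ext_witt"
  where "uminus_ext_witt X = Ext_Witt (- witt_part X) (- abelian_part X)"
definition minus_ext_witt :: "('a, 'b) ext_witt \<Rightarrow> ('a, 'b) ext_witt \<Rightarrow> ('a, 'b) ext_witt"
  where "minus_ext_witt X Y = Ext_Witt (witt_part X - witt_part Y) (abelian_part X - abelian_part Y)"
definition scaleC_ext_witt :: "complex \<Rightarrow> ('a, 'b) ext_witt \<Rightarrow> ('a, 'b) ext_witt"
  where "scaleC_ext_witt c X = Ext_Witt (c *\<^sub>C witt_part X) (c *\<^sub>C abelian_part X)"
definition lie_ext_witt :: "('a, 'b) ext_witt \<Rightarrow> ('a, 'b) ext_witt \<Rightarrow> ('a, 'b) ext_witt"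
  where "lie_ext_witt X Y = Ext_Witt (lie (witt_part X) (witt_part Y))
    (witt_act (witt_part X) (abelian_part Y) - witt_act (witt_part Y) (abelian_part X))"
lemmas ext_witt_defs = zero_ext_witt_def plus_ext_witt_def uminus_ext_witt_def minus_ext_witt_def
  scaleC_ext_witt_def lie_ext_witt_def
instance
proof
  fix X Y Z :: "('a, 'b) ext_witt" and c d :: complex
  show "lie X (lie Y Z) + lie Y (lie Z X) + lie Z (lie X Y) = 0"
    using lie_jacobi[of "witt_part X" "witt_part Y" "witt_part Z"]
    by (simp add: ext_witt_defs witt_act_lie witt_act_diff)
qed (simp_all add: ext_witt_defs scaleC_add_right scaleC_add_left lie_add_left lie_add_right
      lie_scale_left lie_scale_right lie_self witt_act_add witt_act_scale witt_act_add_left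
      witt_act_scale_left complex_vector.scale_right_diff_distrib)
end

text \<open>\<open>D(u, r) = \<Sum>\<^sub>i u\<^sub>i t\<^sup>r d\<^sub>i\<close>; the two bracket formulas below confirm the conventions.\<close>

definition witt_D :: "complex ^ 'n \<Rightarrow> int ^ 'n \<Rightarrow> 'n::finite witt"
  where "witt_D u r = (\<Sum>i\<in>UNIV. u $ i *\<^sub>C witt_mult (tpow r) (euler i))"

definition pairing :: "complex ^ 'n \<Rightarrow> int ^ 'n \<Rightarrow> complex"
  where "pairing u m = (\<Sum>i\<in>UNIV. u $ i * of_int (m $ i))"

lemma der_apply_sum: "der_apply (sum F A) f = (\<Sum>i\<in>A. der_apply (F i) f)"
  by (induction A rule: infinite_finite_induct) (simp_all add: zero_witt.rep_eq plus_witt.rep_eq)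

lemma single_sum: "Poly_Mapping.single k (sum f A) = (\<Sum>i\<in>A. Poly_Mapping.single k (f i))"
  by (induction A rule: infinite_finite_induct) (simp_all add: single_add)

lemma witt_D_tpow: "der_apply (witt_D u r) (tpow m) = pairing u m *\<^sub>C tpow (m + r)"
  by (simp add: witt_D_def der_apply_sum scaleC_witt.rep_eq witt_mult.rep_eq euler.rep_eq tpow_def
      euler_fun_single mult_single scaleC_single pairing_def add.commute single_sum)

lemma witt_eq_tpowI:
  assumes "\<And>m. der_apply D (tpow m) = der_apply E (tpow m)"
  shows "D = E"
proof (rule witt_eqI)
  fix f
  show "der_apply D f = der_apply E f"
  proof (induction f rule: poly_mapping_add_induct)
    case (single m c)
    have "Poly_Mapping.single m c = c *\<^sub>C tpow m" by (simp add: tpow_def scaleC_single)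
    then show ?case by (simp add: assms clinear_scale[OF clinear_der_apply])
  qed (simp add: clinear_add[OF clinear_der_apply])
qed

lemma lie_witt_D: "lie (witt_D u r) (witt_D v s) = witt_D (pairing u s *s v - pairing v r *s u) (r + s)"
proof (rule witt_eq_tpowI)
  fix m :: "int ^ 'a"
  have 1: "pairing w (m + m') = pairing w m + pairing w m'" for w :: "complex ^ 'a" and m m'
    by (simp add: pairing_def algebra_simps sum.distrib)
  have 2: "pairing (c *s w - d *s w') m = c * pairing w m - d * pairing w' m" for w w' :: "complex ^ 'a" and c d m
    by (simp add: pairing_def algebra_simps sum_subtractf sum_distrib_left)
  have "der_apply (lie (witt_D u r) (witt_D v s)) (tpow m)
      = (pairing v m * pairing u (m + s) - pairing u m * pairing v (m + r)) *\<^sub>C tpow (m + (r + s))"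
    by (simp add: lie_witt_apply witt_D_tpow clinear_scale[OF clinear_der_apply]
        complex_vector.scale_left_diff_distrib add_ac)
  also have "\<dots> = der_apply (witt_D (pairing u s *s v - pairing v r *s u) (r + s)) (tpow m)"
    by (simp add: witt_D_tpow 1 2 algebra_simps)
  finally show "der_apply (lie (witt_D u r) (witt_D v s)) (tpow m)
      = der_apply (witt_D (pairing u s *s v - pairing v r *s u) (r + s)) (tpow m)" .
qed

lemma lie_witt_D_abelian:
  fixes s :: "'s::complex_vector" and r m :: "int ^ 'n::finite"
  shows "lie (Ext_Witt (witt_D u r) 0) (Ext_Witt 0 (s \<otimes> tpow m)) = Ext_Witt 0 (pairing u m *\<^sub>C (s \<otimes> tpow (m + r)))"
proof -
  have "lie D 0 = 0" for D :: "'n witt"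
    by (metis complex_vector.scale_zero_left lie_scale_right)
  moreover have "witt_act 0 x = 0" for x :: "'s \<otimes> 'n laurent"
    by (metis complex_vector.scale_zero_left witt_act_scale_left)
  ultimately show ?thesis
    by (simp add: lie_ext_witt_def witt_act_tensor witt_D_tpow tensor_scale_right)
qed

section \<open>Enveloping algebra, modules and induction\<close>

text \<open>The universal enveloping algebra: the free associative algebra on the underlying set of
  \<open>\<gg>\<close> (words in \<open>\<gg>\<close> under concatenation) modulo linearity of \<open>\<gg> \<rightarrow> U(\<gg>)\<close> and
  \<open>x y - y x = [x, y]\<close>.\<close>

instantiation list :: (type) monoid_add
begin
definition zero_list :: "'a list" where "zero_list = []"
definition plus_list :: "'a list \<Rightarrow> 'a list \<Rightarrow> 'a list" where "plus_list = (@)"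
instance by standard (simp_all add: zero_list_def plus_list_def)
end

definition letter :: "'g \<Rightarrow> 'g list \<Rightarrow>\<^sub>0 complex"
  where "letter x = Poly_Mapping.single [x] 1"

definition uea_rels :: "('g::lie_algebra list \<Rightarrow>\<^sub>0 complex) set" where
  "uea_rels =
     {letter (x + y) - letter x - letter y | x y. True} \<union>
     {letter (c *\<^sub>C x) - c *\<^sub>C letter x | c x. True} \<union>
     {letter x * letter y - letter y * letter x - letter (lie x y) | x y. True}"

definition two_sided_ideal :: "('w::monoid_add \<Rightarrow>\<^sub>0 complex) set \<Rightarrow> ('w \<Rightarrow>\<^sub>0 complex) set"
  where "two_sided_ideal R = cspan {a * r * b | a r b. r \<in> R}"

lemma two_sided_ideal_mult_left: "x \<in> two_sided_ideal R \<Longrightarrow> p * x \<in> two_sided_ideal R"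
  unfolding two_sided_ideal_def
proof (induction rule: complex_vector.span_induct_alt)
  case base
  show ?case by (simp add: complex_vector.span_zero)
next
  case (step c x y)
  from step(1) obtain a r b where x: "x = a * r * b" and r: "r \<in> R" by blast
  have "p * x = (p * a) * r * b" by (simp add: x mult.assoc)
  then have "p * x \<in> cspan {a * r * b | a r b. r \<in> R}"
    using r by (intro complex_vector.span_base) blast
  then show ?case
    using step by (simp add: distrib_left mult_scaleC_right complex_vector.span_add complex_vector.span_scale)
qed

lemma two_sided_ideal_mult_right: "x \<in> two_sided_ideal R \<Longrightarrow> x * p \<in> two_sided_ideal R"
  unfolding two_sided_ideal_def
proof (induction rule: complex_vector.span_induct_alt)
  case base
  show ?case by (simp add: complex_vector.span_zero)
next
  case (step c x y)
  from step(1) obtain a r b where x: "x = a * r * b" and r: "r \<in> R" by blast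
  have "x * p = a * r * (b * p)" by (simp add: x mult.assoc)
  then have "x * p \<in> cspan {a * r * b | a r b. r \<in> R}"
    using r by (intro complex_vector.span_base) blast
  then show ?case
    using step by (simp add: distrib_right mult_scaleC_left complex_vector.span_add complex_vector.span_scale)
qed

quotient_type (overloaded) 'g uea = "'g::lie_algebra list \<Rightarrow>\<^sub>0 complex"
    / "\<lambda>p q. p - q \<in> two_sided_ideal uea_rels"
  unfolding two_sided_ideal_def by (rule equivp_diff_cspan)

lemma lookup_mult_Nil:
  "Poly_Mapping.lookup (p * q) [] = Poly_Mapping.lookup p [] * Poly_Mapping.lookup (q :: 'g list \<Rightarrow>\<^sub>0 complex) []"
proof (induction p rule: poly_mapping_add_induct)
  case (single v c)
  show ?case
  proof (induction q rule: poly_mapping_add_induct)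
    case (single w d)
    show ?case by (auto simp: mult_single lookup_single when_def plus_list_def)
  qed (simp add: lookup_add distrib_left)
qed (simp add: lookup_add distrib_right)

lemma one_notin_uea_ideal: "1 \<notin> two_sided_ideal (uea_rels :: ('g::lie_algebra list \<Rightarrow>\<^sub>0 complex) set)"
proof
  have "Poly_Mapping.lookup p [] = 0" if "p \<in> two_sided_ideal uea_rels" for p :: "'g list \<Rightarrow>\<^sub>0 complex"
    using that unfolding two_sided_ideal_def
  proof (induction rule: complex_vector.span_induct_alt)
    case (step c x y)
    have "Poly_Mapping.lookup r [] = 0" if "r \<in> uea_rels" for r :: "'g list \<Rightarrow>\<^sub>0 complex"
      using that by (auto simp: uea_rels_def letter_def lookup_minus lookup_single lookup_mult_Nil scaleC_complex_def)
    then show ?case using step by (auto simp: lookup_add lookup_mult_Nil)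
  qed simp
  moreover assume "1 \<in> two_sided_ideal (uea_rels :: ('g list \<Rightarrow>\<^sub>0 complex) set)"
  ultimately have "Poly_Mapping.lookup (1 :: 'g list \<Rightarrow>\<^sub>0 complex) [] = 0" by blast
  then show False by (simp add: lookup_one zero_list_def)
qed

lemma ideal_eqI: "p = q \<Longrightarrow> p - q \<in> two_sided_ideal R"
  unfolding two_sided_ideal_def by (rule cspan_eqI)

lemma ideal_mult_cong:
  assumes "p - p' \<in> two_sided_ideal R" "q - q' \<in> two_sided_ideal R"
  shows "p * q - p' * q' \<in> two_sided_ideal R"
proof -
  have "p * q - p' * q' = (p - p') * q + p' * (q - q')" by (simp add: algebra_simps)
  then show ?thesis
    using two_sided_ideal_mult_right[OF assms(1), of q] two_sided_ideal_mult_left[OF assms(2), of p']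
    by (simp add: two_sided_ideal_def complex_vector.span_add)
qed

instantiation uea :: (lie_algebra) "{complex_vector, ring_1}"
begin
lift_definition zero_uea :: "'a uea" is 0 .
lift_definition one_uea :: "'a uea" is 1 .
lift_definition plus_uea :: "'a uea \<Rightarrow> 'a uea \<Rightarrow> 'a uea" is "(+)"
  unfolding two_sided_ideal_def by (rule cspan_diff_cong)
lift_definition uminus_uea :: "'a uea \<Rightarrow> 'a uea" is uminus
  unfolding two_sided_ideal_def by (rule cspan_neg_cong)
lift_definition minus_uea :: "'a uea \<Rightarrow> 'a uea \<Rightarrow> 'a uea" is "(-)"
  unfolding two_sided_ideal_def by (rule cspan_diff_cong2)
lift_definition scaleC_uea :: "complex \<Rightarrow> 'a uea \<Rightarrow> 'a uea" is scaleC
  unfolding two_sided_ideal_def by (rule cspan_scale_cong)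
lift_definition times_uea :: "'a uea \<Rightarrow> 'a uea \<Rightarrow> 'a uea" is "(*)"
  by (rule ideal_mult_cong)
instance
proof
  fix s t u :: "'a uea" and a b :: complex
  show "s + t + u = s + (t + u)" by transfer (rule ideal_eqI, rule add.assoc)
  show "s + t = t + s" by transfer (rule ideal_eqI, rule add.commute)
  show "0 + s = s" by transfer (rule ideal_eqI, simp)
  show "- s + s = 0" by transfer (rule ideal_eqI, simp)
  show "s - t = s + - t" by transfer (rule ideal_eqI, simp)
  show "a *\<^sub>C (s + t) = a *\<^sub>C s + a *\<^sub>C t" by transfer (rule ideal_eqI, rule scaleC_add_right)
  show "(a + b) *\<^sub>C s = a *\<^sub>C s + b *\<^sub>C s" by transfer (rule ideal_eqI, rule scaleC_add_left)
  show "a *\<^sub>C (b *\<^sub>C s) = (a * b) *\<^sub>C s" by transfer (rule ideal_eqI, rule scaleC_scaleC)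
  show "1 *\<^sub>C s = s" by transfer (rule ideal_eqI, rule scaleC_one)
  show "s * t * u = s * (t * u)" by transfer (rule ideal_eqI, rule mult.assoc)
  show "1 * s = s" by transfer (rule ideal_eqI, simp)
  show "s * 1 = s" by transfer (rule ideal_eqI, simp)
  show "(s + t) * u = s * u + t * u" by transfer (rule ideal_eqI, rule distrib_right)
  show "s * (t + u) = s * t + s * u" by transfer (rule ideal_eqI, rule distrib_left)
  show "(0 :: 'a uea) \<noteq> 1"
  proof (transfer, rule notI)
    assume "(0 :: 'a list \<Rightarrow>\<^sub>0 complex) - 1 \<in> two_sided_ideal uea_rels"
    then have "- (0 - 1) \<in> two_sided_ideal (uea_rels :: ('a list \<Rightarrow>\<^sub>0 complex) set)"
      unfolding two_sided_ideal_def by (rule complex_vector.span_neg)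
    then show False by (simp add: one_notin_uea_ideal)
  qed
qed
end

lift_definition uea_gen :: "'g::lie_algebra \<Rightarrow> 'g uea" is letter .

lemma uea_gen_add: "uea_gen (x + y) = uea_gen x + uea_gen y"
  and uea_gen_scale: "uea_gen (c *\<^sub>C x) = c *\<^sub>C uea_gen x"
  and uea_gen_lie: "uea_gen (lie x y) = uea_gen x * uea_gen y - uea_gen y * uea_gen x"
proof -
  have rel: "r \<in> two_sided_ideal R" if "r \<in> R" for r and R :: "('a list \<Rightarrow>\<^sub>0 complex) set"
  proof -
    have "1 * r * 1 \<in> two_sided_ideal R"
      unfolding two_sided_ideal_def using that by (intro complex_vector.span_base) blast
    then show ?thesis by simp
  qed
  show "uea_gen (x + y) = uea_gen x + uea_gen y"
    by transfer (rule rel, unfold uea_rels_def diff_diff_eq, blast)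
  show "uea_gen (c *\<^sub>C x) = c *\<^sub>C uea_gen x"
    by transfer (rule rel, unfold uea_rels_def, blast)
  have "uea_gen x * uea_gen y - uea_gen y * uea_gen x = uea_gen (lie x y)"
    by transfer (rule rel, unfold uea_rels_def, blast)
  then show "uea_gen (lie x y) = uea_gen x * uea_gen y - uea_gen y * uea_gen x" by simp
qed

text \<open>A module over a subalgebra \<open>P\<close> of \<open>\<gg>\<close> is given by the action map \<open>\<rho>\<close>, whose values
  outside \<open>P\<close> are irrelevant.\<close>

definition lie_module_on :: "'g::lie_algebra set \<Rightarrow> ('g \<Rightarrow> 'v::complex_vector \<Rightarrow> 'v) \<Rightarrow> bool"
  where "lie_module_on P \<rho> \<longleftrightarrow>
    (\<forall>x\<in>P. clinear (\<rho> x)) \<and>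
    (\<forall>x\<in>P. \<forall>y\<in>P. \<forall>v. \<rho> (x + y) v = \<rho> x v + \<rho> y v) \<and>
    (\<forall>c. \<forall>x\<in>P. \<forall>v. \<rho> (c *\<^sub>C x) v = c *\<^sub>C \<rho> x v) \<and>
    (\<forall>x\<in>P. \<forall>y\<in>P. \<forall>v. \<rho> (lie x y) v = \<rho> x (\<rho> y v) - \<rho> y (\<rho> x v))"

definition irreducible_on :: "'g::lie_algebra set \<Rightarrow> ('g \<Rightarrow> 'v::complex_vector \<Rightarrow> 'v) \<Rightarrow> bool"
  where "irreducible_on P \<rho> \<longleftrightarrow> lie_module_on P \<rho> \<and> (\<exists>v::'v. v \<noteq> 0) \<and>
    (\<forall>W. csubspace W \<and> (\<forall>x\<in>P. \<rho> x ` W \<subseteq> W) \<longrightarrow> W = {0} \<or> W = UNIV)"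

text \<open>The induced module \<open>U(\<gg>) \<otimes>\<^bsub>U(P)\<^esub> Z\<close> is \<open>U(\<gg>) \<otimes> Z\<close> modulo the subspace below, with
  \<open>\<gg>\<close> acting by left multiplication; \<open>U(P)\<close> being generated by \<open>P\<close>, it is enough to balance the
  elements of \<open>P\<close>.\<close>

definition induced_rels :: "'g::lie_algebra set \<Rightarrow> ('g \<Rightarrow> 'z \<Rightarrow> 'z) \<Rightarrow> ('g uea \<otimes> 'z::complex_vector) set"
  where "induced_rels P \<sigma> = cspan {(u * uea_gen x) \<otimes> z - u \<otimes> \<sigma> x z | u x z. x \<in> P}"

definition induced_action :: "'g::lie_algebra \<Rightarrow> 'g uea \<otimes> 'z::complex_vector \<Rightarrow> 'g uea \<otimes> 'z"
  where "induced_action x = tensor_map (\<lambda>u. uea_gen x * u) id"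

lemma induced_action_tensor: "induced_action x (u \<otimes> z) = (uea_gen x * u) \<otimes> z"
proof -
  have "p * (c *\<^sub>C q) = c *\<^sub>C (p * q)" for p q :: "'a uea" and c
    by transfer (rule ideal_eqI, rule mult_scaleC_right)
  then have "clinear (\<lambda>u. uea_gen x * u)" by (intro clinearI) (simp_all add: distrib_left)
  then show ?thesis by (simp add: induced_action_def tensor_map_tensor clinear_id)
qed

text \<open>\<open>\<rho>\<close> is, up to isomorphism, a quotient of the module induced from the \<open>P\<close>-module \<open>\<sigma>\<close>:
  the map \<open>\<phi>\<close> is the composition of \<open>U(\<gg>) \<otimes> Z \<rightarrow> U(\<gg>) \<otimes>\<^bsub>U(P)\<^esub> Z\<close> with a surjective
  homomorphism of \<open>\<gg>\<close>-modules.\<close>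

definition quotient_of_induced ::
    "'g::lie_algebra set \<Rightarrow> ('g \<Rightarrow> 'z::complex_vector \<Rightarrow> 'z) \<Rightarrow> ('g \<Rightarrow> 'v::complex_vector \<Rightarrow> 'v) \<Rightarrow> bool"
  where "quotient_of_induced P \<sigma> \<rho> \<longleftrightarrow>
    (\<exists>\<phi> :: 'g uea \<otimes> 'z \<Rightarrow> 'v. clinear \<phi> \<and> surj \<phi> \<and> (\<forall>t\<in>induced_rels P \<sigma>. \<phi> t = 0) \<and>
      (\<forall>x t. \<phi> (induced_action x t) = \<rho> x (\<phi> t)))"

definition algebra_hom :: "('b::comm_complex_algebra \<Rightarrow> complex) \<Rightarrow> bool"
  where "algebra_hom \<eta> \<longleftrightarrow> clinear \<eta> \<and> \<eta> 1 = 1 \<and> (\<forall>b c. \<eta> (b * c) = \<eta> b * \<eta> c)"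

definition single_point_evaluation ::
    "('g::lie_algebra \<otimes> 'b::comm_complex_algebra \<Rightarrow> 'v::complex_vector \<Rightarrow> 'v) \<Rightarrow> bool"
  where "single_point_evaluation \<rho> \<longleftrightarrow>
    (\<exists>\<eta>. algebra_hom \<eta> \<and> (\<forall>x b v. \<rho> (x \<otimes> b) v = \<eta> b *\<^sub>C \<rho> (x \<otimes> 1) v))"

definition subalgebra :: "'b::comm_complex_algebra set \<Rightarrow> bool"
  where "subalgebra A \<longleftrightarrow> csubspace A \<and> 1 \<in> A \<and> (\<forall>x\<in>A. \<forall>y\<in>A. x * y \<in> A)"

definition finitely_generated_algebra :: "'b::comm_complex_algebra itself \<Rightarrow> bool"
  where "finitely_generated_algebra _ \<longleftrightarrow>
    (\<exists>F :: 'b set. finite F \<and> (\<forall>A. subalgebra A \<and> F \<subseteq> A \<longrightarrow> A = UNIV))"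

section \<open>Weights and highest weight modules over \<open>(W\<^sub>n \<ltimes> (S \<otimes> A\<^sub>n)) \<otimes> B\<close>\<close>

type_synonym ('s, 'n, 'b) current = "('s, 'n) ext_witt \<otimes> 'b"

text \<open>A weight \<open>\<mu> \<in> H\<^sup>*\<close> is given by its values on the basis \<open>d\<^sub>i\<close> of \<open>H\<close>.\<close>

definition weight_space ::
    "(('s::complex_vector, 'n::finite, 'b::comm_complex_algebra) current \<Rightarrow> 'v::complex_vector \<Rightarrow> 'v)
      \<Rightarrow> complex ^ 'n \<Rightarrow> 'v set"
  where "weight_space \<rho> \<mu> = {v. \<forall>i. \<rho> (Ext_Witt (euler i) 0 \<otimes> 1) v = \<mu> $ i *\<^sub>C v}"

text \<open>Weight spaces for distinct weights are automatically independent, so it suffices that they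
  span.\<close>

definition weight_module ::
    "(('s::complex_vector, 'n::finite, 'b::comm_complex_algebra) current \<Rightarrow> 'v::complex_vector \<Rightarrow> 'v) \<Rightarrow> bool"
  where "weight_module \<rho> \<longleftrightarrow> cspan (\<Union>\<mu>. weight_space \<rho> \<mu>) = UNIV"

definition graded_piece ::
    "int ^ 'n \<Rightarrow> ('s::complex_vector, 'n::finite, 'b::comm_complex_algebra) current set"
  where "graded_piece m = cspan
    ({Ext_Witt (witt_mult (tpow m) (euler i)) 0 \<otimes> b | i b. True} \<union>
     {Ext_Witt 0 (s \<otimes> tpow m) \<otimes> b | s b. True})"

definition graded_sum ::
    "(int ^ 'n) set \<Rightarrow> ('s::complex_vector, 'n::finite, 'b::comm_complex_algebra) current set"
  where "graded_sum R = cspan (\<Union>r\<in>R. graded_piece r)"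

text \<open>The sum defining the positive part runs over \<open>d \<ge> 1\<close>, so that it meets the degree-\<open>K\<close> part
  only in \<open>0\<close>.\<close>

definition positive_part ::
    "(int ^ 'n) set \<Rightarrow> int ^ 'n
      \<Rightarrow> ('s::complex_vector, 'n::finite, 'b::comm_complex_algebra) current set"
  where "positive_part K \<beta> = graded_sum {r + int d *s \<beta> | r d. r \<in> K \<and> d \<ge> 1}"

definition parabolic ::
    "(int ^ 'n) set \<Rightarrow> int ^ 'n
      \<Rightarrow> ('s::complex_vector, 'n::finite, 'b::comm_complex_algebra) current set"
  where "parabolic K \<beta> = cspan (graded_sum K \<union> positive_part K \<beta>)"

text \<open>For \<open>x \<in> P\<^sub>0 \<oplus> P\<^sub>1\<close> the description operator picks the \<open>P\<^sub>0\<close>-component of \<open>x\<close>.\<close>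

definition extend_by_zero :: "'g::lie_algebra set \<Rightarrow> 'g set \<Rightarrow> ('g \<Rightarrow> 'z \<Rightarrow> 'z) \<Rightarrow> 'g \<Rightarrow> 'z \<Rightarrow> 'z"
  where "extend_by_zero P0 P1 \<sigma> x = \<sigma> (THE y. y \<in> P0 \<and> x - y \<in> P1)"

text \<open>\<open>\<rho>\<close> realises \<open>L(K, \<beta>, Z)\<close> for the module \<open>Z\<close> with action \<open>\<sigma>\<close>: it is an irreducible quotient of
  the generalised Verma module induced from \<open>Z\<close>.\<close>

definition irreducible_highest_weight_module ::
    "(int ^ 'n) set \<Rightarrow> int ^ 'n
      \<Rightarrow> (('s::complex_vector, 'n::finite, 'b::comm_complex_algebra) current \<Rightarrow> 'z::complex_vector \<Rightarrow> 'z)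
      \<Rightarrow> (('s, 'n, 'b) current \<Rightarrow> 'v::complex_vector \<Rightarrow> 'v) \<Rightarrow> bool"
  where "irreducible_highest_weight_module K \<beta> \<sigma> \<rho> \<longleftrightarrow>
    irreducible_on UNIV \<rho> \<and>
    quotient_of_induced (parabolic K \<beta>) (extend_by_zero (graded_sum K) (positive_part K \<beta>) \<sigma>) \<rho>"

definition additive_subgroup :: "'a::ab_group_add set \<Rightarrow> bool"
  where "additive_subgroup K \<longleftrightarrow> 0 \<in> K \<and> (\<forall>x\<in>K. \<forall>y\<in>K. x - y \<in> K)"

end

theory Submission
  imports Defs "HOL-Library.Function_Algebras" "HOL-Computational_Algebra.Fundamental_Theorem_Algebra"
begin

text \<open>Let \<open>L\<close> be the extended Witt algebra, \<open>L\<^sub>K\<close> its part of degrees in \<open>K\<close> and \<open>A\<^sub>K\<close> the algebra of Laurent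
polynomials with exponents in \<open>K\<close>. The elements \<open>b\<close> for which \<open>L \<otimes> b B\<close> acts by zero on the module \<open>V\<close> form
an ideal \<open>I\<close> of \<open>B\<close>. The claim is that \<open>I\<close> contains the kernel of an algebra homomorphism \<open>\<eta>\<close>, because then
\<open>x \<otimes> b\<close> acts like \<open>x \<otimes> \<eta>(b)\<close>.

The level of a degree is its \<open>\<beta>\<close>-coordinate. \<open>Z\<close> is embedded in \<open>V\<close> as the top component, and it suffices
to find \<open>\<eta>\<close> for \<open>Z\<close>: if \<open>L\<^sub>K \<otimes> J\<close> acts by zero on \<open>Z\<close> for an ideal \<open>J\<close>, the submodule \<open>(L \<otimes> J) V\<close> lies
strictly below the top component, so it is zero (\<open>vanishing_spreads_from_top\<close>).

The weight spaces of \<open>V\<close> one level below the top control the following space. To \<open>X \<in> L\<^sub>K \<otimes> B\<close> and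
\<open>v \<in> Z\<close> attach the function \<open>f \<mapsto> (f X) v\<close> on \<open>A\<^sub>K \<otimes> B\<close>. These functions span a module, the cover of \<open>Z\<close>,
over both \<open>L\<^sub>K \<otimes> B\<close> and \<open>A\<^sub>K \<otimes> B\<close>. Its weight spaces are finite dimensional: up to linear combinations,
its functions describe how elements of level \<open>1\<close> act on the vectors obtained from \<open>Z\<close> by an element of
level \<open>-1\<close>.

Now \<open>B\<close> acts on a weight space of the cover by commuting operators, and a joint eigenvector gives \<open>\<eta>\<close>. On
the eigenspace, the elements \<open>t\<^sup>k e \<otimes> b\<close> with \<open>\<eta>(b) = 0\<close> act linearly over \<open>A\<^sub>K\<close>, so that, after a shift by
\<open>t\<^sup>-\<^sup>k\<close>, they all act on one finite dimensional space. If all of them, for a fixed \<open>b\<close> and its multiples,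
kill a common nonzero function, then they kill a nonzero vector of \<open>Z\<close> and, by irreducibility, all of \<open>Z\<close>
(\<open>ann_of_killed_vector\<close>). Two facts of linear algebra provide such functions. If \<open>c b\<close> is a nonzero
multiple of \<open>b\<close> for some \<open>c\<close> with \<open>\<eta>(c) = 0\<close>, then the elements \<open>t\<^sup>k e \<otimes> b\<close> shift the eigenvalues of
\<open>d\<^sub>i \<otimes> c\<close> by infinitely many different amounts, hence are mostly zero, and then all zero
(\<open>ann_of_ker_eigen\<close>). If \<open>c b = 0\<close> for all such \<open>c\<close>, the elements \<open>t\<^sup>k e \<otimes> b\<close> commute and are combinations
of brackets, so that they have a joint eigenvector with eigenvalues \<open>0\<close>, by the argument for Lie's theorem
(\<open>ann_of_ker_socle\<close>). Both equations for \<open>c b\<close> are understood modulo the elements that are already known to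
act by zero. An element of the kernel of \<open>\<eta>\<close> that does not act by zero and has minimal rank on the cover
would lead to one of the two cases (\<open>ker_subset_ann\<close>).

If \<open>L\<^sub>K \<otimes> B\<close> acts by zero on \<open>Z\<close>, then the whole action on \<open>V\<close> is zero and any homomorphism \<open>\<eta>\<close> will do; one
exists by the Nullstellensatz.\<close>

section \<open>Linear maps and function spaces\<close>

instantiation "fun" :: (type, complex_vector) complex_vector
begin
definition scaleC_fun :: "complex \<Rightarrow> ('a \<Rightarrow> 'b) \<Rightarrow> 'a \<Rightarrow> 'b"
  where "scaleC_fun c f = (\<lambda>x. c *\<^sub>C f x)"
instance
  by standard (simp_all add: scaleC_fun_def fun_eq_iff scaleC_add_right scaleC_add_left scaleC_scaleC scaleC_one)
end

lemma scaleC_apply [simp]: "(c *\<^sub>C f) x = c *\<^sub>C f x"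
  by (simp add: scaleC_fun_def)

lemma clinear_0: "clinear f \<Longrightarrow> f 0 = 0"
  by (metis complex_vector.scale_zero_left clinear_scale)

lemma clinear_diff: "clinear f \<Longrightarrow> f (x - y) = f x - f y"
  by (metis add_diff_cancel_right' diff_add_cancel clinear_add)

lemma clinear_zero_on_cspan:
  assumes "clinear f" "\<And>x. x \<in> S \<Longrightarrow> f x = 0" "v \<in> cspan S"
  shows "f v = 0"
  using assms(3)
  by (induction rule: complex_vector.span_induct_alt)
     (simp_all add: assms clinear_0 clinear_add clinear_scale)

lemma clinear_cspan_into:
  assumes "clinear f" "\<And>x. x \<in> S \<Longrightarrow> f x \<in> W" "csubspace W" "v \<in> cspan S"
  shows "f v \<in> W"
  using assms(4)
  by (induction rule: complex_vector.span_induct_alt)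
     (simp_all add: assms clinear_0 clinear_add clinear_scale complex_vector.subspace_0
       complex_vector.subspace_add complex_vector.subspace_scale)

section \<open>Finite dimensional subspaces\<close>

lemma finite_dim_subset: "finite_dim W \<Longrightarrow> U \<subseteq> W \<Longrightarrow> finite_dim U"
  unfolding finite_dim_def by blast

lemma finite_dim_cspan: "finite_dim W \<Longrightarrow> finite_dim (cspan W)"
  unfolding finite_dim_def
  by (metis complex_vector.span_mono complex_vector.span_span)

lemma finite_dim_image:
  assumes "clinear f" "finite_dim W"
  shows "finite_dim (f ` W)"
proof -
  obtain F where F: "finite F" "W \<subseteq> cspan F" using assms(2) unfolding finite_dim_def by blast
  have "f ` W \<subseteq> cspan (f ` F)"
    using clinear_cspan_into[OF assms(1), of F "cspan (f ` F)"] F(2)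
    by (auto simp: complex_vector.span_base)
  then show ?thesis using F(1) unfolding finite_dim_def by blast
qed

lemma finite_dim_UN:
  assumes "finite A" "\<And>i. i \<in> A \<Longrightarrow> finite_dim (W i)"
  shows "finite_dim (\<Union>i\<in>A. W i)"
proof -
  obtain F where F: "\<And>i. i \<in> A \<Longrightarrow> finite (F i) \<and> W i \<subseteq> cspan (F i)"
    using assms(2) unfolding finite_dim_def by metis
  have "(\<Union>i\<in>A. W i) \<subseteq> cspan (\<Union>i\<in>A. F i)"
  proof
    fix x assume "x \<in> (\<Union>i\<in>A. W i)"
    then obtain i where i: "i \<in> A" "x \<in> cspan (F i)" using F by blast
    then show "x \<in> cspan (\<Union>i\<in>A. F i)"
      using complex_vector.span_mono[of "F i" "\<Union>i\<in>A. F i"] UN_upper[OF i(1), of F] by (auto dest: subsetD)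
  qed
  moreover have "finite (\<Union>i\<in>A. F i)" using F assms(1) by simp
  ultimately show ?thesis unfolding finite_dim_def by (intro exI conjI)
qed

lemma finite_dim_independent_bound:
  assumes "finite_dim W"
  obtains N where "\<And>S. S \<subseteq> W \<Longrightarrow> \<not> complex_vector.dependent S \<Longrightarrow> finite S \<and> card S \<le> N"
proof -
  obtain F where F: "finite F" "W \<subseteq> cspan F" using assms unfolding finite_dim_def by blast
  show ?thesis
  proof (rule that[of "card F"])
    fix S assume "S \<subseteq> W" "\<not> complex_vector.dependent S"
    then show "finite S \<and> card S \<le> card F"
      using complex_vector.independent_span_bound[OF F(1)] F(2) by fastforce
  qed
qed

lemma dim_psubset:
  assumes "finite_dim W" "csubspace U" "csubspace W" "U \<subset> W"
  shows "complex_vector.dim U < complex_vector.dim W"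
proof -
  obtain N where N: "\<And>S. S \<subseteq> W \<Longrightarrow> \<not> complex_vector.dependent S \<Longrightarrow> finite S \<and> card S \<le> N"
    using finite_dim_independent_bound[OF assms(1)] by blast
  obtain A where A: "A \<subseteq> U" "\<not> complex_vector.dependent A" "U \<subseteq> cspan A" "card A = complex_vector.dim U"
    using complex_vector.basis_exists[of U] by metis
  obtain C where C: "C \<subseteq> W" "\<not> complex_vector.dependent C" "W \<subseteq> cspan C" "card C = complex_vector.dim W"
    using complex_vector.basis_exists[of W] by metis
  obtain x where x: "x \<in> W" "x \<notin> U" using assms(4) by blast
  have "cspan A \<subseteq> U" using A(1) assms(2) by (simp add: complex_vector.span_minimal)
  then have xA: "x \<notin> cspan A" using x by blast
  then have ind: "\<not> complex_vector.dependent (insert x A)"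
    using A(2) complex_vector.independent_insertI by blast
  have "finite C" using N C by blast
  then have "finite (insert x A)" "card (insert x A) \<le> card C"
    using complex_vector.independent_span_bound[OF \<open>finite C\<close> ind] A(1) C(3) assms(4) x(1) by auto
  moreover have "x \<notin> A" using xA complex_vector.span_base by blast
  ultimately show ?thesis using A(4) C(4) by simp
qed

section \<open>Eigenvalues on finite dimensional invariant subspaces\<close>

text \<open>The operator \<open>\<Prod>\<^sub>m (h - m)\<close>, with \<open>m\<close> running over a list. Lists take the place of annihilating
polynomials in factored form, with concatenation corresponding to the product.\<close>

definition annih :: "('a::complex_vector \<Rightarrow> 'a) \<Rightarrow> complex list \<Rightarrow> 'a \<Rightarrow> 'a"
  where "annih h ms = foldr (\<lambda>m g. h g - m *\<^sub>C g) ms"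

lemma annih_simps [simp]:
  "annih h [] f = f" "annih h (m # ms) f = h (annih h ms f) - m *\<^sub>C annih h ms f"
  "annih h (ms @ ns) f = annih h ms (annih h ns f)"
  by (simp_all add: annih_def)

lemma clinear_annih: "clinear h \<Longrightarrow> clinear (annih h ms)"
proof (induction ms)
  case Nil then show ?case by (auto intro!: clinearI)
next
  case (Cons m ms)
  show ?case
    by (rule clinearI)
       (simp_all add: clinear_add[OF Cons.prems] clinear_scale[OF Cons.prems]
         clinear_add[OF Cons.IH[OF Cons.prems]] clinear_scale[OF Cons.IH[OF Cons.prems]]
         scaleC_add_right complex_vector.scale_right_diff_distrib mult.commute)
qed

lemma annih_commute1:
  assumes "clinear h"
  shows "annih h ms (h f) = h (annih h ms f)"
  by (induction ms) (simp_all add: assms clinear_diff clinear_scale)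

lemma annih_commute:
  assumes "clinear h"
  shows "annih h ms (annih h ns f) = annih h ns (annih h ms f)"
  by (induction ns)
     (simp_all add: assms clinear_diff[OF clinear_annih] clinear_scale[OF clinear_annih] annih_commute1)

lemma annih_eigen:
  assumes "h f = m *\<^sub>C f" "clinear h"
  shows "annih h ms f = (\<Prod>n\<leftarrow>ms. m - n) *\<^sub>C f"
  by (induction ms)
     (simp_all add: assms clinear_scale scaleC_one complex_vector.scale_left_diff_distrib left_diff_distrib mult.commute)

lemma annih_in:
  assumes "csubspace F" "h ` F \<subseteq> F" "f \<in> F"
  shows "annih h ms f \<in> F"
  using assms(3)
  by (induction ms) (use assms in \<open>auto intro!: complex_vector.subspace_diff complex_vector.subspace_scale\<close>)

lemma csubspace_annihilated:
  assumes "clinear h"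
  shows "csubspace {f. \<exists>ms. set ms \<subseteq> A \<and> annih h ms f = 0}" (is "csubspace ?S")
proof (rule complex_vector.subspaceI)
  have "annih h [] 0 = 0" by simp
  then show "0 \<in> ?S" by (intro CollectI exI[of _ "[]"]) simp
next
  fix x y assume "x \<in> ?S" "y \<in> ?S"
  then obtain ms ns where "set ms \<subseteq> A" "annih h ms x = 0" "set ns \<subseteq> A" "annih h ns y = 0" by blast
  then have "set (ms @ ns) \<subseteq> A \<and> annih h (ms @ ns) (x + y) = 0"
    using annih_commute[OF assms, of ms ns x]
    by (simp add: clinear_add[OF clinear_annih[OF assms]] clinear_0[OF clinear_annih[OF assms]])
  then show "x + y \<in> ?S" by blast
next
  fix c x assume "x \<in> ?S"
  then show "c *\<^sub>C x \<in> ?S" by (auto simp: clinear_scale[OF clinear_annih[OF assms]])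
qed

text \<open>A product of factors \<open>h - m\<close> with \<open>m \<in> A\<close> kills \<open>v\<close>, while it acts on the eigenvector \<open>v\<close> by the
scalar \<open>\<Prod> (a - m) \<noteq> 0\<close>.\<close>

lemma eigenvectors_sum_distinct:
  assumes "clinear h" "v \<in> cspan {w. \<exists>m\<in>A. h w = m *\<^sub>C w}" "h v = a *\<^sub>C v" "a \<notin> A"
  shows "v = 0"
proof -
  have "cspan {w. \<exists>m\<in>A. h w = m *\<^sub>C w} \<subseteq> {f. \<exists>ms. set ms \<subseteq> A \<and> annih h ms f = 0}"
  proof (rule complex_vector.span_minimal[OF _ csubspace_annihilated[OF assms(1)]], safe)
    fix w m assume "h w = m *\<^sub>C w" "m \<in> A"
    then show "\<exists>ms. set ms \<subseteq> A \<and> annih h ms w = 0" by (intro exI[of _ "[m]"]) simp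
  qed
  then obtain ms where ms: "set ms \<subseteq> A" "annih h ms v = 0" using assms(2) by blast
  then have "(\<Prod>n\<leftarrow>ms. a - n) *\<^sub>C v = 0" by (simp add: annih_eigen[OF assms(3,1)])
  moreover have "(\<Prod>n\<leftarrow>ms. a - n) \<noteq> 0"
    using ms(1) assms(4) by (auto simp: prod_list_zero_iff)
  ultimately show ?thesis by (simp add: complex_vector.scale_eq_0_iff)
qed

text \<open>Over \<open>\<complex>\<close> the polynomial splits, and its roots are peeled off one by one.\<close>

lemma polynomial_relation_annih:
  fixes h :: "'a::complex_vector \<Rightarrow> 'a"
  assumes h: "clinear h"
  shows "p \<noteq> 0 \<Longrightarrow> (\<Sum>i\<le>degree p. coeff p i *\<^sub>C (h ^^ i) f) = 0 \<Longrightarrow> \<exists>ms. annih h ms f = 0"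
proof (induction "degree p" arbitrary: p f)
  case 0
  then obtain c where "p = [:c:]" "c \<noteq> 0" by (metis degree_eq_zeroE pCons_0_0)
  then show ?case using 0 by (intro exI[of _ "[]"]) (simp add: complex_vector.scale_eq_0_iff)
next
  case (Suc n)
  then have "\<not> constant (poly p)" by (simp add: constant_degree)
  then obtain z where "poly p z = 0" using fundamental_theorem_of_algebra by blast
  then obtain q where q: "p = [:-z, 1:] * q" by (auto simp: poly_eq_0_iff_dvd elim: dvdE)
  then have q0: "q \<noteq> 0" using Suc.prems by auto
  have dp: "degree p = Suc (degree q)"
    unfolding q using q0 by (subst degree_mult_eq) auto
  have dq: "degree q = n" using dp Suc.hyps by simp
  have lin: "clinear (h ^^ i)" for i
    by (induction i) (auto intro!: clinearI simp: clinear_add[OF h] clinear_scale[OF h] clinear_add clinear_scale)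
  have coeff: "coeff p i = (case i of 0 \<Rightarrow> 0 | Suc j \<Rightarrow> coeff q j) - z * coeff q i" for i
    unfolding q by (auto simp: coeff_pCons split: nat.split)
  have "(\<Sum>i\<le>degree p. coeff p i *\<^sub>C (h ^^ i) f) = (\<Sum>i\<le>degree q. coeff q i *\<^sub>C (h ^^ i) (h f - z *\<^sub>C f))"
  proof -
    have "(\<Sum>i\<le>degree p. coeff p i *\<^sub>C (h ^^ i) f)
        = (\<Sum>i\<le>Suc (degree q). (case i of 0 \<Rightarrow> 0 | Suc j \<Rightarrow> coeff q j) *\<^sub>C (h ^^ i) f)
          - (\<Sum>i\<le>Suc (degree q). (z * coeff q i) *\<^sub>C (h ^^ i) f)"
      by (simp add: dp coeff complex_vector.scale_left_diff_distrib sum_subtractf del: sum.atMost_Suc)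
    also have "(\<Sum>i\<le>Suc (degree q). (case i of 0 \<Rightarrow> 0 | Suc j \<Rightarrow> coeff q j) *\<^sub>C (h ^^ i) f)
        = (\<Sum>i\<le>degree q. coeff q i *\<^sub>C (h ^^ i) (h f))"
      by (subst sum.atMost_Suc_shift) (simp add: funpow_swap1)
    also have "(\<Sum>i\<le>Suc (degree q). (z * coeff q i) *\<^sub>C (h ^^ i) f)
        = (\<Sum>i\<le>degree q. (z * coeff q i) *\<^sub>C (h ^^ i) f)"
      by (simp add: coeff_eq_0)
    finally show ?thesis
      by (simp add: clinear_diff[OF lin] clinear_scale[OF lin] complex_vector.scale_right_diff_distrib
          sum_subtractf mult.commute)
  qed
  then obtain ms where "annih h ms (h f - z *\<^sub>C f) = 0"
    using Suc.hyps(1)[of q "h f - z *\<^sub>C f"] dq q0 Suc.prems by auto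
  then show ?case by (intro exI[of _ "ms @ [z]"]) simp
qed

lemma finite_dim_annih_vector:
  assumes h: "clinear h" and F: "finite_dim F" "h ` F \<subseteq> F" "f \<in> F"
  shows "\<exists>ms. annih h ms f = 0"
proof -
  let ?g = "\<lambda>i. (h ^^ i) f"
  have gF: "?g i \<in> F" for i using F by (induction i) auto
  show ?thesis
  proof (cases "inj ?g")
    case False
    then obtain i j where ij: "i < j" "?g i = ?g j" unfolding inj_def by (metis linorder_neqE_nat)
    let ?p = "monom 1 j - monom 1 i :: complex poly"
    have "coeff ?p j = 1" using ij by simp
    then have p0: "?p \<noteq> 0" by (metis coeff_0 zero_neq_one)
    have deg: "degree ?p \<le> j"
      using ij by (intro degree_diff_le) (auto intro: order_trans[OF degree_monom_le])
    have "(\<Sum>k\<le>degree ?p. coeff ?p k *\<^sub>C ?g k) = (\<Sum>k\<le>j. coeff ?p k *\<^sub>C ?g k)"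
      by (rule sum.mono_neutral_left) (use deg in \<open>auto simp del: coeff_diff coeff_monom simp: not_le intro: coeff_eq_0\<close>)
    also have "\<dots> = (\<Sum>k\<le>j. (if k = j then ?g k else 0)) - (\<Sum>k\<le>j. (if k = i then ?g k else 0))"
      unfolding sum_subtractf[symmetric]
      by (rule sum.cong) (auto simp: scaleC_one)
    also have "\<dots> = 0" using ij by simp
    finally show ?thesis using polynomial_relation_annih[OF h p0] by blast
  next
    case True
    obtain N where N: "\<And>S. S \<subseteq> F \<Longrightarrow> \<not> complex_vector.dependent S \<Longrightarrow> finite S \<and> card S \<le> N"
      using finite_dim_independent_bound[OF F(1)] by blast
    let ?S = "?g ` {..N}"
    have "card ?S = Suc N" using True by (simp add: card_image inj_on_def)
    moreover have "?S \<subseteq> F" using gF by blast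
    ultimately have "complex_vector.dependent ?S" using N[of ?S] by force
    then obtain u where u: "\<exists>v\<in>?S. u v \<noteq> 0" "(\<Sum>v\<in>?S. u v *\<^sub>C v) = 0"
      using complex_vector.dependent_finite[of ?S] by auto
    let ?p = "\<Sum>i\<le>N. monom (u (?g i)) i"
    have cp: "coeff ?p i = (if i \<le> N then u (?g i) else 0)" for i
      by (simp add: coeff_sum)
    have p0: "?p \<noteq> 0" using u(1) cp by (metis (no_types, lifting) atMost_iff coeff_0 image_iff)
    have deg: "degree ?p \<le> N" using cp by (simp add: degree_le)
    have "(\<Sum>k\<le>degree ?p. coeff ?p k *\<^sub>C ?g k) = (\<Sum>k\<le>N. coeff ?p k *\<^sub>C ?g k)"
      by (rule sum.mono_neutral_left) (use deg in \<open>auto simp del: coeff_sum simp: not_le intro: coeff_eq_0\<close>)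
    also have "\<dots> = (\<Sum>k\<le>N. u (?g k) *\<^sub>C ?g k)" by (simp add: cp)
    also have "\<dots> = (\<Sum>v\<in>?S. u v *\<^sub>C v)"
      using True by (simp add: sum.reindex inj_on_def)
    finally show ?thesis using u(2) polynomial_relation_annih[OF h p0] by simp
  qed
qed

lemma finite_dim_annih:
  assumes h: "clinear h" and F: "finite_dim F" "csubspace F" "h ` F \<subseteq> F"
  obtains ms where "\<And>f. f \<in> F \<Longrightarrow> annih h ms f = 0"
proof -
  obtain A where A: "A \<subseteq> F" "\<not> complex_vector.dependent A" "F \<subseteq> cspan A"
    using complex_vector.basis_exists[of F] by metis
  have "finite A" using finite_dim_independent_bound[OF F(1)] A by metis
  then have "\<exists>ms. \<forall>f\<in>A. annih h ms f = 0" using A(1)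
  proof (induction A)
    case (insert x A)
    then obtain ms where ms: "\<forall>f\<in>A. annih h ms f = 0" by auto
    obtain ns where ns: "annih h ns x = 0"
      using finite_dim_annih_vector[OF h F(1,3), of x] insert.prems by auto
    have "\<forall>f\<in>insert x A. annih h (ms @ ns) f = 0"
    proof
      fix f assume "f \<in> insert x A"
      then have "annih h ns f = 0 \<or> annih h ms f = 0" using ms ns by auto
      then show "annih h (ms @ ns) f = 0"
        using annih_commute[OF h, of ms ns f] by (auto simp: clinear_0[OF clinear_annih[OF h]])
    qed
    then show ?case by blast
  qed auto
  then obtain ms where "\<forall>f\<in>A. annih h ms f = 0" by blast
  then have "annih h ms f = 0" if "f \<in> F" for f
    using clinear_zero_on_cspan[OF clinear_annih[OF h]] A(3) that by blast
  then show ?thesis using that by blast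
qed

lemma annih_eigenvector:
  assumes "annih h ms f = 0" "f \<noteq> 0" "csubspace F" "h ` F \<subseteq> F" "f \<in> F"
  shows "\<exists>m\<in>set ms. \<exists>g\<in>F. g \<noteq> 0 \<and> h g = m *\<^sub>C g"
  using assms(1)
proof (induction ms)
  case Nil then show ?case using assms by simp
next
  case (Cons m ms)
  show ?case
  proof (cases "annih h ms f = 0")
    case False
    then have "annih h ms f \<noteq> 0" "h (annih h ms f) = m *\<^sub>C annih h ms f" using Cons.prems by auto
    then show ?thesis using annih_in[OF assms(3-5), of ms] by auto
  qed (use Cons in auto)
qed

lemma annih_eigenvalue:
  assumes "annih h ms g = 0" "g \<noteq> 0" "h g = m *\<^sub>C g" "clinear h"
  shows "m \<in> set ms"
  using assms(1,2) unfolding annih_eigen[OF assms(3,4)]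
  by (auto simp: complex_vector.scale_eq_0_iff prod_list_zero_iff)

lemma csubspace_eigenspace:
  assumes "clinear h" "csubspace F"
  shows "csubspace {f \<in> F. h f = m *\<^sub>C f}"
proof (rule complex_vector.subspaceI)
  show "0 \<in> {f \<in> F. h f = m *\<^sub>C f}"
    using complex_vector.subspace_0[OF assms(2)] clinear_0[OF assms(1)] by simp
  show "x + y \<in> {f \<in> F. h f = m *\<^sub>C f}"
    if "x \<in> {f \<in> F. h f = m *\<^sub>C f}" "y \<in> {f \<in> F. h f = m *\<^sub>C f}" for x y
    using that complex_vector.subspace_add[OF assms(2)] by (simp add: clinear_add[OF assms(1)] scaleC_add_right)
  show "c *\<^sub>C x \<in> {f \<in> F. h f = m *\<^sub>C f}" if "x \<in> {f \<in> F. h f = m *\<^sub>C f}" for c x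
    using that complex_vector.subspace_scale[OF assms(2)] by (simp add: clinear_scale[OF assms(1)] mult.commute)
qed

text \<open>Unless all operators are scalar on \<open>F\<close>, an eigenspace of one of them is a proper nonzero subspace
that the whole commuting family preserves; induction on the dimension applies to it.\<close>

lemma common_eigenvector:
  assumes "finite_dim F" "csubspace F" "F \<noteq> {0}"
    and "\<And>h. h \<in> H \<Longrightarrow> clinear h" "\<And>h. h \<in> H \<Longrightarrow> h ` F \<subseteq> F"
    and "\<And>h h' f. h \<in> H \<Longrightarrow> h' \<in> H \<Longrightarrow> f \<in> F \<Longrightarrow> h (h' f) = h' (h f)"
  shows "\<exists>f\<in>F. f \<noteq> 0 \<and> (\<forall>h\<in>H. \<exists>m. h f = m *\<^sub>C f)"
  using assms(1,2,3,5,6)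
proof (induction "complex_vector.dim F" arbitrary: F rule: less_induct)
  case (less F)
  show ?case
  proof (cases "\<forall>h\<in>H. \<exists>m. \<forall>f\<in>F. h f = m *\<^sub>C f")
    case True
    moreover obtain f where "f \<in> F" "f \<noteq> 0"
      using less.prems(3) complex_vector.subspace_0[OF less.prems(2)] by auto
    ultimately show ?thesis by metis
  next
    case False
    then obtain h where h: "h \<in> H" "\<not> (\<exists>m. \<forall>f\<in>F. h f = m *\<^sub>C f)" by blast
    obtain ms where ms: "\<And>f. f \<in> F \<Longrightarrow> annih h ms f = 0"
      using finite_dim_annih[OF assms(4)[OF h(1)] less.prems(1,2) less.prems(4)[OF h(1)]] by blast
    obtain f where "f \<in> F" "f \<noteq> 0"
      using less.prems(3) complex_vector.subspace_0[OF less.prems(2)] by auto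
    then obtain m g where g: "g \<in> F" "g \<noteq> 0" "h g = m *\<^sub>C g"
      using annih_eigenvector[OF ms[of f] _ less.prems(2) less.prems(4)[OF h(1)]] by auto
    let ?F = "{f \<in> F. h f = m *\<^sub>C f}"
    have sub: "csubspace ?F"
      using csubspace_eigenspace[OF assms(4)[OF h(1)] less.prems(2)] .
    have "?F \<subset> F" using h(2) by blast
    from dim_psubset[OF less.prems(1) sub less.prems(2) this]
    have lt: "complex_vector.dim ?F < complex_vector.dim F" .
    have "\<exists>f\<in>?F. f \<noteq> 0 \<and> (\<forall>h\<in>H. \<exists>m. h f = m *\<^sub>C f)"
    proof (rule less.hyps[OF lt _ sub])
      show "finite_dim ?F" by (rule finite_dim_subset[OF less.prems(1)]) simp
      show "?F \<noteq> {0}" using g by blast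
      show "h' ` ?F \<subseteq> ?F" if "h' \<in> H" for h'
      proof safe
        fix x assume x: "x \<in> F" "h x = m *\<^sub>C x"
        show "h' x \<in> F" using less.prems(4)[OF that] x(1) by auto
        show "h (h' x) = m *\<^sub>C h' x"
          using less.prems(5)[OF h(1) that x(1)] x(2) clinear_scale[OF assms(4)[OF that]] by simp
      qed
    qed (simp add: less.prems(5))
    then show ?thesis by auto
  qed
qed

text \<open>If \<open>h X = X (h + d)\<close>, then \<open>X\<close> moves generalised eigenvectors of \<open>h\<close> for \<open>m\<close> to ones for
\<open>m + d\<close>, so \<open>X\<close> vanishes on \<open>F\<close> once \<open>d\<close> is not a difference of two eigenvalues. The generalised
eigenvectors themselves are avoided by splitting the factors \<open>h - n\<close> off one at a time.\<close>

lemma eigenvalue_shift_zero: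
  assumes h: "clinear h" and X: "clinear X" and F: "csubspace F" "h ` F \<subseteq> F" "X ` F \<subseteq> F"
    and ms: "\<And>f. f \<in> F \<Longrightarrow> annih h ms f = 0"
    and rel: "\<And>f. f \<in> F \<Longrightarrow> h (X f) = X (h f) + d *\<^sub>C X f"
    and d: "\<And>m n. m \<in> set ms \<Longrightarrow> n \<in> set ms \<Longrightarrow> d \<noteq> m - n"
    and f: "f \<in> F"
  shows "X f = 0"
proof -
  have "f \<in> F \<Longrightarrow> annih h ns f = 0 \<Longrightarrow> set ns \<subseteq> set ms \<Longrightarrow> X f = 0" for ns f
  proof (induction ns arbitrary: f rule: rev_induct)
    case Nil then show ?case by (simp add: clinear_0[OF X])
  next
    case (snoc n ns)
    have "h f - n *\<^sub>C f \<in> F"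
      using snoc.prems(1) F by (auto intro!: complex_vector.subspace_diff complex_vector.subspace_scale)
    then have "X (h f - n *\<^sub>C f) = 0" using snoc.IH snoc.prems by simp
    then have eig: "h (X f) = (n + d) *\<^sub>C X f"
      using rel[OF snoc.prems(1)] by (simp add: clinear_diff[OF X] clinear_scale[OF X] scaleC_add_left)
    show "X f = 0"
    proof (rule ccontr)
      assume "X f \<noteq> 0"
      moreover have "annih h ms (X f) = 0" using ms F snoc.prems(1) by blast
      ultimately have "n + d \<in> set ms" using annih_eigenvalue[OF _ _ eig h] by blast
      moreover have "n \<in> set ms" using snoc.prems by simp
      ultimately show False using d[of "n + d" n] by simp
    qed
  qed
  then show ?thesis using f ms by blast
qed

lemma cspan_powers_dependent:
  assumes "finite_dim F" "y ` F \<subseteq> F" "f \<in> F"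
  shows "\<exists>m. (y ^^ m) f \<in> cspan ((\<lambda>i. (y ^^ i) f) ` {..<m})"
proof (rule ccontr)
  let ?g = "\<lambda>i. (y ^^ i) f"
  assume "\<not> ?thesis"
  then have new: "?g m \<notin> cspan (?g ` {..<m})" for m by blast
  have ind: "\<not> complex_vector.dependent (?g ` {..<m}) \<and> card (?g ` {..<m}) = m" for m
  proof (induction m)
    case 0 then show ?case by (simp add: complex_vector.dependent_def)
  next
    case (Suc m)
    have "?g m \<notin> ?g ` {..<m}" using new[of m] complex_vector.span_base[of "?g m" "?g ` {..<m}"] by auto
    then show ?case
      using Suc new[of m] by (simp add: lessThan_Suc complex_vector.independent_insertI)
  qed
  have gF: "?g i \<in> F" for i using assms by (induction i) auto
  obtain N where N: "\<And>S. S \<subseteq> F \<Longrightarrow> \<not> complex_vector.dependent S \<Longrightarrow> finite S \<and> card S \<le> N"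
    using finite_dim_independent_bound[OF assms(1)] by blast
  have "?g ` {..<Suc N} \<subseteq> F" using gF by (simp add: image_subset_iff)
  then show False using N[of "?g ` {..<Suc N}"] ind[of "Suc N"] by simp
qed

text \<open>The invariance lemma behind Lie's theorem, for a family \<open>N\<close> of operators with joint eigenvector \<open>f\<close>
and an operator \<open>y\<close> with \<open>[N, y] \<subseteq> N\<close> on \<open>F\<close>: the eigenvalue of \<open>z = [x, y]\<close> at \<open>f\<close> is \<open>0\<close>. On
the vectors \<open>y\<^sup>j f\<close> every \<open>x\<close> acts triangularly, and the coefficient next to the diagonal is \<open>j\<close> times
that eigenvalue. At the first \<open>m\<close> for which \<open>y\<^sup>m f\<close> depends on its predecessors, a nonzero eigenvalue
would make \<open>y\<^sup>m\<^sup>-\<^sup>1 f\<close> depend on them already. This replaces the usual trace computation.\<close>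

lemma commutator_kills_joint_eigenvector:
  assumes F: "finite_dim F" "f \<in> F" "f \<noteq> 0"
    and y: "clinear y" "y ` F \<subseteq> F"
    and N: "\<And>x. x \<in> N \<Longrightarrow> clinear x" "\<And>x. x \<in> N \<Longrightarrow> \<exists>m. x f = m *\<^sub>C f"
    and br: "\<And>x. x \<in> N \<Longrightarrow> \<exists>z\<in>N. \<forall>g\<in>F. x (y g) = y (x g) + z g"
    and xz: "x \<in> N" "z \<in> N" "\<And>g. g \<in> F \<Longrightarrow> x (y g) = y (x g) + z g"
  shows "z f = 0"
proof -
  define g where "g i = (y ^^ i) f" for i
  define U where "U j = cspan (g ` {..<j})" for j
  obtain \<theta> where \<theta>: "\<And>x. x \<in> N \<Longrightarrow> x f = \<theta> x *\<^sub>C f" using N(2) by metis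
  have gF: "g i \<in> F" for i unfolding g_def using F y by (induction i) auto
  have g0: "g 0 = f" and gS: "g (Suc i) = y (g i)" for i by (simp_all add: g_def)
  have U0: "U 0 = {0}" by (simp add: U_def)
  have subU: "csubspace (U j)" for j by (simp add: U_def)
  have U_mono: "v \<in> U j" if "v \<in> U i" "i \<le> j" for v i j
  proof -
    have "g ` {..<i} \<subseteq> g ` {..<j}" using that(2) by auto
    then have "cspan (g ` {..<i}) \<subseteq> cspan (g ` {..<j})" by (rule complex_vector.span_mono)
    then show ?thesis using that(1) unfolding U_def by auto
  qed
  have gU: "g i \<in> U j" if "i < j" for i j
    unfolding U_def using that by (auto intro: complex_vector.span_base)
  have yU: "y v \<in> U (Suc j)" if "v \<in> U j" for v j
    using that unfolding U_def[of j]
    by (rule clinear_cspan_into[OF y(1) _ subU, rotated]) (auto simp: gS[symmetric] intro: gU)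
  have yU': "y v \<in> U j" if "v \<in> U (j - 1)" for v j
    using that yU[of v "j - 1"] by (cases j) (auto simp: U0 clinear_0[OF y(1)])
  \<comment> \<open>The induction runs over all \<open>x\<close> at once, since its step uses the hypothesis for \<open>z\<close> too.\<close>
  have key: "x (g j) - \<theta> x *\<^sub>C g j - (of_nat j * \<theta> z) *\<^sub>C g (j - 1) \<in> U (j - 1)"
    if "x \<in> N" "z \<in> N" "\<And>g. g \<in> F \<Longrightarrow> x (y g) = y (x g) + z g" for x z j
    using that
  proof (induction j arbitrary: x z)
    case 0
    then show ?case by (simp add: g0 \<theta> U0)
  next
    case (Suc j)
    obtain z' where z': "z' \<in> N" "\<And>g. g \<in> F \<Longrightarrow> z (y g) = y (z g) + z' g"
      using br[OF Suc.prems(2)] by blast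
    have gj: "(of_nat j * c) *\<^sub>C g (j - 1) \<in> U j" for c
      by (cases j) (auto simp: U0 intro!: complex_vector.subspace_scale[OF subU] gU)
    have "z (g j) - \<theta> z *\<^sub>C g j - (of_nat j * \<theta> z') *\<^sub>C g (j - 1) \<in> U j"
      using Suc.IH[OF Suc.prems(2) z'] U_mono by simp
    from complex_vector.subspace_add[OF subU this gj[of "\<theta> z'"]]
    have 1: "z (g j) - \<theta> z *\<^sub>C g j \<in> U j" by simp
    have "y (x (g j) - \<theta> x *\<^sub>C g j - (of_nat j * \<theta> z) *\<^sub>C g (j - 1)) \<in> U j"
      by (rule yU'[OF Suc.IH[OF Suc.prems]])
    moreover have "(of_nat j * \<theta> z) *\<^sub>C y (g (j - 1)) = (of_nat j * \<theta> z) *\<^sub>C g j"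
      by (cases j) (simp_all add: gS)
    ultimately have "y (x (g j)) - \<theta> x *\<^sub>C g (Suc j) - (of_nat j * \<theta> z) *\<^sub>C g j \<in> U j"
      by (simp only: clinear_diff[OF y(1)] clinear_scale[OF y(1)] gS)
    from complex_vector.subspace_add[OF subU this 1]
    show ?case
      using Suc.prems(3)[OF gF[of j]]
      by (simp add: gS scaleC_add_left algebra_simps)
  qed
  show ?thesis
  proof (rule ccontr)
    assume "z f \<noteq> 0"
    then have \<theta>z: "\<theta> z \<noteq> 0" using \<theta>[OF xz(2)] by auto
    define m where "m = (LEAST m. g m \<in> U m)"
    have ex: "\<exists>m. g m \<in> U m"
      using cspan_powers_dependent[OF F(1) y(2) F(2)] by (simp add: g_def U_def)
    then have m: "g m \<in> U m" unfolding m_def by (rule LeastI_ex)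
    have min: "g i \<notin> U i" if "i < m" for i
      using not_less_Least[of i "\<lambda>m. g m \<in> U m"] that unfolding m_def by blast
    have m0: "m > 0" using m F(3) by (cases m) (auto simp: U0 g0)
    have gen: "x (g i) - \<theta> x *\<^sub>C g i \<in> U (m - 1)" if "i < m" for i
    proof -
      have "(of_nat i * \<theta> z) *\<^sub>C g (i - 1) \<in> U (m - 1)"
        using that by (cases i) (auto simp: complex_vector.subspace_0[OF subU]
            intro!: complex_vector.subspace_scale[OF subU] gU)
      moreover have "x (g i) - \<theta> x *\<^sub>C g i - (of_nat i * \<theta> z) *\<^sub>C g (i - 1) \<in> U (m - 1)"
        by (rule U_mono[OF key[OF xz]]) (use that in auto)
      ultimately show ?thesis using complex_vector.subspace_add[OF subU] by fastforce
    qed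
    have lin: "clinear (\<lambda>v. x v - \<theta> x *\<^sub>C v)"
      by (rule clinearI)
         (simp_all add: clinear_add[OF N(1)[OF xz(1)]] clinear_scale[OF N(1)[OF xz(1)]]
           scaleC_add_right complex_vector.scale_right_diff_distrib mult.commute)
    have "x (g m) - \<theta> x *\<^sub>C g m \<in> U (m - 1)"
      by (rule clinear_cspan_into[OF lin _ subU, of "g ` {..<m}"]) (use gen m in \<open>auto simp: U_def\<close>)
    from complex_vector.subspace_diff[OF subU this key[OF xz, of m]]
    have "(of_nat m * \<theta> z) *\<^sub>C g (m - 1) \<in> U (m - 1)" by simp
    from complex_vector.subspace_scale[OF subU this, of "inverse (of_nat m * \<theta> z)"]
    have "g (m - 1) \<in> U (m - 1)"
      using \<theta>z m0 by (simp only: scaleC_scaleC left_inverse scaleC_one mult_eq_0_iff of_nat_eq_0_iff simp_thms)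
    then show False using min[of "m - 1"] m0 by simp
  qed
qed

section \<open>Modules over currents on a torus\<close>

text \<open>The operator \<open>a e k b\<close> stands for the action of \<open>t\<^sup>k e \<otimes> b\<close>, where \<open>e\<close> is a derivation \<open>D(w, 0)\<close> or
an element of \<open>S\<close> (or a sum of both) and \<open>q e k\<close> is the number with \<open>e(t\<^sup>k) = q e k \<cdot> t\<^sup>k\<close>. With this
notation derivations along \<open>K\<close>, the derivation transversal to \<open>K\<close> and the elements of \<open>S\<close> obey one and
the same bracket formula; the last two kinds have \<open>q e = 0\<close> on \<open>K\<close>. Only the labels in \<open>E\<close> and the
degrees in \<open>K\<close> are considered, so that the locale serves both for the algebra of degrees in \<open>K\<close> acting
on the top component and for the whole algebra.\<close>

locale current_module =
  fixes E :: "'e set" and K :: "'k::ab_group_add set" and q :: "'e \<Rightarrow> 'k \<Rightarrow> complex"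
    and a :: "'e \<Rightarrow> 'k \<Rightarrow> 'b::comm_complex_algebra \<Rightarrow> 'z::complex_vector \<Rightarrow> 'z"
  assumes K_zero: "0 \<in> K" and K_diff: "\<And>k l. k \<in> K \<Longrightarrow> l \<in> K \<Longrightarrow> k - l \<in> K"
    and q_add: "\<And>e k l. q e (k + l) = q e k + q e l"
    and a_clinear: "\<And>e k b. e \<in> E \<Longrightarrow> k \<in> K \<Longrightarrow> clinear (a e k b)"
    and a_add: "\<And>e k b c v. e \<in> E \<Longrightarrow> k \<in> K \<Longrightarrow> a e k (b + c) v = a e k b v + a e k c v"
    and a_scale: "\<And>e k x b v. e \<in> E \<Longrightarrow> k \<in> K \<Longrightarrow> a e k (x *\<^sub>C b) v = x *\<^sub>C a e k b v"
    and bracket: "\<And>e e' k l b c v. e \<in> E \<Longrightarrow> e' \<in> E \<Longrightarrow> k \<in> K \<Longrightarrow> l \<in> K \<Longrightarrow>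
      a e l c (a e' k b v) = a e' k b (a e l c v)
        + (q e k *\<^sub>C a e' (k + l) (b * c) v - q e' l *\<^sub>C a e (k + l) (b * c) v)"
    and irreducible: "\<And>W. csubspace W \<Longrightarrow> (\<And>e k b w. e \<in> E \<Longrightarrow> k \<in> K \<Longrightarrow> w \<in> W \<Longrightarrow> a e k b w \<in> W)
      \<Longrightarrow> W = {0} \<or> W = UNIV"
begin

lemma K_neg: "k \<in> K \<Longrightarrow> - k \<in> K"
  using K_diff[OF K_zero] by simp

lemma K_add: "k \<in> K \<Longrightarrow> l \<in> K \<Longrightarrow> k + l \<in> K"
  using K_diff[of k "- l"] K_neg by simp

lemma K_diff_iff: "l \<in> K \<Longrightarrow> k - l \<in> K \<longleftrightarrow> k \<in> K"
  using K_add[of "k - l" l] K_diff by auto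

lemma q_zero [simp]: "q e 0 = 0"
  using q_add[of e 0 0] by simp

lemma q_diff: "q e (k - l) = q e k - q e l"
  using q_add[of e "k - l" l] by simp

lemma q_neg: "q e (- l) = - q e l"
  using q_diff[of e 0 l] by simp

lemma a_zero_vec: "e \<in> E \<Longrightarrow> k \<in> K \<Longrightarrow> a e k b 0 = 0"
  using a_clinear clinear_0 by blast

text \<open>The factor \<open>d\<close> makes \<open>ann\<close> an ideal by construction.\<close>

definition ann :: "'b set"
  where "ann = {b. \<forall>e\<in>E. \<forall>k\<in>K. \<forall>d v. a e k (b * d) v = 0}"

lemma annD: "b \<in> ann \<Longrightarrow> e \<in> E \<Longrightarrow> k \<in> K \<Longrightarrow> a e k (b * d) v = 0"
  by (simp add: ann_def)

lemma ann_mult: "b \<in> ann \<Longrightarrow> b * c \<in> ann"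
  by (simp add: ann_def mult.assoc)

text \<open>The vectors killed by all \<open>a e k (b d)\<close> form a submodule. By irreducibility a single nonzero one
suffices.\<close>

lemma ann_of_killed_vector:
  assumes "t \<noteq> 0" "\<And>e k d. e \<in> E \<Longrightarrow> k \<in> K \<Longrightarrow> a e k (b * d) t = 0"
  shows "b \<in> ann"
proof -
  let ?N = "{t. \<forall>e\<in>E. \<forall>k\<in>K. \<forall>d. a e k (b * d) t = 0}"
  have "csubspace ?N"
    by (rule complex_vector.subspaceI)
       (auto simp: a_zero_vec clinear_add[OF a_clinear] clinear_scale[OF a_clinear])
  moreover have "a e k c w \<in> ?N" if ek: "e \<in> E" "k \<in> K" and w: "w \<in> ?N" for e k c w
  proof safe
    fix e' k' d assume ek': "e' \<in> E" "k' \<in> K"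
    have "a e' (k + k') (c * (b * d)) w = 0" "a e (k + k') (c * (b * d)) w = 0"
      using w ek ek' K_add[of k k'] by (simp_all add: mult.left_commute[of c])
    then show "a e' k' (b * d) (a e k c w) = 0"
      using bracket[OF ek'(1) ek(1) ek(2) ek'(2), of "b * d" c w] w ek ek' by (simp add: a_zero_vec)
  qed
  ultimately have "?N = {0} \<or> ?N = UNIV" by (rule irreducible)
  moreover have "t \<in> ?N" using assms(2) by simp
  ultimately have "?N = UNIV" using assms(1) by blast
  then have "v \<in> ?N" for v by simp
  then show ?thesis unfolding ann_def by simp
qed

end

text \<open>\<open>P r\<close> plays the role of the weight space \<open>Z\<^sub>\<mu>\<^sub>-\<^sub>r\<close> for a fixed weight \<open>\<mu>\<close>.\<close>

locale covered_module = current_module E K q a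
  for E :: "'e set" and K :: "'k::ab_group_add set" and q
    and a :: "'e \<Rightarrow> 'k \<Rightarrow> 'b::comm_complex_algebra \<Rightarrow> 'z::complex_vector \<Rightarrow> 'z" +
  fixes P :: "'k \<Rightarrow> 'z set"
  assumes P_shift: "\<And>e l r c v. e \<in> E \<Longrightarrow> l \<in> K \<Longrightarrow> r \<in> K \<Longrightarrow> v \<in> P r \<Longrightarrow> a e l c v \<in> P (r - l)"
    and P_span: "cspan (\<Union>r\<in>K. P r) = UNIV"
    and q_separates: "\<And>l. l \<in> K \<Longrightarrow> l \<noteq> 0 \<Longrightarrow> \<exists>e\<in>E. q e l \<noteq> 0"
    and K_nontrivial: "\<exists>k\<in>K. k \<noteq> 0"
begin

text \<open>The function attached to \<open>t\<^sup>r e \<otimes> b\<close> and \<open>v\<close> records the action of all multiples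
\<open>t\<^sup>k c (t\<^sup>r e \<otimes> b)\<close> on \<open>v\<close>; degrees outside \<open>K\<close> carry no information and get the value \<open>0\<close>. Such
functions, for all weights together, form the \<open>A\<^sub>K \<otimes> B\<close>-cover of the module \<open>Z\<close> in the sense of Billig
and Futorny. As \<open>v\<close> has weight \<open>\<mu> - r\<close>, the span below is the component of weight \<open>\<mu>\<close>. The shift by
\<open>m \<in> K\<close> maps it isomorphically onto the component of weight \<open>\<mu> + m\<close>.\<close>

definition cover_fun :: "'e \<Rightarrow> 'k \<Rightarrow> 'b \<Rightarrow> 'z \<Rightarrow> 'k \<Rightarrow> 'b \<Rightarrow> 'z"
  where "cover_fun e r b v = (\<lambda>k c. if k \<in> K then a e (r + k) (b * c) v else 0)"

definition cover :: "('k \<Rightarrow> 'b \<Rightarrow> 'z) set"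
  where "cover = cspan {cover_fun e r b v | e r b v. e \<in> E \<and> r \<in> K \<and> v \<in> P r}"

definition alg_op :: "'b \<Rightarrow> ('k \<Rightarrow> 'b \<Rightarrow> 'z) \<Rightarrow> 'k \<Rightarrow> 'b \<Rightarrow> 'z"
  where "alg_op b f = (\<lambda>k c. f k (b * c))"

text \<open>On the cover, \<open>X = t\<^sup>l e \<otimes> c\<close> acts by \<open>(X f)(k, d) = X f(k, d) - q e k \<cdot> f(k + l, c d)\<close>, i.e. by the
natural action on functions with values in a module. This changes the weight by \<open>l\<close>, and the shift
\<open>t\<^sup>-\<^sup>l\<close> brings it back to \<open>\<mu>\<close>.\<close>

definition shift_op :: "'e \<Rightarrow> 'k \<Rightarrow> 'b \<Rightarrow> ('k \<Rightarrow> 'b \<Rightarrow> 'z) \<Rightarrow> 'k \<Rightarrow> 'b \<Rightarrow> 'z"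
  where "shift_op e l c f = (\<lambda>k d. a e l c (f (k - l) d) - q e (k - l) *\<^sub>C f k (d * c))"

lemma csubspace_cover: "csubspace cover"
  by (simp add: cover_def)

lemma cover_fun_in: "e \<in> E \<Longrightarrow> r \<in> K \<Longrightarrow> v \<in> P r \<Longrightarrow> cover_fun e r b v \<in> cover"
  unfolding cover_def by (rule complex_vector.span_base) blast

lemma clinear_alg_op: "clinear (alg_op b)"
  by (rule clinearI) (simp_all add: alg_op_def fun_eq_iff)

lemma clinear_shift_op: "e \<in> E \<Longrightarrow> l \<in> K \<Longrightarrow> clinear (shift_op e l c)"
  by (rule clinearI)
     (simp_all add: shift_op_def fun_eq_iff clinear_add[OF a_clinear] clinear_scale[OF a_clinear]
        scaleC_add_right complex_vector.scale_right_diff_distrib mult.commute)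

lemma cover_support:
  assumes "f \<in> cover" "k \<notin> K"
  shows "f k c = 0"
proof -
  have "clinear (\<lambda>f. f k c)" by (rule clinearI) simp_all
  then show ?thesis
    by (rule clinear_zero_on_cspan[OF _ _ assms(1)[unfolded cover_def]])
       (use assms(2) in \<open>auto simp: cover_fun_def\<close>)
qed

lemma alg_op_cover_fun: "alg_op b (cover_fun e r b' v) = cover_fun e r (b * b') v"
  by (simp add: alg_op_def cover_fun_def fun_eq_iff mult_ac)

lemma alg_op_cover: "f \<in> cover \<Longrightarrow> alg_op b f \<in> cover"
  unfolding cover_def
  by (erule clinear_cspan_into[OF clinear_alg_op, rotated 2])
     (auto simp: alg_op_cover_fun cover_fun_in[unfolded cover_def])

lemma shift_op_cover_fun:
  assumes e: "e \<in> E" "e' \<in> E" and k: "l \<in> K" "r \<in> K"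
  shows "shift_op e l c (cover_fun e' r b v) = cover_fun e' (r - l) b (a e l c v)
    + q e r *\<^sub>C cover_fun e' r (b * c) v - q e' l *\<^sub>C cover_fun e r (b * c) v"
proof (intro ext)
  fix k d
  show "shift_op e l c (cover_fun e' r b v) k d = (cover_fun e' (r - l) b (a e l c v)
    + q e r *\<^sub>C cover_fun e' r (b * c) v - q e' l *\<^sub>C cover_fun e r (b * c) v) k d"
  proof (cases "k \<in> K")
    case True
    have K1: "r + (k - l) \<in> K" using True k K_add K_diff by blast
    have sum: "r + (k - l) + l = r + k" "r - l + k = r + (k - l)" by (simp_all add: algebra_simps)
    have "b * d * c = b * c * d" "b * (d * c) = b * c * d" by (simp_all add: mult_ac)
    then show ?thesis
      using bracket[OF e K1 k(1), of c "b * d" v] True k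
      by (simp add: shift_op_def cover_fun_def K_diff sum q_add q_diff
          complex_vector.scale_left_diff_distrib scaleC_add_left algebra_simps)
  next
    case False
    then show ?thesis
      using k e by (simp add: shift_op_def cover_fun_def K_diff_iff a_zero_vec)
  qed
qed

lemma shift_op_cover:
  assumes "e \<in> E" "l \<in> K" "f \<in> cover"
  shows "shift_op e l c f \<in> cover"
proof (rule clinear_cspan_into[OF clinear_shift_op[OF assms(1,2)] _ csubspace_cover assms(3)[unfolded cover_def]])
  fix x assume "x \<in> {cover_fun e r b v |e r b v. e \<in> E \<and> r \<in> K \<and> v \<in> P r}"
  then obtain e' r b v where x: "x = cover_fun e' r b v" "e' \<in> E" "r \<in> K" "v \<in> P r" by blast
  show "shift_op e l c x \<in> cover"
    unfolding x(1) shift_op_cover_fun[OF assms(1) x(2) assms(2) x(3)]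
    by (intro complex_vector.subspace_add complex_vector.subspace_diff complex_vector.subspace_scale
        csubspace_cover cover_fun_in assms x K_diff P_shift)
qed

text \<open>Thus \<open>B/ann\<close> embeds into the operators on the cover, and a finite dimensional cover can be used to
study \<open>ann\<close>.\<close>

lemma alg_op_zero_iff: "(\<forall>f\<in>cover. alg_op b f = 0) \<longleftrightarrow> b \<in> ann"
proof
  assume *: "\<forall>f\<in>cover. alg_op b f = 0"
  show "b \<in> ann"
    unfolding ann_def
  proof safe
    fix e l d v assume el: "e \<in> E" "l \<in> K"
    have "a e l (b * d) w = 0" if w: "w \<in> (\<Union>r\<in>K. P r)" for w
    proof -
      obtain r where r: "r \<in> K" "w \<in> P r" using w by blast
      have "alg_op b (cover_fun e r d w) (l - r) 1 = 0"
        using * cover_fun_in[OF el(1) r] by simp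
      then show ?thesis
        using K_diff[OF el(2) r(1)] unfolding alg_op_cover_fun by (simp add: cover_fun_def)
    qed
    then show "a e l (b * d) v = 0"
      using clinear_zero_on_cspan[OF a_clinear[OF el], of "\<Union>r\<in>K. P r"] P_span by auto
  qed
next
  assume b: "b \<in> ann"
  have "alg_op b x = 0" if "x \<in> {cover_fun e r b v |e r b v. e \<in> E \<and> r \<in> K \<and> v \<in> P r}" for x
  proof -
    obtain e r b' v where x: "x = cover_fun e r b' v" "e \<in> E" "r \<in> K" using \<open>x \<in> _\<close> by blast
    show ?thesis
      unfolding x(1) alg_op_cover_fun
      using b x(2,3) by (simp add: cover_fun_def fun_eq_iff K_add mult.assoc annD)
  qed
  then show "\<forall>f\<in>cover. alg_op b f = 0"
    using clinear_zero_on_cspan[OF clinear_alg_op, of "{cover_fun e r b v |e r b v. e \<in> E \<and> r \<in> K \<and> v \<in> P r}"]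
    unfolding cover_def by simp
qed

lemma cover_nonzero:
  assumes "e \<in> E" "k \<in> K" "a e k b v \<noteq> 0"
  shows "cover \<noteq> {0}"
proof
  assume "cover = {0}"
  then have "\<forall>f\<in>cover. alg_op b f = 0" by (simp add: clinear_0[OF clinear_alg_op])
  then have "b \<in> ann" by (simp only: alg_op_zero_iff)
  then show False using annD[of b e k 1 v] assms by simp
qed

text \<open>The multiples of \<open>k\<close> have infinitely many values under \<open>q e\<close>.\<close>

lemma far_degree:
  assumes "e \<in> E" "k \<in> K" "q e k \<noteq> 0" "finite Bad"
  shows "\<exists>l\<in>K. q e l \<notin> Bad"
proof -
  have mult: "\<exists>l\<in>K. q e l = of_nat n * q e k" for n
  proof (induction n)
    case 0 then show ?case using K_zero by (intro bexI[of _ 0]) simp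
  next
    case (Suc n)
    then obtain l where "l \<in> K" "q e l = of_nat n * q e k" by blast
    then show ?case using assms(2) by (intro bexI[of _ "l + k"]) (simp_all add: q_add K_add algebra_simps)
  qed
  have "inj (\<lambda>n::nat. of_nat n * q e k)" using assms(3) by (simp add: inj_def)
  then have "infinite (range (\<lambda>n::nat. of_nat n * q e k))" by (rule range_inj_infinite)
  then have "\<not> range (\<lambda>n::nat. of_nat n * q e k) \<subseteq> Bad" using assms(4) finite_subset by auto
  then obtain n :: nat where "of_nat n * q e k \<notin> Bad" by auto
  then show ?thesis using mult[of n] by metis
qed

end

lemma (in covered_module) cover_linear:
  assumes "f \<in> cover"
  shows "clinear (f k)"
proof -
  have "cover \<subseteq> {f. (\<forall>b c. f k (b + c) = f k b + f k c) \<and> (\<forall>x b. f k (x *\<^sub>C b) = x *\<^sub>C f k b)}"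
    unfolding cover_def
  proof (rule complex_vector.span_minimal)
    show "{cover_fun e r b v |e r b v. e \<in> E \<and> r \<in> K \<and> v \<in> P r}
      \<subseteq> {f. (\<forall>b c. f k (b + c) = f k b + f k c) \<and> (\<forall>x b. f k (x *\<^sub>C b) = x *\<^sub>C f k b)}"
      by (auto simp: cover_fun_def distrib_left scaleC_mult_right a_add a_scale K_add)
  qed (auto intro!: complex_vector.subspaceI simp: scaleC_add_right mult.commute)
  then show ?thesis using assms by (intro clinearI) auto
qed

section \<open>The fibre of the cover over a point of \<open>B\<close>\<close>

text \<open>\<open>\<eta>\<close> is an eigenvalue of \<open>B\<close> on the cover with eigenvector \<open>(k, c) \<mapsto> \<eta>(c) f0(k)\<close>. The eigenspace for
\<open>\<eta>\<close> consists of functions of this shape, so that it can be described by functions of \<open>k\<close> alone, which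
are called the fibre.\<close>

locale evaluated_cover = covered_module E K q a P
  for E :: "'e set" and K :: "'k::ab_group_add set" and q
    and a :: "'e \<Rightarrow> 'k \<Rightarrow> 'b::comm_complex_algebra \<Rightarrow> 'z::complex_vector \<Rightarrow> 'z" and P +
  fixes \<eta> :: "'b \<Rightarrow> complex" and f0 :: "'k \<Rightarrow> 'z"
  assumes eta: "algebra_hom \<eta>"
    and f0: "f0 \<noteq> 0" "(\<lambda>k c. \<eta> c *\<^sub>C f0 k) \<in> cover"
    and cover_fd: "finite_dim cover"
begin

lemma eta_simps [simp]: "\<eta> (b + c) = \<eta> b + \<eta> c" "\<eta> (x *\<^sub>C b) = x * \<eta> b" "\<eta> 1 = 1"
    "\<eta> (b * c) = \<eta> b * \<eta> c" "\<eta> (b - c) = \<eta> b - \<eta> c" "\<eta> 0 = 0"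
  using eta unfolding algebra_hom_def
  by (auto simp: clinear_add clinear_scale clinear_diff clinear_0 scaleC_complex_def)

definition fiber_emb :: "('k \<Rightarrow> 'z) \<Rightarrow> 'k \<Rightarrow> 'b \<Rightarrow> 'z"
  where "fiber_emb f = (\<lambda>k c. \<eta> c *\<^sub>C f k)"

definition fiber :: "('k \<Rightarrow> 'z) set"
  where "fiber = {f. fiber_emb f \<in> cover}"

lemma clinear_fiber_emb: "clinear fiber_emb"
  by (rule clinearI) (simp_all add: fiber_emb_def fun_eq_iff scaleC_add_right mult.commute)

lemma csubspace_fiber: "csubspace fiber"
  unfolding fiber_def
  by (rule complex_vector.subspaceI)
     (auto simp: clinear_add[OF clinear_fiber_emb] clinear_scale[OF clinear_fiber_emb]
       clinear_0[OF clinear_fiber_emb] complex_vector.subspace_0 complex_vector.subspace_add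
       complex_vector.subspace_scale csubspace_cover)

lemma finite_dim_fiber: "finite_dim fiber"
proof (rule finite_dim_subset)
  have "clinear (\<lambda>g k. g k (1::'b))"
    by (rule clinearI) (simp_all add: fun_eq_iff)
  then show "finite_dim ((\<lambda>g k. g k (1::'b)) ` cover)" by (rule finite_dim_image[OF _ cover_fd])
  show "fiber \<subseteq> (\<lambda>g k. g k (1::'b)) ` cover"
  proof
    fix f assume "f \<in> fiber"
    then show "f \<in> (\<lambda>g k. g k (1::'b)) ` cover"
      by (intro image_eqI[of _ _ "fiber_emb f"]) (simp_all add: fiber_def fiber_emb_def scaleC_one)
  qed
qed

lemma f0_fiber: "f0 \<in> fiber"
  using f0(2) by (simp add: fiber_def fiber_emb_def)

lemma fiber_support: "f \<in> fiber \<Longrightarrow> k \<notin> K \<Longrightarrow> f k = 0"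
  using cover_support[of "fiber_emb f" k 1] by (simp add: fiber_def fiber_emb_def scaleC_one)

lemma fiber_nonzero_value:
  assumes "f \<in> fiber" "f \<noteq> 0"
  shows "\<exists>k\<in>K. f k \<noteq> 0"
  using assms fiber_support by (metis ext zero_fun_apply)

text \<open>On the fibre the term of \<open>shift_op\<close> with the coefficient \<open>q\<close> carries the factor \<open>\<eta>(b)\<close>. Elements
\<open>t\<^sup>l e \<otimes> b\<close> with \<open>\<eta>(b) = 0\<close> therefore act without it: they vanish at the point \<open>\<eta>\<close> and act linearly
over \<open>A\<^sub>K\<close>. The operators \<open>isotropy_op\<close> of the elements \<open>t\<^sup>l e \<otimes> 1\<close> keep this term; they correspond
to the elements \<open>t\<^sup>l e - e\<close>, which vanish at the unit of the torus.\<close>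

definition vanishing_op :: "'e \<Rightarrow> 'k \<Rightarrow> 'b \<Rightarrow> ('k \<Rightarrow> 'z) \<Rightarrow> 'k \<Rightarrow> 'z"
  where "vanishing_op e l b f = (\<lambda>k. a e l b (f (k - l)))"

definition isotropy_op :: "'e \<Rightarrow> 'k \<Rightarrow> ('k \<Rightarrow> 'z) \<Rightarrow> 'k \<Rightarrow> 'z"
  where "isotropy_op e l f = (\<lambda>k. a e l 1 (f (k - l)) - q e (k - l) *\<^sub>C f k)"

lemma clinear_vanishing_op: "e \<in> E \<Longrightarrow> l \<in> K \<Longrightarrow> clinear (vanishing_op e l b)"
  by (rule clinearI)
     (simp_all add: vanishing_op_def fun_eq_iff clinear_add[OF a_clinear] clinear_scale[OF a_clinear])

lemma clinear_isotropy_op: "e \<in> E \<Longrightarrow> l \<in> K \<Longrightarrow> clinear (isotropy_op e l)"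
  by (rule clinearI)
     (simp_all add: isotropy_op_def fun_eq_iff clinear_add[OF a_clinear] clinear_scale[OF a_clinear]
        scaleC_add_right complex_vector.scale_right_diff_distrib mult.commute)

lemma vanishing_op_fiber:
  assumes "e \<in> E" "l \<in> K" "\<eta> b = 0" "f \<in> fiber"
  shows "vanishing_op e l b f \<in> fiber"
proof -
  have "shift_op e l b (fiber_emb f) = fiber_emb (vanishing_op e l b f)"
    by (simp add: shift_op_def fiber_emb_def vanishing_op_def fun_eq_iff
        clinear_scale[OF a_clinear] assms)
  then show ?thesis using shift_op_cover[OF assms(1,2), of "fiber_emb f" b] assms(4) by (simp add: fiber_def)
qed

lemma isotropy_op_fiber:
  assumes "e \<in> E" "l \<in> K" "f \<in> fiber"
  shows "isotropy_op e l f \<in> fiber"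
proof -
  have "shift_op e l 1 (fiber_emb f) = fiber_emb (isotropy_op e l f)"
    by (simp add: shift_op_def fiber_emb_def isotropy_op_def fun_eq_iff
        clinear_scale[OF a_clinear] assms complex_vector.scale_right_diff_distrib mult.commute)
  then show ?thesis using shift_op_cover[OF assms(1,2), of "fiber_emb f" 1] assms(3) by (simp add: fiber_def)
qed

lemma ann_ker: "b \<in> ann \<Longrightarrow> \<eta> b = 0"
proof -
  assume "b \<in> ann"
  then have "alg_op b (fiber_emb f0) = 0" using alg_op_zero_iff f0_fiber by (auto simp: fiber_def)
  moreover obtain k where "f0 k \<noteq> 0" using f0(1) by (auto simp: fun_eq_iff)
  ultimately have "\<eta> (b * 1) *\<^sub>C f0 k = 0" "f0 k \<noteq> 0"
    by (auto simp: alg_op_def fiber_emb_def fun_eq_iff dest: spec[of _ k])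
  then show "\<eta> b = 0" by (simp add: complex_vector.scale_eq_0_iff)
qed

text \<open>Modulo \<open>ann\<close>, multiplication by \<open>c\<close> has the eigenvector \<open>b\<close> with eigenvalue \<open>x \<noteq> 0\<close>. Then \<open>e0 \<otimes> c\<close> and
\<open>t\<^sup>l e \<otimes> b\<close> satisfy a relation \<open>[h, X] = x q(l) X\<close> on the finite dimensional fibre, so that \<open>t\<^sup>l e \<otimes> b\<close>
is zero there for all \<open>l\<close> outside finitely many values of \<open>q(l)\<close>. Modulo
\<open>ann\<close>, every \<open>t\<^sup>m e \<otimes> b\<close> is a combination of brackets of some \<open>t\<^sup>m\<^sup>-\<^sup>l e0 \<otimes> c\<close> with such elements. This
is where it matters that \<open>K\<close> is infinite.\<close>

lemma ann_of_ker_eigen: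
  assumes c: "\<eta> c = 0" and x: "x \<noteq> 0" and cb: "c * b - x *\<^sub>C b \<in> ann"
  shows "b \<in> ann"
proof -
  have "\<eta> (c * b - x *\<^sub>C b) = 0" by (rule ann_ker[OF cb])
  then have b: "\<eta> b = 0" using c x by simp
  have cbd: "a e k (c * (b * d)) v = x *\<^sub>C a e k (b * d) v" if "e \<in> E" "k \<in> K" for e k d v
  proof -
    have eq: "c * (b * d) = (c * b - x *\<^sub>C b) * d + x *\<^sub>C (b * d)"
      by (simp add: algebra_simps scaleC_mult_left scaleC_mult_right)
    show ?thesis
      unfolding eq a_add[OF that] a_scale[OF that] annD[OF cb that] by simp
  qed
  obtain \<kappa> where \<kappa>: "\<kappa> \<in> K" "\<kappa> \<noteq> 0" using K_nontrivial by blast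
  obtain e0 where e0: "e0 \<in> E" "q e0 \<kappa> \<noteq> 0" using q_separates[OF \<kappa>] by blast
  obtain ms where ms: "\<And>f. f \<in> fiber \<Longrightarrow> annih (vanishing_op e0 0 c) ms f = 0"
    using finite_dim_annih[OF clinear_vanishing_op[OF e0(1) K_zero] finite_dim_fiber csubspace_fiber]
      vanishing_op_fiber[OF e0(1) K_zero c] by (metis image_subsetI)
  define D where "D = (\<lambda>(m, n). m - n) ` (set ms \<times> set ms)"
  have killed: "a e l (b * d) (f k) = 0"
    if e: "e \<in> E" and l: "l \<in> K" "x * q e0 l \<notin> D" and f: "f \<in> fiber" for e l d f k
  proof -
    let ?X = "vanishing_op e l (b * d)" and ?h = "vanishing_op e0 0 c"
    have "?X f = 0"
    proof (rule eigenvalue_shift_zero[where d = "x * q e0 l" and h = ?h and X = ?X and F = fiber and ms = ms])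
      show "clinear ?h" "clinear ?X" using clinear_vanishing_op e e0 l K_zero by blast+
      show "csubspace fiber" by (rule csubspace_fiber)
      show "?h ` fiber \<subseteq> fiber" using vanishing_op_fiber[OF e0(1) K_zero c] by blast
      show "?X ` fiber \<subseteq> fiber" using vanishing_op_fiber[OF e l(1)] b by auto
      show "\<And>f. f \<in> fiber \<Longrightarrow> annih ?h ms f = 0" by (rule ms)
      show "?h (?X g) = ?X (?h g) + (x * q e0 l) *\<^sub>C ?X g" if "g \<in> fiber" for g
        using bracket[OF e0(1) e l(1) K_zero, of c "b * d"] cbd[OF e l(1)]
        by (simp add: vanishing_op_def fun_eq_iff mult.commute[of "b * d" c] mult.commute[of x])
      show "x * q e0 l \<noteq> m - n" if "m \<in> set ms" "n \<in> set ms" for m n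
      proof -
        have "m - n \<in> D" unfolding D_def using that by force
        then show ?thesis using l(2) by auto
      qed
      show "f \<in> fiber" by (rule f)
    qed
    then have "?X f (k + l) = 0" by simp
    then show ?thesis by (simp add: vanishing_op_def)
  qed
  obtain k0 where k0: "k0 \<in> K" "f0 k0 \<noteq> 0" using fiber_nonzero_value[OF f0_fiber f0(1)] by blast
  show ?thesis
  proof (rule ann_of_killed_vector[OF k0(2)])
    fix e m d assume e: "e \<in> E" and m: "m \<in> K"
    \<comment> \<open>Both \<open>q e0 l\<close> and \<open>q e0 l - q e0 (m - l) = 2 q e0 l - q e0 m\<close> have to be nonzero.\<close>
    define Bad where "Bad = (\<lambda>y. y / x) ` D \<union> {0, q e0 m / 2}"
    have "finite Bad" unfolding Bad_def D_def by simp
    then obtain l where l: "l \<in> K" "q e0 l \<notin> Bad" using far_degree[OF e0(1) \<kappa>(1) e0(2)] by blast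
    then have "x * q e0 l \<notin> D" "q e0 l \<noteq> 0" and half: "q e0 l \<noteq> q e0 m / 2"
      unfolding Bad_def using x by (auto simp: image_iff)
    then have q2: "q e0 l - q e0 (m - l) \<noteq> 0" by (simp add: q_diff field_simps)
    have ml: "m - l \<in> K" using m l K_diff by blast
    have rel: "q e0 l *\<^sub>C a e' m (b * d) (f0 k0) = q e' (m - l) *\<^sub>C a e0 m (b * d) (f0 k0)"
      if e': "e' \<in> E" for e'
    proof -
      have "vanishing_op e0 (m - l) c f0 \<in> fiber"
        by (rule vanishing_op_fiber[OF e0(1) ml c f0_fiber])
      from killed[OF e' l(1) \<open>x * q e0 l \<notin> D\<close> this, of d "k0 + (m - l)"]
      have "a e' l (b * d) (a e0 (m - l) c (f0 k0)) = 0" by (simp add: vanishing_op_def)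
      moreover have "a e' l (b * d) (f0 k0) = 0"
        by (rule killed[OF e' l(1) \<open>x * q e0 l \<notin> D\<close> f0_fiber])
      ultimately have "q e0 l *\<^sub>C a e' m (b * d * c) (f0 k0) = q e' (m - l) *\<^sub>C a e0 m (b * d * c) (f0 k0)"
        using bracket[OF e0(1) e' l(1) ml, of c "b * d" "f0 k0"] e0(1) ml
        by (simp add: a_zero_vec)
      then have "x *\<^sub>C (q e0 l *\<^sub>C a e' m (b * d) (f0 k0)) = x *\<^sub>C (q e' (m - l) *\<^sub>C a e0 m (b * d) (f0 k0))"
        using cbd[OF e' m, of d] cbd[OF e0(1) m, of d] by (simp add: mult.commute mult.left_commute)
      then show ?thesis using x complex_vector.scale_left_imp_eq by blast
    qed
    have "a e0 m (b * d) (f0 k0) = 0"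
      using rel[OF e0(1)] q2 complex_vector.scale_right_imp_eq by auto
    then show "a e m (b * d) (f0 k0) = 0"
      using rel[OF e] \<open>q e0 l \<noteq> 0\<close> by simp
  qed
qed

text \<open>If \<open>b\<close> is killed by the maximal ideal of \<open>\<eta>\<close> modulo \<open>ann\<close>, the elements \<open>t\<^sup>l e \<otimes> b\<close> commute on the
fibre and have a joint eigenvector, with eigenvalues \<open>\<theta> e l\<close>. Brackets with the isotropy operators are
combinations of these elements again, hence have eigenvalue \<open>0\<close> by
\<open>commutator_kills_joint_eigenvector\<close>. The resulting linear relations between the numbers \<open>\<theta> e l\<close> have
only the zero solution, so all \<open>t\<^sup>l e \<otimes> b\<close> kill the values of the joint eigenvector.\<close>

lemma ann_of_ker_socle:
  assumes b: "\<eta> b = 0" and socle: "\<And>c. \<eta> c = 0 \<Longrightarrow> b * c \<in> ann"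
  shows "b \<in> ann"
proof -
  have bb: "a e k (b * b) v = 0" if "e \<in> E" "k \<in> K" for e k v
    using annD[OF socle[OF b] that, of 1] by simp
  define N where "N = cspan {vanishing_op e l b | e l. e \<in> E \<and> l \<in> K}"
  have "\<exists>f\<in>fiber. f \<noteq> 0 \<and> (\<forall>h\<in>{vanishing_op e l b | e l. e \<in> E \<and> l \<in> K}. \<exists>m. h f = m *\<^sub>C f)"
  proof (rule common_eigenvector[OF finite_dim_fiber csubspace_fiber])
    show "fiber \<noteq> {0}" using f0_fiber f0(1) by blast
    fix h assume "h \<in> {vanishing_op e l b | e l. e \<in> E \<and> l \<in> K}"
    then obtain e l where h: "h = vanishing_op e l b" "e \<in> E" "l \<in> K" by blast
    show "clinear h" "h ` fiber \<subseteq> fiber"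
      using clinear_vanishing_op vanishing_op_fiber b h by blast+
    fix h' f assume "h' \<in> {vanishing_op e l b | e l. e \<in> E \<and> l \<in> K}"
    then obtain e' l' where h': "h' = vanishing_op e' l' b" "e' \<in> E" "l' \<in> K" by blast
    show "h (h' f) = h' (h f)"
      using bracket[OF h(2) h'(2,3) h(3), of b b] bb h h'
      by (simp add: vanishing_op_def fun_eq_iff K_add algebra_simps)
  qed
  then obtain f where f: "f \<in> fiber" "f \<noteq> 0"
    and eig: "\<forall>h\<in>{vanishing_op e l b | e l. e \<in> E \<and> l \<in> K}. \<exists>m. h f = m *\<^sub>C f" by blast
  have "\<exists>m. e \<in> E \<longrightarrow> l \<in> K \<longrightarrow> vanishing_op e l b f = m *\<^sub>C f" for e l
    using eig by blast
  then obtain \<theta> where \<theta>: "\<And>e l. e \<in> E \<Longrightarrow> l \<in> K \<Longrightarrow> vanishing_op e l b f = \<theta> e l *\<^sub>C f"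
    by metis
  have N_gen: "vanishing_op e l b \<in> N" if "e \<in> E" "l \<in> K" for e l
    unfolding N_def using that by (intro complex_vector.span_base) blast
  have N_sub: "csubspace N" unfolding N_def by simp
  have comm: "vanishing_op e' l' b (isotropy_op e l g) = isotropy_op e l (vanishing_op e' l' b g)
      + (q e' l *\<^sub>C vanishing_op e (l + l') b + q e l' *\<^sub>C vanishing_op e' l' b
         - q e l' *\<^sub>C vanishing_op e' (l + l') b) g"
    if "e \<in> E" "e' \<in> E" "l \<in> K" "l' \<in> K" for e e' l l' g
  proof
    fix k
    let ?w = "g (k - (l + l'))" and ?u = "g (k - l')"
    have idx: "k - l' - l = k - (l + l')" "k - l - l' = k - (l + l')" by simp_all
    have L: "vanishing_op e' l' b (isotropy_op e l g) k
        = a e' l' b (a e l 1 ?w) - q e (k - (l + l')) *\<^sub>C a e' l' b ?u"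
      by (simp add: vanishing_op_def isotropy_op_def idx clinear_diff[OF a_clinear[OF that(2,4)]]
          clinear_scale[OF a_clinear[OF that(2,4)]])
    have R: "isotropy_op e l (vanishing_op e' l' b g) k
        = a e l 1 (a e' l' b ?w) - q e (k - l) *\<^sub>C a e' l' b ?u"
      by (simp add: vanishing_op_def isotropy_op_def idx)
    have B: "a e l 1 (a e' l' b ?w) = a e' l' b (a e l 1 ?w)
        + (q e l' *\<^sub>C a e' (l + l') b ?w - q e' l *\<^sub>C a e (l + l') b ?w)"
      using bracket[OF that(1,2,4,3), of 1 b ?w] by (simp add: add.commute[of l' l])
    have C: "(q e' l *\<^sub>C vanishing_op e (l + l') b + q e l' *\<^sub>C vanishing_op e' l' b
         - q e l' *\<^sub>C vanishing_op e' (l + l') b) g k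
        = q e' l *\<^sub>C a e (l + l') b ?w + q e l' *\<^sub>C a e' l' b ?u - q e l' *\<^sub>C a e' (l + l') b ?w"
      by (simp add: vanishing_op_def)
    have S: "q e (k - l) *\<^sub>C a e' l' b ?u = q e (k - (l + l')) *\<^sub>C a e' l' b ?u + q e l' *\<^sub>C a e' l' b ?u"
      unfolding scaleC_add_left[symmetric] by (simp add: q_diff q_add)
    show "vanishing_op e' l' b (isotropy_op e l g) k = (isotropy_op e l (vanishing_op e' l' b g)
      + (q e' l *\<^sub>C vanishing_op e (l + l') b + q e l' *\<^sub>C vanishing_op e' l' b
         - q e l' *\<^sub>C vanishing_op e' (l + l') b) g) k"
      unfolding plus_fun_apply[of "isotropy_op e l _"] L R B C S by simp
  qed
  have zero: "(q e' l *\<^sub>C vanishing_op e (l + l') b + q e l' *\<^sub>C vanishing_op e' l' b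
         - q e l' *\<^sub>C vanishing_op e' (l + l') b) f = 0"
    if el: "e \<in> E" "e' \<in> E" "l \<in> K" "l' \<in> K" for e e' l l'
  proof (rule commutator_kills_joint_eigenvector[OF finite_dim_fiber f])
    show "clinear (isotropy_op e l)" by (rule clinear_isotropy_op[OF el(1,3)])
    show "isotropy_op e l ` fiber \<subseteq> fiber" using isotropy_op_fiber[OF el(1,3)] by blast
    show "vanishing_op e' l' b \<in> N" by (rule N_gen[OF el(2,4)])
    show "q e' l *\<^sub>C vanishing_op e (l + l') b + q e l' *\<^sub>C vanishing_op e' l' b
         - q e l' *\<^sub>C vanishing_op e' (l + l') b \<in> N"
      by (intro complex_vector.subspace_diff complex_vector.subspace_add complex_vector.subspace_scale
          N_sub N_gen K_add el)
    show "vanishing_op e' l' b (isotropy_op e l g) = isotropy_op e l (vanishing_op e' l' b g)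
      + (q e' l *\<^sub>C vanishing_op e (l + l') b + q e l' *\<^sub>C vanishing_op e' l' b
         - q e l' *\<^sub>C vanishing_op e' (l + l') b) g" for g
      by (rule comm[OF el])
    fix x assume "x \<in> N"
    then have "clinear x \<and> (\<exists>m. x f = m *\<^sub>C f) \<and>
        (\<exists>z\<in>N. \<forall>g. x (isotropy_op e l g) = isotropy_op e l (x g) + z g)"
      unfolding N_def
    proof (induction rule: complex_vector.span_induct_alt)
      case base
      have "(0 :: ('k \<Rightarrow> 'z) \<Rightarrow> 'k \<Rightarrow> 'z) \<in> N" by (rule complex_vector.subspace_0[OF N_sub])
      moreover have "clinear (0 :: ('k \<Rightarrow> 'z) \<Rightarrow> 'k \<Rightarrow> 'z)" by (rule clinearI) simp_all
      moreover have "\<exists>m. (0 :: ('k \<Rightarrow> 'z) \<Rightarrow> 'k \<Rightarrow> 'z) f = m *\<^sub>C f"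
        by (rule exI[of _ 0]) simp
      moreover have "\<forall>g. (0 :: ('k \<Rightarrow> 'z) \<Rightarrow> 'k \<Rightarrow> 'z) (isotropy_op e l g)
          = isotropy_op e l ((0 :: ('k \<Rightarrow> 'z) \<Rightarrow> 'k \<Rightarrow> 'z) g) + (0 :: ('k \<Rightarrow> 'z) \<Rightarrow> 'k \<Rightarrow> 'z) g"
        using clinear_0[OF clinear_isotropy_op[OF el(1,3)]] by (simp add: fun_eq_iff)
      ultimately show ?case unfolding N_def[symmetric] by blast
    next
      case (step c x y)
      then obtain e1 l1 where x: "x = vanishing_op e1 l1 b" "e1 \<in> E" "l1 \<in> K" by blast
      obtain m z where y: "clinear y" "y f = m *\<^sub>C f" "z \<in> N"
        "\<And>g. y (isotropy_op e l g) = isotropy_op e l (y g) + z g"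
        using step unfolding N_def by blast
      let ?z = "q e1 l *\<^sub>C vanishing_op e (l + l1) b + q e l1 *\<^sub>C vanishing_op e1 l1 b
         - q e l1 *\<^sub>C vanishing_op e1 (l + l1) b"
      have "c *\<^sub>C ?z + z \<in> N"
        by (intro complex_vector.subspace_diff complex_vector.subspace_add complex_vector.subspace_scale
          N_sub N_gen K_add el x y)
      moreover have "(c *\<^sub>C x + y) (isotropy_op e l g) = isotropy_op e l ((c *\<^sub>C x + y) g) + (c *\<^sub>C ?z + z) g" for g
        unfolding plus_fun_apply scaleC_apply x(1) comm[OF el(1) x(2) el(3) x(3)] y(4)
          clinear_add[OF clinear_isotropy_op[OF el(1,3)]] clinear_scale[OF clinear_isotropy_op[OF el(1,3)]]
        by (simp only: scaleC_add_right add_ac)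
      moreover have "clinear (c *\<^sub>C x + y)"
        unfolding x(1)
        by (rule clinearI)
           (simp_all add: clinear_add[OF y(1)] clinear_scale[OF y(1)] clinear_add[OF clinear_vanishing_op[OF x(2,3)]]
             clinear_scale[OF clinear_vanishing_op[OF x(2,3)]] scaleC_add_right mult.commute add_ac)
      moreover have "(c *\<^sub>C x + y) f = (c * \<theta> e1 l1 + m) *\<^sub>C f"
        by (simp add: x(1) \<theta>[OF x(2,3)] y(2) scaleC_add_left)
      ultimately show ?case unfolding N_def[symmetric] by blast
    qed
    then show "clinear x" "\<exists>m. x f = m *\<^sub>C f"
      "\<exists>z\<in>N. \<forall>g\<in>fiber. x (isotropy_op e l g) = isotropy_op e l (x g) + z g" by blast+
  qed
  have rel: "q e' l * \<theta> e (l + l') + q e l' * \<theta> e' l' = q e l' * \<theta> e' (l + l')"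
    if "e \<in> E" "e' \<in> E" "l \<in> K" "l' \<in> K" for e e' l l'
  proof -
    have "(q e' l * \<theta> e (l + l') + q e l' * \<theta> e' l' - q e l' * \<theta> e' (l + l')) *\<^sub>C f = 0"
      using zero[OF that] \<theta>[OF that(1) K_add[OF that(3,4)]] \<theta>[OF that(2) K_add[OF that(3,4)]] \<theta>[OF that(2,4)]
      by (simp add: scaleC_add_left complex_vector.scale_left_diff_distrib)
    then show ?thesis using f(2) by (simp add: complex_vector.scale_eq_0_iff)
  qed
  \<comment> \<open>In degrees \<open>l \<noteq> 0\<close> take \<open>l' = 0\<close> in \<open>rel\<close>; degree \<open>0\<close> is reached from \<open>l' = - l\<close>.\<close>
  have \<theta>_nz: "\<theta> e l = 0" if el: "e \<in> E" "l \<in> K" "l \<noteq> 0" for e l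
  proof -
    obtain e' where "e' \<in> E" "q e' l \<noteq> 0" using q_separates[OF el(2,3)] by blast
    then show ?thesis using rel[OF el(1) _ el(2) K_zero, of e'] by simp
  qed
  have \<theta>_0: "\<theta> e 0 = 0" if "e \<in> E" for e
  proof -
    obtain \<kappa> where \<kappa>: "\<kappa> \<in> K" "\<kappa> \<noteq> 0" using K_nontrivial by blast
    obtain e0 where e0: "e0 \<in> E" "q e0 \<kappa> \<noteq> 0" using q_separates[OF \<kappa>] by blast
    have "\<theta> e0 0 = 0"
      using rel[OF e0(1) e0(1) \<kappa>(1) K_neg[OF \<kappa>(1)]] \<theta>_nz[OF e0(1) K_neg[OF \<kappa>(1)]] \<kappa>(2) e0(2)
      by (simp add: q_neg)
    then show ?thesis
      using rel[OF e0(1) that \<kappa>(1) K_neg[OF \<kappa>(1)]] \<theta>_nz[OF that K_neg[OF \<kappa>(1)]] \<kappa>(2) e0(2)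
      by (simp add: q_neg)
  qed
  obtain k0 where k0: "k0 \<in> K" "f k0 \<noteq> 0" using fiber_nonzero_value[OF f] by blast
  show ?thesis
  proof (rule ann_of_killed_vector[OF k0(2)])
    fix e k d assume e: "e \<in> E" and k: "k \<in> K"
    have "vanishing_op e k b f = 0" using \<theta>[OF e k] \<theta>_nz[OF e k] \<theta>_0[OF e] by (cases "k = 0") auto
    then have "vanishing_op e k b f (k0 + k) = 0" by simp
    then have 0: "a e k b (f k0) = 0" by (simp add: vanishing_op_def)
    \<comment> \<open>Modulo \<open>ann\<close>, the element \<open>b d\<close> is \<open>\<eta>(d) b\<close>.\<close>
    have d: "b * d = b * (d - \<eta> d *\<^sub>C 1) + \<eta> d *\<^sub>C b"
      by (simp add: right_diff_distrib scaleC_mult_right)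
    have "b * (d - \<eta> d *\<^sub>C 1) \<in> ann" by (rule socle) simp
    from annD[OF this e k, of 1] show "a e k (b * d) (f k0) = 0"
      by (subst d) (simp add: a_add[OF e k] a_scale[OF e k] 0)
  qed
qed

text \<open>Among the elements of the kernel of \<open>\<eta>\<close> outside \<open>ann\<close> choose \<open>b1\<close> of minimal rank on the cover. If
\<open>c\<close> lies in the kernel and \<open>b1 c\<close> is not in \<open>ann\<close>, then \<open>b1 c\<close> and \<open>b1\<close> have the same image, so \<open>c\<close> is
surjective on the image of \<open>b1\<close>. In a product \<open>b1 \<Prod> (c - n)\<close> that vanishes on the cover, factors with
\<open>n \<noteq> 0\<close> can be removed by \<open>ann_of_ker_eigen\<close> and factors with \<open>n = 0\<close> by this surjectivity, so that
\<open>b1\<close> itself would be in \<open>ann\<close>. Hence \<open>b1\<close> satisfies the assumption of \<open>ann_of_ker_socle\<close>.\<close>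

lemma ker_subset_ann:
  assumes "\<eta> b = 0"
  shows "b \<in> ann"
proof (rule ccontr)
  assume "b \<notin> ann"
  let ?d = "\<lambda>b. complex_vector.dim (alg_op b ` cover)"
  define b1 where "b1 = arg_min ?d (\<lambda>b. \<eta> b = 0 \<and> b \<notin> ann)"
  have b1: "\<eta> b1 = 0" "b1 \<notin> ann"
    using arg_min_natI[of "\<lambda>b. \<eta> b = 0 \<and> b \<notin> ann" b ?d] assms \<open>b \<notin> ann\<close> by (auto simp: b1_def)
  have least: "?d b1 \<le> ?d c" if "\<eta> c = 0" "c \<notin> ann" for c
    using arg_min_nat_le[of "\<lambda>b. \<eta> b = 0 \<and> b \<notin> ann" c ?d] that by (simp add: b1_def)
  have sub: "csubspace (alg_op c ` cover)" for c
    using clinear_alg_op[of c] csubspace_cover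
    by (simp add: Vector_Spaces.linear_iff_module_hom module_hom.subspace_image)
  have fd: "finite_dim (alg_op c ` cover)" for c
    by (rule finite_dim_image[OF clinear_alg_op cover_fd])
  have comp: "alg_op c (alg_op c' f) = alg_op (c * c') f" for c c' f
    by (simp add: alg_op_def mult_ac)
  have "b1 * c \<in> ann" if c: "\<eta> c = 0" for c
  proof (rule ccontr)
    assume nin: "b1 * c \<notin> ann"
    have "alg_op (b1 * c) ` cover \<subseteq> alg_op b1 ` cover"
      using alg_op_cover by (auto simp: comp[symmetric])
    then have same: "alg_op (b1 * c) ` cover = alg_op b1 ` cover"
      using dim_psubset[OF fd sub sub, of "b1 * c" b1] least[of "b1 * c"] b1(1) nin by auto
    obtain ms where ms: "\<And>f. f \<in> cover \<Longrightarrow> annih (alg_op c) ms f = 0"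
      using finite_dim_annih[OF clinear_alg_op cover_fd csubspace_cover, of c] alg_op_cover
      by (metis image_subsetI)
    define p where "p ns = (\<Prod>n\<leftarrow>ns. c - n *\<^sub>C 1)" for ns
    have annih_p: "annih (alg_op c) ns f = alg_op (p ns) f" if f: "f \<in> cover" for ns f
    proof (induction ns)
      case (Cons n ns)
      have "p (n # ns) * d = c * (p ns * d) - n *\<^sub>C (p ns * d)" for d
        by (simp add: p_def algebra_simps scaleC_mult_left scaleC_mult_right)
      then have "f k (p (n # ns) * d) = f k (p ns * (c * d)) - n *\<^sub>C f k (p ns * d)" for k d
        by (simp add: clinear_diff[OF cover_linear[OF f]] clinear_scale[OF cover_linear[OF f]] mult.left_commute)
      then show ?case using Cons by (simp add: alg_op_def fun_eq_iff)
    qed (simp add: p_def alg_op_def)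
    have "b1 * p ns \<in> ann \<Longrightarrow> b1 \<in> ann" for ns
    proof (induction ns)
      case (Cons n ns)
      have eq: "b1 * p (n # ns) = c * (b1 * p ns) - n *\<^sub>C (b1 * p ns)"
        by (simp add: p_def algebra_simps scaleC_mult_left scaleC_mult_right)
      show ?case
      proof (cases "n = 0")
        case False
        have "b1 * p ns \<in> ann"
          by (rule ann_of_ker_eigen[OF c False]) (use Cons.prems in \<open>simp only: eq\<close>)
        then show ?thesis by (rule Cons.IH)
      next
        case True
        have "alg_op (b1 * p ns) f = 0" if f: "f \<in> cover" for f
        proof -
          have "alg_op b1 f \<in> alg_op (b1 * c) ` cover" using f same by blast
          then obtain g where g: "g \<in> cover" "alg_op b1 f = alg_op (b1 * c) g" by blast
          have "alg_op (b1 * p ns) f = alg_op (p ns) (alg_op b1 f)" by (simp only: comp mult.commute)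
          also have "\<dots> = alg_op (b1 * p (n # ns)) g"
            unfolding g(2) comp eq unfolding True by (simp add: mult_ac)
          also have "\<dots> = 0" using Cons.prems g(1) alg_op_zero_iff[of "b1 * p (n # ns)"] by auto
          finally show ?thesis .
        qed
        then have "b1 * p ns \<in> ann" using alg_op_zero_iff[of "b1 * p ns"] by auto
        then show ?thesis by (rule Cons.IH)
      qed
    qed (simp add: p_def)
    moreover have "b1 * p ms \<in> ann"
    proof -
      have "alg_op (b1 * p ms) f = 0" if "f \<in> cover" for f
        using ms[OF alg_op_cover[OF that, of b1]] annih_p[OF alg_op_cover[OF that, of b1], of ms]
        by (simp only: comp mult.commute)
      then show ?thesis using alg_op_zero_iff[of "b1 * p ms"] by auto
    qed
    ultimately show False using b1(2) by blast
  qed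
  then show False using ann_of_ker_socle[OF b1(1)] b1(2) by blast
qed

end

text \<open>The algebra \<open>B\<close> acts on the cover by commuting operators; the eigenvalues at a joint eigenvector form
the homomorphism \<open>\<eta>\<close>. Its linearity comes from the fact that elements of the cover are linear in their
second argument.\<close>

theorem (in covered_module) evaluation_of_finite_dim_cover:
  assumes "finite_dim cover" "e \<in> E" "k \<in> K" "a e k b v \<noteq> 0"
  shows "\<exists>\<eta>. algebra_hom \<eta> \<and> (\<forall>b. \<eta> b = 0 \<longrightarrow> b \<in> ann)"
proof -
  have "\<exists>g\<in>cover. g \<noteq> 0 \<and> (\<forall>h\<in>range alg_op. \<exists>m. h g = m *\<^sub>C g)"
  proof (rule common_eigenvector[OF assms(1) csubspace_cover cover_nonzero[OF assms(2-4)]])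
    show "clinear h" "h ` cover \<subseteq> cover" if "h \<in> range alg_op" for h
      using that clinear_alg_op alg_op_cover by auto
    show "h (h' f) = h' (h f)" if "h \<in> range alg_op" "h' \<in> range alg_op" for h h' f
      using that by (auto simp: alg_op_def mult_ac)
  qed
  then obtain g where g: "g \<in> cover" "g \<noteq> 0" and eig: "\<forall>c. \<exists>m. alg_op c g = m *\<^sub>C g"
    by auto
  obtain \<eta> where \<eta>: "\<And>c. alg_op c g = \<eta> c *\<^sub>C g" using choice[OF eig] by auto
  have gc: "g k (c * d) = \<eta> c *\<^sub>C g k d" for k c d
    using fun_cong[OF fun_cong[OF \<eta>[of c], of k], of d] by (simp add: alg_op_def)
  obtain k0 where k0: "g k0 1 \<noteq> 0"
  proof -
    obtain k c where "g k c \<noteq> 0" using g(2) by (auto simp: fun_eq_iff)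
    then have "\<eta> c *\<^sub>C g k 1 \<noteq> 0" using gc[of k c 1] by simp
    then have "g k 1 \<noteq> 0" by auto
    then show ?thesis by (rule that)
  qed
  have inj: "x = y" if "x *\<^sub>C g k0 1 = y *\<^sub>C g k0 1" for x y
    using that k0 complex_vector.scale_right_imp_eq[of "g k0 1" x y] by auto
  have g1: "g k c = \<eta> c *\<^sub>C g k 1" for k c using gc[of k c 1] by (simp only: mult_1_right)
  have lin_g: "g k0 (b + c) = g k0 b + g k0 c" "g k0 (x *\<^sub>C b) = x *\<^sub>C g k0 b" for b c x
  proof -
    note lin = cover_linear[OF g(1), of k0]
    show "g k0 (b + c) = g k0 b + g k0 c" by (rule clinear_add[OF lin])
    show "g k0 (x *\<^sub>C b) = x *\<^sub>C g k0 b" by (rule clinear_scale[OF lin])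
  qed
  have hom: "algebra_hom \<eta>"
    unfolding algebra_hom_def
  proof (intro conjI allI clinearI)
    show "\<eta> (b + c) = \<eta> b + \<eta> c" for b c
      by (rule inj) (simp only: scaleC_add_left g1[symmetric] lin_g)
    show "\<eta> (x *\<^sub>C b) = x *\<^sub>C \<eta> b" for x b
      unfolding scaleC_complex_def
      by (rule inj) (simp only: scaleC_scaleC[symmetric] g1[symmetric] lin_g)
    show "\<eta> 1 = 1" by (rule inj) (simp only: g1[symmetric] scaleC_one)
    show "\<eta> (b * c) = \<eta> b * \<eta> c" for b c
      by (rule inj) (simp only: scaleC_scaleC[symmetric] g1[symmetric] gc)
  qed
  interpret evaluated_cover E K q a P \<eta> "\<lambda>k. g k 1"
  proof
    show "algebra_hom \<eta>" by (rule hom)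
    show "(\<lambda>k. g k 1) \<noteq> 0" using k0 by (auto simp: fun_eq_iff)
    have "(\<lambda>k c. \<eta> c *\<^sub>C g k 1) = g" by (simp only: g1[symmetric])
    then show "(\<lambda>k c. \<eta> c *\<^sub>C g k 1) \<in> cover" using g(1) by simp
  qed (rule assms(1))
  show ?thesis using hom ker_subset_ann by blast
qed

section \<open>From the top component to the whole module\<close>

text \<open>Vectors \<open>x\<^sub>1 \<dots> x\<^sub>n t\<close> with \<open>t\<close> in the top component \<open>T\<close> and all \<open>x\<^sub>i\<close> of level at most \<open>0\<close>; the integer
is the total level. The span of these words is a submodule, hence the whole irreducible module; this
takes the place of the Poincare-Birkhoff-Witt decomposition of the enveloping algebra.\<close>

inductive descending_word :: "'e set \<Rightarrow> ('k \<Rightarrow> int) \<Rightarrow> ('e \<Rightarrow> 'k \<Rightarrow> 'b \<Rightarrow> 'z \<Rightarrow> 'z) \<Rightarrow> 'z set \<Rightarrow> int \<Rightarrow> 'z \<Rightarrow> bool"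
  for E lv a T where
  top: "t \<in> T \<Longrightarrow> descending_word E lv a T 0 t"
| step: "descending_word E lv a T d v \<Longrightarrow> e \<in> E \<Longrightarrow> lv m \<le> 0 \<Longrightarrow> descending_word E lv a T (d + lv m) (a e m b v)"

text \<open>The elements \<open>t\<^sup>m e \<otimes> b\<close> with \<open>b \<in> J\<close> span an ideal, so their images span a submodule \<open>N\<close>. Commuting
such an element to the right through a word shows that it kills the word unless it ends up below level
\<open>0\<close>: on \<open>T\<close> itself it acts by zero in all levels \<open>\<ge> 0\<close>. So \<open>N\<close> lies in eigenspaces of the level operator
\<open>H\<close> other than that of \<open>T\<close>, hence is not the whole module.\<close>

lemma (in current_module) vanishing_spreads_from_top:
  fixes lv :: "'k \<Rightarrow> int"
  assumes K: "K = UNIV"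
    and lv_add: "\<And>k l. lv (k + l) = lv k + lv l"
    and H: "clinear H" "\<And>e m b v. e \<in> E \<Longrightarrow> H (a e m b v) = a e m b (H v) + of_int (lv m) *\<^sub>C a e m b v"
    and T: "t0 \<in> T" "t0 \<noteq> 0" "\<And>t. t \<in> T \<Longrightarrow> H t = \<alpha> *\<^sub>C t"
    and pos: "\<And>e m b t. e \<in> E \<Longrightarrow> t \<in> T \<Longrightarrow> lv m > 0 \<Longrightarrow> a e m b t = 0"
    and J: "\<And>b c. b \<in> J \<Longrightarrow> b * c \<in> J"
    and J0: "\<And>e m b t. e \<in> E \<Longrightarrow> b \<in> J \<Longrightarrow> t \<in> T \<Longrightarrow> lv m = 0 \<Longrightarrow> a e m b t = 0"
    and b: "b \<in> J" and e: "e \<in> E"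
  shows "a e m b v = 0"
proof -
  let ?w = "descending_word E lv a T"
  have clin: "clinear (a e m b)" if "e \<in> E" for e m b using a_clinear that K by simp
  note br = bracket[unfolded K, OF _ _ UNIV_I UNIV_I]
  have word_H: "d \<le> 0 \<and> H v = (\<alpha> + of_int d) *\<^sub>C v" if "?w d v" for d v
    using that
  proof induction
    case (step d v e m b)
    then show ?case
      by (simp add: H clinear_scale[OF clin] clinear_add[OF clin] scaleC_add_left)
  qed (simp add: T)
  define V where "V = cspan {v. \<exists>d. ?w d v}"
  have V_sub: "csubspace V" by (simp add: V_def)
  have word_V: "v \<in> V" if "?w d v" for d v
    unfolding V_def using that by (intro complex_vector.span_base) blast
  have V_desc: "a e m b v \<in> V" if "v \<in> V" "e \<in> E" "lv m \<le> 0" for e m b v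
    by (rule clinear_cspan_into[OF clin[OF that(2)] _ V_sub that(1)[unfolded V_def]])
       (use that in \<open>auto intro: word_V descending_word.step\<close>)
  have word_closed: "\<forall>e\<in>E. \<forall>m b. a e m b v \<in> V" if "?w d v" for d v
    using that
  proof induction
    case (top t)
    show ?case
    proof safe
      fix e m b assume e: "e \<in> E"
      show "a e m b t \<in> V"
      proof (cases "lv m > 0")
        case True
        then show ?thesis using pos[OF e top] complex_vector.subspace_0[OF V_sub] by simp
      next
        case False
        then show ?thesis using word_V[OF descending_word.step[OF descending_word.top[OF top] e]] by simp
      qed
    qed
  next
    case (step d v e' m' b')
    show ?case
    proof safe
      fix e m b assume e: "e \<in> E"
      have "a e' m' b' (a e m b v) \<in> V" by (rule V_desc) (simp_all add: step.IH e step.hyps)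
      then show "a e m b (a e' m' b' v) \<in> V"
        unfolding br[OF e step.hyps(2)]
        by (intro complex_vector.subspace_add complex_vector.subspace_diff complex_vector.subspace_scale V_sub)
           (simp_all add: step.IH e step.hyps(2))
    qed
  qed
  have V_UNIV: "V = UNIV"
  proof -
    have "V = {0} \<or> V = UNIV"
    proof (rule irreducible[OF V_sub])
      fix e k b w assume e: "e \<in> E" and w: "w \<in> V"
      show "a e k b w \<in> V"
        by (rule clinear_cspan_into[OF clin[OF e] _ V_sub w[unfolded V_def]]) (use word_closed e in auto)
    qed
    moreover have "t0 \<in> V" using word_V[OF descending_word.top[OF T(1)]] .
    ultimately show ?thesis using T(2) by auto
  qed
  have word_zero: "\<forall>e\<in>E. \<forall>m. \<forall>b\<in>J. d + lv m \<ge> 0 \<longrightarrow> a e m b v = 0" if "?w d v" for d v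
    using that
  proof induction
    case (top t)
    then show ?case using pos J0 by (metis add_0 order_le_less)
  next
    case (step d v e' m' b')
    show ?case
    proof safe
      fix e m b assume e: "e \<in> E" and b: "b \<in> J" and le: "0 \<le> d + lv m' + lv m"
      have "a e m b v = 0" using step.IH e b le step.hyps(3) by auto
      moreover have "a e' (m' + m) (b' * b) v = 0" "a e (m' + m) (b' * b) v = 0"
        using step.IH e step.hyps(2) J[OF b, of b'] le by (simp_all add: lv_add mult.commute add.assoc)
      ultimately show "a e m b (a e' m' b' v) = 0"
        unfolding br[OF e step.hyps(2)] by (simp add: clinear_0[OF clin[OF step.hyps(2)]])
    qed
  qed
  let ?L = "{w. \<exists>x\<in>{\<alpha> + of_int d | d. d < 0}. H w = x *\<^sub>C w}"
  define N where "N = cspan {a e m b v | e m b v. e \<in> E \<and> b \<in> J}"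
  have N_sub: "csubspace N" by (simp add: N_def)
  have low: "a e m b v \<in> cspan ?L" if e: "e \<in> E" and b: "b \<in> J" for e m b v
  proof -
    have "v \<in> cspan {v. \<exists>d. ?w d v}" using V_UNIV V_def by auto
    then show ?thesis
    proof (rule clinear_cspan_into[OF clin[OF e], rotated 2])
      fix v assume "v \<in> {v. \<exists>d. ?w d v}"
      then obtain d where d: "?w d v" by blast
      show "a e m b v \<in> cspan ?L"
      proof (cases "d + lv m \<ge> 0")
        case True
        then show ?thesis using word_zero[OF d] e b complex_vector.span_zero by auto
      next
        case False
        have "H (a e m b v) = (\<alpha> + of_int (d + lv m)) *\<^sub>C a e m b v"
          using word_H[OF d] by (simp add: H(2)[OF e] clinear_scale[OF clin[OF e]] clinear_add[OF clin[OF e]] scaleC_add_left)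
        then show ?thesis
          using False by (intro complex_vector.span_base CollectI bexI[of _ "\<alpha> + of_int (d + lv m)"])
            (auto intro!: exI[of _ "d + lv m"])
      qed
    qed simp
  qed
  have N_low: "N \<subseteq> cspan ?L"
    unfolding N_def by (rule complex_vector.span_minimal) (use low in auto)
  have "N = {0} \<or> N = UNIV"
  proof (rule irreducible[OF N_sub])
    fix e k b w assume e: "e \<in> E" and w: "w \<in> N"
    show "a e k b w \<in> N"
    proof (rule clinear_cspan_into[OF clin[OF e] _ N_sub w[unfolded N_def]])
      fix x assume "x \<in> {a e m b v | e m b v. e \<in> E \<and> b \<in> J}"
      then obtain e' m' b' v where x: "x = a e' m' b' v" "e' \<in> E" "b' \<in> J" by blast
      have gen: "a e m c v \<in> N" if "e \<in> E" "c \<in> J" for e m c v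
        unfolding N_def using that by (intro complex_vector.span_base) blast
      show "a e k b x \<in> N"
        unfolding x(1) br[OF e x(2)]
        by (intro complex_vector.subspace_add complex_vector.subspace_diff complex_vector.subspace_scale
            N_sub gen e x J)
    qed
  qed
  moreover have "N \<noteq> UNIV"
  proof
    assume "N = UNIV"
    then have "t0 \<in> cspan ?L" using N_low by auto
    then have "t0 = 0"
      by (rule eigenvectors_sum_distinct[OF H(1) _ T(3)[OF T(1)]]) auto
    then show False using T(2) by simp
  qed
  moreover have "a e m b v \<in> N"
    unfolding N_def using e b by (intro complex_vector.span_base) blast
  ultimately show ?thesis by auto
qed

section \<open>Points of finitely generated algebras\<close>

definition alg_ideal :: "'b::comm_complex_algebra set \<Rightarrow> bool"
  where "alg_ideal I \<longleftrightarrow> 0 \<in> I \<and> (\<forall>x\<in>I. \<forall>y\<in>I. x + y \<in> I) \<and> (\<forall>x\<in>I. \<forall>b. b * x \<in> I)"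

lemma alg_idealD:
  assumes "alg_ideal I"
  shows "0 \<in> I" "x \<in> I \<Longrightarrow> y \<in> I \<Longrightarrow> x + y \<in> I" "x \<in> I \<Longrightarrow> b * x \<in> I" "x \<in> I \<Longrightarrow> x * b \<in> I"
    "x \<in> I \<Longrightarrow> - x \<in> I" "x \<in> I \<Longrightarrow> y \<in> I \<Longrightarrow> x - y \<in> I" "x \<in> I \<Longrightarrow> c *\<^sub>C x \<in> I"
proof -
  show 0: "0 \<in> I" and add: "x \<in> I \<Longrightarrow> y \<in> I \<Longrightarrow> x + y \<in> I" and m: "x \<in> I \<Longrightarrow> b * x \<in> I" for x y b
    using assms unfolding alg_ideal_def by blast+
  show "x \<in> I \<Longrightarrow> x * b \<in> I" using m[of x b] by (simp add: mult.commute)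
  show n: "x \<in> I \<Longrightarrow> - x \<in> I" for x using m[of x "-1"] by simp
  show "x \<in> I \<Longrightarrow> y \<in> I \<Longrightarrow> x - y \<in> I" using add[of x "- y"] n by simp
  show "x \<in> I \<Longrightarrow> c *\<^sub>C x \<in> I" using m[of x "c *\<^sub>C 1"] by (simp add: scaleC_mult_left)
qed

lemma alg_ideal_sum: "alg_ideal I \<Longrightarrow> (\<And>i. i \<in> A \<Longrightarrow> f i \<in> I) \<Longrightarrow> sum f A \<in> I"
  by (induction A rule: infinite_finite_induct) (auto simp: alg_idealD)

text \<open>Zorn's lemma; maximality is used in the form that the quotient is a field.\<close>

lemma maximal_ideal_exists:
  obtains M :: "'b::comm_complex_algebra set"
  where "alg_ideal M" "1 \<notin> M" "\<And>x. x \<notin> M \<Longrightarrow> \<exists>y. x * y - 1 \<in> M"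
proof -
  let ?P = "{I :: 'b set. alg_ideal I \<and> 1 \<notin> I}"
  have "\<exists>M\<in>?P. \<forall>X\<in>?P. M \<subseteq> X \<longrightarrow> X = M"
  proof (rule subset_Zorn_nonempty)
    have "{0} \<in> ?P" by (simp add: alg_ideal_def)
    then show "?P \<noteq> {}" by blast
    fix C assume C: "C \<noteq> {}" "subset.chain ?P C"
    then have sub: "C \<subseteq> ?P" and lin: "\<And>X Y. X \<in> C \<Longrightarrow> Y \<in> C \<Longrightarrow> X \<subseteq> Y \<or> Y \<subseteq> X"
      unfolding subset.chain_def by blast+
    have "alg_ideal (\<Union>C)"
      unfolding alg_ideal_def
    proof (intro conjI ballI allI)
      have ideal: "alg_ideal X" if "X \<in> C" for X using sub that by auto
      obtain I where "I \<in> C" using C(1) by auto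
      then show "0 \<in> \<Union>C" using alg_idealD(1)[OF ideal] by auto
      fix x assume "x \<in> \<Union>C"
      then obtain X where X: "X \<in> C" "x \<in> X" by auto
      show "b * x \<in> \<Union>C" for b using alg_idealD(3)[OF ideal[OF X(1)] X(2)] X(1) by auto
      fix y assume "y \<in> \<Union>C"
      then obtain Y where Y: "Y \<in> C" "y \<in> Y" by auto
      obtain Z where Z: "Z \<in> C" "x \<in> Z" "y \<in> Z" using lin[OF X(1) Y(1)] X Y by auto
      show "x + y \<in> \<Union>C" using alg_idealD(2)[OF ideal[OF Z(1)] Z(2,3)] Z(1) by auto
    qed
    then show "\<Union>C \<in> ?P" using sub by blast
  qed
  then obtain M :: "'b set" where M: "alg_ideal M" "1 \<notin> M" and max: "\<And>X. alg_ideal X \<Longrightarrow> 1 \<notin> X \<Longrightarrow> M \<subseteq> X \<Longrightarrow> X = M"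
    by blast
  have "\<exists>y. x * y - 1 \<in> M" if x: "x \<notin> M" for x
  proof -
    let ?X = "{m + x * y | m y. m \<in> M}"
    have "alg_ideal ?X"
      unfolding alg_ideal_def
    proof (intro conjI ballI allI)
      show "0 \<in> ?X" by (rule CollectI, rule exI[of _ 0], rule exI[of _ 0]) (simp add: alg_idealD M)
      show "u + v \<in> ?X" if uv: "u \<in> ?X" "v \<in> ?X" for u v
      proof -
        obtain m y n z where "u = m + x * y" "v = n + x * z" "m \<in> M" "n \<in> M" using uv by blast
        then have "u + v = (m + n) + x * (y + z)" "m + n \<in> M"
          using alg_idealD(2)[OF M(1)] by (simp_all add: algebra_simps)
        then show ?thesis by blast
      qed
      show "b * u \<in> ?X" if u: "u \<in> ?X" for u b
      proof -
        obtain m y where m: "u = m + x * y" "m \<in> M" using u by blast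
        have "b * u = b * m + x * (b * y)" by (simp add: m(1) algebra_simps)
        moreover have "b * m \<in> M" by (rule alg_idealD(3)[OF M(1) m(2)])
        ultimately show ?thesis by blast
      qed
    qed
    moreover have "M \<subseteq> ?X"
    proof
      fix m assume "m \<in> M"
      then show "m \<in> ?X" by (intro CollectI exI[of _ m] exI[of _ 0]) simp
    qed
    moreover have "x \<in> ?X"
      by (rule CollectI, rule exI[of _ 0], rule exI[of _ 1]) (simp add: alg_idealD M)
    ultimately have "1 \<in> ?X" using max[of ?X] x by blast
    then obtain m y where "1 = m + x * y" "m \<in> M" by blast
    then have "x * y - 1 = - m" "- m \<in> M" using alg_idealD(5)[OF M(1)] by (simp_all add: algebra_simps)
    then show ?thesis by metis
  qed
  then show ?thesis using that M by blast
qed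

text \<open>A countable set has only countably many finite subsets, and each spans a finite dimensional subspace.\<close>

lemma countable_independent:
  assumes "countable S" "\<not> complex_vector.dependent A" "A \<subseteq> cspan S"
  shows "countable A"
proof -
  have "A \<subseteq> (\<Union>F\<in>{F. finite F \<and> F \<subseteq> S}. A \<inter> cspan F)"
  proof
    fix x assume x: "x \<in> A"
    then have "x \<in> cspan S" using assms(3) by blast
    then obtain F r where "finite F" "F \<subseteq> S" "x = (\<Sum>a\<in>F. r a *\<^sub>C a)"
      unfolding complex_vector.span_explicit by blast
    then show "x \<in> (\<Union>F\<in>{F. finite F \<and> F \<subseteq> S}. A \<inter> cspan F)"
      using x by (auto intro!: exI[of _ F] complex_vector.span_sum complex_vector.span_scale
          intro: complex_vector.span_base)
  qed
  moreover have "finite (A \<inter> cspan F)" if "finite F" for F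
    using complex_vector.independent_span_bound[OF that, of "A \<inter> cspan F"]
      complex_vector.independent_mono[OF assms(2), of "A \<inter> cspan F"] by auto
  then have "countable (\<Union>F\<in>{F. finite F \<and> F \<subseteq> S}. A \<inter> cspan F)"
    using countable_Collect_finite_subset[OF assms(1)]
    by (intro countable_UN) (auto intro: countable_finite)
  ultimately show ?thesis using countable_subset by blast
qed

definition alg_eval :: "'b::comm_complex_algebra \<Rightarrow> complex poly \<Rightarrow> 'b"
  where "alg_eval x p = poly (map_poly (\<lambda>c. c *\<^sub>C 1) p) x"

lemma alg_eval_0 [simp]: "alg_eval x 0 = 0"
  by (simp add: alg_eval_def)

lemma alg_eval_pCons [simp]: "alg_eval x (pCons c p) = c *\<^sub>C 1 + x * alg_eval x p"
  by (simp add: alg_eval_def map_poly_pCons)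

lemma alg_eval_add: "alg_eval x (p + q) = alg_eval x p + alg_eval x q"
  by (induction p q rule: poly_induct2) (simp_all add: scaleC_add_left algebra_simps)

lemma alg_eval_smult: "alg_eval x (smult c p) = c *\<^sub>C alg_eval x p"
  by (induction p) (simp_all add: scaleC_add_right scaleC_mult_right)

lemma alg_eval_mult: "alg_eval x (p * q) = alg_eval x p * alg_eval x q"
  by (induction p) (simp_all add: alg_eval_add alg_eval_smult scaleC_mult_left algebra_simps)

lemma alg_eval_1 [simp]: "alg_eval x 1 = 1"
  using alg_eval_pCons[of x 1 0] by (simp add: scaleC_one one_pCons)

lemma alg_eval_sum: "alg_eval x (sum f A) = (\<Sum>i\<in>A. alg_eval x (f i))"
  by (induction A rule: infinite_finite_induct) (simp_all add: alg_eval_add)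

lemma alg_eval_prod: "alg_eval x (prod f A) = (\<Prod>i\<in>A. alg_eval x (f i))"
  by (induction A rule: infinite_finite_induct) (simp_all add: alg_eval_mult)

lemma finitely_generated_countable_span:
  assumes "finitely_generated_algebra TYPE('b::comm_complex_algebra)"
  obtains S :: "'b::comm_complex_algebra set" where "countable S" "cspan S = UNIV"
proof -
  obtain F :: "'b set" where F: "finite F" "\<And>A. subalgebra A \<Longrightarrow> F \<subseteq> A \<Longrightarrow> A = UNIV"
    using assms unfolding finitely_generated_algebra_def by blast
  let ?S = "prod_list ` lists F"
  have "cspan ?S = UNIV"
  proof (rule F(2))
    show "F \<subseteq> cspan ?S"
    proof
      fix x assume "x \<in> F"
      then have "x \<in> ?S" by (intro image_eqI[of _ _ "[x]"]) auto
      then show "x \<in> cspan ?S" by (rule complex_vector.span_base)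
    qed
    show "subalgebra (cspan ?S)"
      unfolding subalgebra_def
    proof (intro conjI ballI)
      have "1 \<in> ?S" by (intro image_eqI[of _ _ "[]"]) auto
      then show "1 \<in> cspan ?S" by (rule complex_vector.span_base)
      fix x y assume x: "x \<in> cspan ?S" and y: "y \<in> cspan ?S"
      have lin: "clinear (\<lambda>x. z * x)" "clinear (\<lambda>x. x * z)" for z :: 'b
        by (auto intro!: clinearI simp: scaleC_mult_left scaleC_mult_right algebra_simps)
      have base: "u * v \<in> cspan ?S" if uv: "u \<in> ?S" "v \<in> ?S" for u v
      proof -
        obtain us vs where "u = prod_list us" "v = prod_list vs" "us \<in> lists F" "vs \<in> lists F" using uv by blast
        then have "u * v \<in> ?S" by (intro image_eqI[of _ _ "us @ vs"]) auto
        then show ?thesis by (rule complex_vector.span_base)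
      qed
      have "u * y \<in> cspan ?S" if "u \<in> ?S" for u
        by (rule clinear_cspan_into[OF lin(1) _ _ y]) (use base that in auto)
      then show "x * y \<in> cspan ?S"
        by (intro clinear_cspan_into[OF lin(2) _ _ x]) auto
    qed simp
  qed
  moreover have "countable ?S" using F(1) by (intro countable_image countable_lists countable_finite)
  ultimately show ?thesis using that by blast
qed

text \<open>The polynomial splits over \<open>\<complex>\<close>, and each factor \<open>x - r\<close> is a unit modulo \<open>M\<close>.\<close>

lemma no_evaluation_in_proper_ideal:
  assumes M: "alg_ideal M" "1 \<notin> M" and inv: "\<And>r. \<exists>y. (x - r *\<^sub>C 1) * y - 1 \<in> M"
  shows "p \<noteq> 0 \<Longrightarrow> alg_eval x p \<notin> M"
proof (induction "degree p" arbitrary: p)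
  case 0
  then obtain c where c: "p = [:c:]" "c \<noteq> 0" by (metis degree_eq_zeroE pCons_0_0)
  show ?case
  proof
    assume "alg_eval x p \<in> M"
    from alg_idealD(7)[OF M(1) this, of "inverse c"] show False
      using c M(2) by (simp add: scaleC_one)
  qed
next
  case (Suc n)
  then have "\<not> constant (poly p)" by (simp add: constant_degree)
  then obtain z where "poly p z = 0" using fundamental_theorem_of_algebra by blast
  then obtain q where q: "p = [:-z, 1:] * q" by (auto simp: poly_eq_0_iff_dvd elim: dvdE)
  then have q0: "q \<noteq> 0" using Suc.prems by auto
  have dp: "degree p = Suc (degree q)"
    unfolding q using q0 by (subst degree_mult_eq) auto
  obtain y where y: "(x - z *\<^sub>C 1) * y - 1 \<in> M" using inv by blast
  have ev: "alg_eval x p = (x - z *\<^sub>C 1) * alg_eval x q"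
    unfolding q alg_eval_mult by (simp add: scaleC_one)
  show ?case
  proof
    assume "alg_eval x p \<in> M"
    from alg_idealD(6)[OF M(1) alg_idealD(3)[OF M(1) this, of y] alg_idealD(4)[OF M(1) y, of "alg_eval x q"]]
    have "y * alg_eval x p - ((x - z *\<^sub>C 1) * y - 1) * alg_eval x q \<in> M" .
    moreover have "y * (w * e) - (w * y - 1) * e = e" for w e :: 'a by (simp add: algebra_simps)
    ultimately have "alg_eval x q \<in> M" by (simp only: ev)
    then show False using Suc.hyps(1)[OF _ q0] Suc.hyps(2) dp by simp
  qed
qed

text \<open>The weak Nullstellensatz, in the form that is special to uncountable fields. If the quotient of \<open>B\<close> by a
maximal ideal contained an element \<open>x\<close> that is not a scalar, the inverses \<open>y r\<close> of \<open>x - r\<close> would be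
linearly independent, since clearing denominators turns a linear relation between them into a
polynomial relation for \<open>x\<close>. There are uncountably many of them, but \<open>B\<close> has countable dimension.\<close>

lemma algebra_hom_exists:
  assumes fg: "finitely_generated_algebra TYPE('b::comm_complex_algebra)"
  shows "\<exists>\<eta> :: 'b::comm_complex_algebra \<Rightarrow> complex. algebra_hom \<eta>"
proof -
  obtain S :: "'b set" where S: "countable S" "cspan S = UNIV"
    using finitely_generated_countable_span[OF fg] by blast
  obtain M :: "'b set" where M: "alg_ideal M" "1 \<notin> M" "\<And>x. x \<notin> M \<Longrightarrow> \<exists>y. x * y - 1 \<in> M"
    using maximal_ideal_exists by blast
  have "\<exists>r. x - r *\<^sub>C 1 \<in> M" for x
  proof (rule ccontr)
    assume no: "\<nexists>r. x - r *\<^sub>C 1 \<in> M"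
    then have inv: "\<exists>y. (x - r *\<^sub>C 1) * y - 1 \<in> M" for r using M(3) by blast
    then obtain y where y: "\<And>r. (x - r *\<^sub>C 1) * y r - 1 \<in> M" by metis
    have indep: "c r = 0" if R: "finite R" "(\<Sum>r\<in>R. c r *\<^sub>C y r) = 0" "r \<in> R" for R c r
    proof (rule ccontr)
      assume cr: "c r \<noteq> 0"
      \<comment> \<open>The numerator of \<open>\<Sum>\<^sub>r c\<^sub>r / (X - r)\<close>; its value at \<open>r\<close> is \<open>c\<^sub>r\<close> times a nonzero product.\<close>
      define p where "p = (\<Sum>r\<in>R. smult (c r) (\<Prod>s\<in>R - {r}. [:-s, 1:]))"
      have "poly p r = (\<Sum>t\<in>R. c t * (\<Prod>s\<in>R - {t}. r - s))"
        by (simp add: p_def poly_sum poly_prod)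
      also have "\<dots> = (\<Sum>t\<in>R. if t = r then c r * (\<Prod>s\<in>R - {r}. r - s) else 0)"
      proof (rule sum.cong)
        fix t assume "t \<in> R"
        show "c t * (\<Prod>s\<in>R - {t}. r - s) = (if t = r then c r * (\<Prod>s\<in>R - {r}. r - s) else 0)"
          using R(1,3) by (auto intro!: prod_zero)
      qed simp
      also have "\<dots> = c r * (\<Prod>s\<in>R - {r}. r - s)" using R by simp
      finally have "poly p r \<noteq> 0" using cr R(1) by simp
      then have "p \<noteq> 0" by auto
      then have "alg_eval x p \<notin> M" by (rule no_evaluation_in_proper_ideal[OF M(1,2) inv])
      moreover have "alg_eval x p \<in> M"
      proof -
        let ?f = "\<lambda>s. x - s *\<^sub>C 1"
        have f: "alg_eval x [:-s, 1:] = ?f s" for s by (simp add: scaleC_one)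
        have "alg_eval x p = (\<Sum>r\<in>R. c r *\<^sub>C (\<Prod>s\<in>R - {r}. ?f s)) - (\<Prod>s\<in>R. ?f s) * (\<Sum>r\<in>R. c r *\<^sub>C y r)"
          by (simp only: R(2) p_def alg_eval_sum alg_eval_smult alg_eval_prod f mult_zero_right diff_zero)
        also have "\<dots> = (\<Sum>r\<in>R. c r *\<^sub>C (\<Prod>s\<in>R - {r}. ?f s) - c r *\<^sub>C ((\<Prod>s\<in>R. ?f s) * y r))"
          by (simp add: sum_distrib_left sum_subtractf scaleC_mult_right)
        also have "\<dots> \<in> M"
        proof (rule alg_ideal_sum[OF M(1)])
          fix r assume r: "r \<in> R"
          have "(\<Prod>s\<in>R. ?f s) = ?f r * (\<Prod>s\<in>R - {r}. ?f s)" using R(1) r by (rule prod.remove)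
          moreover have "k *\<^sub>C q - k *\<^sub>C (w * q * z) = (- k) *\<^sub>C ((w * z - 1) * q)" for k and q w z :: 'b
            by (simp add: algebra_simps complex_vector.scale_right_diff_distrib)
          ultimately have eq: "c r *\<^sub>C (\<Prod>s\<in>R - {r}. ?f s) - c r *\<^sub>C ((\<Prod>s\<in>R. ?f s) * y r)
            = (- c r) *\<^sub>C ((?f r * y r - 1) * (\<Prod>s\<in>R - {r}. ?f s))"
            by (simp only:)
          show "c r *\<^sub>C (\<Prod>s\<in>R - {r}. ?f s) - c r *\<^sub>C ((\<Prod>s\<in>R. ?f s) * y r) \<in> M"
            unfolding eq by (rule alg_idealD(7)[OF M(1) alg_idealD(4)[OF M(1) y[of r]]])
        qed
        finally show ?thesis .
      qed
      ultimately show False by blast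
    qed
    have "inj y"
    proof (rule injI, rule ccontr)
      fix r s assume rs: "y r = y s" "r \<noteq> s"
      then have "(\<Sum>t\<in>{r, s}. (if t = r then 1 else - 1) *\<^sub>C y t) = 0" by simp
      from indep[OF _ this, of r] show False by simp
    qed
    have "\<not> complex_vector.dependent (range y)"
    proof
      assume "complex_vector.dependent (range y)"
      then obtain t u v where t: "finite t" "t \<subseteq> range y" "(\<Sum>v\<in>t. u v *\<^sub>C v) = 0" "v \<in> t" "u v \<noteq> 0"
        unfolding complex_vector.dependent_explicit by blast
      obtain R where R: "t = y ` R" "finite R"
        using finite_subset_image[OF t(1,2)] by blast
      have "(\<Sum>r\<in>R. u (y r) *\<^sub>C y r) = 0"
        using t(3) \<open>inj y\<close> unfolding R(1) by (subst (asm) sum.reindex) (auto intro: inj_on_subset)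
      then show False using indep[OF R(2), of "\<lambda>r. u (y r)"] t(4,5) R(1) by blast
    qed
    from countable_independent[OF S(1) this] have "countable (range y)" by (simp add: S(2))
    then have "countable (UNIV :: complex set)" using \<open>inj y\<close> by (rule countable_image_inj_on)
    then have "countable (range complex_of_real)" by (rule countable_subset[rotated]) simp
    then have "countable (UNIV :: real set)"
      using countable_image_inj_on[of complex_of_real UNIV] by (simp add: inj_def)
    then show False using uncountable_UNIV_real by blast
  qed
  then obtain \<eta> where \<eta>: "\<And>x. x - \<eta> x *\<^sub>C 1 \<in> M" by metis
  have uniq: "\<eta> x = r" if "x - r *\<^sub>C 1 \<in> M" for x r
  proof (rule ccontr)
    assume ne: "\<eta> x \<noteq> r"
    have "(x - r *\<^sub>C 1) - (x - \<eta> x *\<^sub>C 1) \<in> M" using alg_idealD(6)[OF M(1) that \<eta>] .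
    then have "(\<eta> x - r) *\<^sub>C 1 \<in> M" by (simp add: complex_vector.scale_left_diff_distrib)
    from alg_idealD(7)[OF M(1) this, of "inverse (\<eta> x - r)"] show False
      using M(2) ne by (simp add: scaleC_one del: complex_vector.scale_left_diff_distrib)
  qed
  have "algebra_hom \<eta>"
    unfolding algebra_hom_def
  proof (intro conjI allI clinearI)
    show "\<eta> 1 = 1" by (rule uniq) (simp add: scaleC_one alg_idealD[OF M(1)])
    show "\<eta> (b + c) = \<eta> b + \<eta> c" for b c
      using alg_idealD(2)[OF M(1) \<eta>[of b] \<eta>[of c]]
      by (intro uniq) (simp add: scaleC_add_left algebra_simps)
    show "\<eta> (r *\<^sub>C b) = r *\<^sub>C \<eta> b" for r b
      using alg_idealD(7)[OF M(1) \<eta>[of b], of r]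
      by (intro uniq) (simp add: scaleC_complex_def complex_vector.scale_right_diff_distrib)
    show "\<eta> (b * c) = \<eta> b * \<eta> c" for b c
    proof (rule uniq)
      have "(b - \<eta> b *\<^sub>C 1) * c + \<eta> b *\<^sub>C (c - \<eta> c *\<^sub>C 1) \<in> M"
        using alg_idealD(2)[OF M(1) alg_idealD(4)[OF M(1) \<eta>[of b], of c] alg_idealD(7)[OF M(1) \<eta>[of c], of "\<eta> b"]] .
      moreover have "(b - \<eta> b *\<^sub>C 1) * c + \<eta> b *\<^sub>C (c - \<eta> c *\<^sub>C 1) = b * c - (\<eta> b * \<eta> c) *\<^sub>C 1"
        by (simp add: left_diff_distrib scaleC_mult_left complex_vector.scale_right_diff_distrib)
      ultimately show "b * c - (\<eta> b * \<eta> c) *\<^sub>C 1 \<in> M" by simp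
    qed
  qed
  then show ?thesis by blast
qed

section \<open>Homogeneous elements of the extended Witt algebra\<close>

lemma additive_int_vec:
  fixes f :: "int ^ 'n::finite \<Rightarrow> 'a::ring_1"
  assumes add: "\<And>k l. f (k + l) = f k + f l"
  shows "f m = (\<Sum>i\<in>UNIV. of_int (m $ i) * f (axis i 1))"
proof -
  have f0: "f 0 = 0" using add[of 0 0] by simp
  have fneg: "f (- v) = - f v" for v using add[of v "- v"] f0 by (simp add: eq_neg_iff_add_eq_0 add.commute)
  have scale: "f (z *s v) = of_int z * f v" for z v
  proof (induction z rule: int_induct[of _ 0])
    case base then show ?case by (simp add: f0)
  next
    case (step1 i) then show ?case by (simp add: add vector_sadd_rdistrib algebra_simps)
  next
    case (step2 i)
    have "(i - 1) *s v = i *s v + (- v)" by (simp add: vec_eq_iff algebra_simps)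
    then have "f ((i - 1) *s v) = f (i *s v) + f (- v)" by (simp only: add)
    then show ?case by (simp add: step2(2) fneg left_diff_distrib)
  qed
  have sum: "f (sum g A) = (\<Sum>i\<in>A. f (g i))" for g and A :: "'n set"
    by (induction A rule: infinite_finite_induct) (simp_all add: f0 add)
  have "f m = f (\<Sum>i\<in>UNIV. m $ i *s axis i 1)" by (simp add: basis_expansion)
  then show ?thesis by (simp add: sum scale)
qed

lemma pairing_add: "pairing u (k + l) = pairing u k + pairing u l"
  by (simp add: pairing_def algebra_simps sum.distrib)

lemma pairing_zero [simp]: "pairing 0 m = 0" "pairing u 0 = 0"
  by (simp_all add: pairing_def)

lemma pairing_axis: "pairing (axis i 1) m = of_int (m $ i)"
proof -
  have "(axis i 1 :: complex ^ 'a) $ j * c = (if j = i then c else 0)" for j c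
    by (simp add: axis_def)
  then show ?thesis by (simp add: pairing_def)
qed

lemma witt_D_diff: "witt_D (c *s v - d *s u) m = c *\<^sub>C witt_D v m - d *\<^sub>C witt_D u m"
  by (simp add: witt_D_def complex_vector.scale_left_diff_distrib sum_subtractf complex_vector.scale_sum_right)

lemma witt_D_zero [simp]: "witt_D 0 m = 0"
  by (simp add: witt_D_def)

lemma witt_D_sum: "witt_D u m = (\<Sum>i\<in>UNIV. u $ i *\<^sub>C witt_D (axis i 1) m)"
  and witt_D_axis: "witt_D (axis i 1) m = witt_mult (tpow m) (euler i)"
proof -
  show *: "witt_D (axis i 1) m = witt_mult (tpow m) (euler i)" for i
    by (simp add: witt_D_def axis_def if_distrib[of "\<lambda>c. c *\<^sub>C _"] scaleC_one cong: if_cong)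
  show "witt_D u m = (\<Sum>i\<in>UNIV. u $ i *\<^sub>C witt_D (axis i 1) m)"
    unfolding * by (simp add: witt_D_def)
qed

lemma tensor_zero_left: "0 \<otimes> y = (0 :: 'a::complex_vector \<otimes> 'b::complex_vector)"
  by (metis complex_vector.scale_zero_left tensor_scale_left)

lemma tensor_diff_left: "(x - x') \<otimes> y = x \<otimes> y - x' \<otimes> y"
  by (metis add_diff_cancel_right' diff_add_cancel tensor_add_left)

lemma clinear_sum: "clinear f \<Longrightarrow> f (sum g A) = (\<Sum>i\<in>A. f (g i))"
  by (induction A rule: infinite_finite_induct) (simp_all add: clinear_0 clinear_add)

lemma clinear_Ext_Witt_abelian: "clinear (\<lambda>a. Ext_Witt 0 a)"
  by (rule clinearI) (simp_all add: plus_ext_witt_def scaleC_ext_witt_def)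

lemma clinear_Ext_Witt_witt: "clinear (\<lambda>D. Ext_Witt D 0)"
  by (rule clinearI) (simp_all add: plus_ext_witt_def scaleC_ext_witt_def)

text \<open>The label \<open>(w, s)\<close> combines \<open>D(w, m)\<close> and \<open>s \<otimes> t\<^sup>m\<close> into one element \<open>t\<^sup>m (w, s)\<close>, for which both kinds
of brackets are given by a single formula.\<close>

definition homog :: "(complex ^ 'n) \<times> 's \<Rightarrow> int ^ 'n \<Rightarrow> ('s::complex_vector, 'n::finite) ext_witt"
  where "homog e m = Ext_Witt (witt_D (fst e) m) (snd e \<otimes> tpow m)"

lemma lie_homog:
  "lie (homog e l) (homog e' k)
    = pairing (fst e) k *\<^sub>C homog e' (k + l) - pairing (fst e') l *\<^sub>C homog e (k + l)"
  by (simp add: homog_def lie_ext_witt_def lie_witt_D witt_D_diff witt_act_tensor witt_D_tpow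
      tensor_scale_right scaleC_ext_witt_def minus_ext_witt_def add.commute[of l k])

lemma homog_expand:
  "(homog (u, 0) m :: ('s::complex_vector, 'n::finite) ext_witt)
    = (\<Sum>i\<in>UNIV. u $ i *\<^sub>C homog (axis i 1, 0) m)"
proof -
  show ?thesis
    unfolding homog_def fst_conv snd_conv tensor_zero_left
    by (subst witt_D_sum) (simp add: clinear_sum[OF clinear_Ext_Witt_witt] scaleC_ext_witt_def)
qed

text \<open>For a spanning set \<open>F\<close> of \<open>S\<close>, these are labels whose homogeneous elements span the Lie algebra. They
are finite in number if \<open>F\<close> is, so that the cover is a sum of finitely many pieces.\<close>

definition labels :: "'s set \<Rightarrow> ((complex ^ 'n) \<times> 's::complex_vector) set"
  where "labels F = range (\<lambda>i. (axis i 1, 0)) \<union> Pair 0 ` F"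

lemma finite_labels: "finite F \<Longrightarrow> finite (labels F :: ((complex ^ 'n::finite) \<times> 's::complex_vector) set)"
  by (simp add: labels_def)

lemma homog_abelian: "homog (0, s) m = Ext_Witt 0 (s \<otimes> tpow m)"
  by (simp add: homog_def)

lemma homog_euler: "homog (axis i 1, 0) m = Ext_Witt (witt_mult (tpow m) (euler i)) 0"
  by (simp add: homog_def witt_D_axis tensor_zero_left)

lemma clinear_tensor_left: "clinear (\<lambda>x. x \<otimes> y)"
  by (rule clinearI) (simp_all add: tensor_add_left tensor_scale_left)

lemma graded_piece_eq_span:
  assumes F: "cspan F = (UNIV :: 's::complex_vector set)"
  shows "(graded_piece m :: ('s, 'n::finite, 'b::comm_complex_algebra) current set) = cspan {homog e m \<otimes> b | e b. e \<in> labels F}"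
    (is "_ = cspan ?G")
proof
  show "cspan ?G \<subseteq> (graded_piece m :: ('s, 'n, 'b) current set)"
    unfolding graded_piece_def
  proof (rule complex_vector.span_mono, rule subsetI)
    fix x :: "('s, 'n, 'b) current" assume "x \<in> ?G"
    then obtain e b where x: "x = homog e m \<otimes> b" "e \<in> labels F" by blast
    from x(2) consider i where "e = (axis i 1, 0)" | s where "e = (0, s)" unfolding labels_def by blast
    then show "x \<in> {Ext_Witt (witt_mult (tpow m) (euler i)) 0 \<otimes> b |i b. True} \<union>
      {Ext_Witt 0 (s \<otimes> tpow m) \<otimes> b |s b. True}"
      unfolding x(1) by cases (simp only: homog_euler homog_abelian; blast)+
  qed
  show "graded_piece m \<subseteq> cspan ?G"
    unfolding graded_piece_def
  proof (rule complex_vector.span_minimal)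
    have "Ext_Witt (witt_mult (tpow m) (euler i)) 0 \<otimes> b \<in> ?G" for i b
      unfolding homog_euler[symmetric] labels_def by blast
    moreover have "Ext_Witt 0 (s \<otimes> tpow m) \<otimes> b \<in> cspan ?G" for s :: 's and b
    proof -
      have lin: "clinear (\<lambda>s. Ext_Witt 0 (s \<otimes> tpow m) \<otimes> b)"
        by (rule clinearI)
           (simp_all add: tensor_add_left tensor_scale_left clinear_add[OF clinear_Ext_Witt_abelian]
             clinear_scale[OF clinear_Ext_Witt_abelian])
      have "Ext_Witt 0 (s \<otimes> tpow m) \<otimes> b \<in> cspan ?G" if "s \<in> F" for s
      proof -
        have "Ext_Witt 0 (s \<otimes> tpow m) \<otimes> b \<in> ?G"
          unfolding homog_abelian[symmetric] labels_def using that by blast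
        then show ?thesis by (rule complex_vector.span_base)
      qed
      then show ?thesis
        by (rule clinear_cspan_into[OF lin, of F]) (simp_all add: F)
    qed
    ultimately show "{Ext_Witt (witt_mult (tpow m) (euler i)) 0 \<otimes> b |i b. True} \<union>
      {Ext_Witt 0 (s \<otimes> tpow m) \<otimes> b |s b. True} \<subseteq> cspan ?G"
      using complex_vector.span_base[of _ ?G] by auto
  qed simp
qed

lemma graded_sum_eq_span:
  assumes "cspan F = (UNIV :: 's::complex_vector set)"
  shows "(graded_sum R :: ('s, 'n::finite, 'b::comm_complex_algebra) current set) = cspan {homog e m \<otimes> b | e m b. e \<in> labels F \<and> m \<in> R}"
    (is "_ = cspan ?G")
proof
  show "graded_sum R \<subseteq> cspan ?G"
    unfolding graded_sum_def
  proof (rule complex_vector.span_minimal)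
    show "(\<Union>m\<in>R. graded_piece m) \<subseteq> cspan ?G"
      unfolding graded_piece_eq_span[OF assms]
    proof (rule UN_least)
      fix m assume "m \<in> R"
      then show "cspan {homog e m \<otimes> b | e b. e \<in> labels F} \<subseteq> cspan ?G"
        by (intro complex_vector.span_mono) blast
    qed
  qed simp
  show "cspan ?G \<subseteq> graded_sum R"
    unfolding graded_sum_def
  proof (rule complex_vector.span_mono, safe)
    fix e :: "(complex ^ 'n) \<times> 's" and m :: "int ^ 'n" and b :: 'b
    assume "e \<in> labels F" "m \<in> R"
    moreover from this have "homog e m \<otimes> b \<in> graded_piece m"
      unfolding graded_piece_eq_span[OF assms] by (intro complex_vector.span_base) blast
    ultimately show "homog e m \<otimes> b \<in> (\<Union>m\<in>R. graded_piece m)" by blast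
  qed
qed

text \<open>For a derivation \<open>D\<close>, the logarithmic derivative \<open>m \<mapsto> D(t\<^sup>m) t\<^sup>-\<^sup>m\<close> is additive, hence determined by
its values on the unit vectors. So \<open>W\<^sub>n\<close> is spanned by the elements \<open>t\<^sup>m d\<^sub>i\<close>.\<close>

lemma witt_expand:
  "D = (\<Sum>i\<in>UNIV. witt_mult (der_apply D (tpow (axis i 1)) * tpow (- axis i 1)) (euler i))"
proof (rule witt_eq_tpowI)
  fix m
  note der = derivationD[OF derivation_der_apply]
  have tp: "tpow (k + l) = tpow k * tpow l" for k l :: "int ^ 'a" by (simp add: tpow_def mult_single)
  have tp0: "tpow 0 = (1 :: 'a laurent)" by (simp add: tpow_def)
  have inv: "tpow k * tpow (- k) = 1" for k :: "int ^ 'a" by (simp flip: tp add: tp0)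
  define \<delta> where "\<delta> k = der_apply D (tpow k) * tpow (- k)" for k
  have "\<delta> (k + l) = \<delta> k + \<delta> l" for k l
  proof -
    have "\<delta> (k + l) = (der_apply D (tpow k) * tpow l + tpow k * der_apply D (tpow l)) * (tpow (- k) * tpow (- l))"
      unfolding \<delta>_def tp der by (simp flip: tp add: add.commute)
    also have "\<dots> = \<delta> k * (tpow l * tpow (- l)) + \<delta> l * (tpow k * tpow (- k))"
      unfolding \<delta>_def by (simp add: algebra_simps)
    finally show ?thesis by (simp add: inv)
  qed
  then have \<delta>: "\<delta> m = (\<Sum>i\<in>UNIV. of_int (m $ i) * \<delta> (axis i 1))" by (rule additive_int_vec)
  have eul: "der_apply (euler i) (tpow m) = of_int (m $ i) * tpow m" for i
  proof -
    have "of_int (m $ i) * tpow m = Poly_Mapping.single 0 (of_int (m $ i)) * Poly_Mapping.single m 1"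
      by (simp only: single_of_int tpow_def)
    also have "\<dots> = Poly_Mapping.single m (of_int (m $ i))"
      by (simp only: mult_single add_0_left mult_1_right)
    finally have *: "of_int (m $ i) * tpow m = Poly_Mapping.single m (of_int (m $ i) :: complex)" .
    show ?thesis unfolding * by (simp add: euler.rep_eq tpow_def euler_fun_single)
  qed
  have "der_apply D (tpow m) = \<delta> m * tpow m"
  proof -
    have "der_apply D (tpow m) = der_apply D (tpow m) * (tpow m * tpow (- m))" by (simp only: inv mult_1_right)
    then show ?thesis by (simp only: \<delta>_def mult_ac)
  qed
  also have "\<dots> = (\<Sum>i\<in>UNIV. \<delta> (axis i 1) * der_apply (euler i) (tpow m))"
    unfolding \<delta> by (simp add: eul sum_distrib_left sum_distrib_right mult_ac)
  finally show "der_apply D (tpow m) = der_apply (\<Sum>i\<in>UNIV. witt_mult (der_apply D (tpow (axis i 1)) * tpow (- axis i 1)) (euler i)) (tpow m)"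
    by (simp add: der_apply_sum witt_mult.rep_eq \<delta>_def)
qed

lemma laurent_span: "f \<in> cspan (range (tpow :: int ^ 'n::finite \<Rightarrow> 'n laurent))"
proof (induction f rule: poly_mapping_add_induct)
  case (single k c)
  have "Poly_Mapping.single k c = c *\<^sub>C tpow k" by (simp add: tpow_def scaleC_single)
  then show ?case by (simp add: complex_vector.span_scale complex_vector.span_base)
qed (rule complex_vector.span_add)

lemma homog_span:
  assumes F: "cspan F = (UNIV :: 's::complex_vector set)"
  shows "cspan {homog e m | e m. e \<in> labels F} = (UNIV :: ('s, 'n::finite) ext_witt set)"
    (is "cspan ?G = _")
proof -
  have W: "Ext_Witt (witt_mult f (euler i)) 0 \<in> cspan ?G" for f :: "'n laurent" and i
  proof (rule clinear_cspan_into[OF _ _ _ laurent_span[of f]])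
    show "clinear (\<lambda>f. Ext_Witt (witt_mult f (euler i)) (0 :: 's \<otimes> 'n laurent))"
    proof (rule clinearI)
      show "Ext_Witt (witt_mult (x + y) (euler i)) (0 :: 's \<otimes> 'n laurent)
        = Ext_Witt (witt_mult x (euler i)) 0 + Ext_Witt (witt_mult y (euler i)) 0" for x y
      proof -
        have "witt_mult (x + y) (euler i) = witt_mult x (euler i) + witt_mult y (euler i)"
          by (rule witt_eqI) (simp add: witt_mult.rep_eq plus_witt.rep_eq distrib_right)
        then show ?thesis by (simp add: plus_ext_witt_def)
      qed
      show "Ext_Witt (witt_mult (c *\<^sub>C x) (euler i)) (0 :: 's \<otimes> 'n laurent)
        = c *\<^sub>C Ext_Witt (witt_mult x (euler i)) 0" for c x
      proof -
        have "witt_mult (c *\<^sub>C x) (euler i) = c *\<^sub>C witt_mult x (euler i)"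
          by (rule witt_eqI) (simp add: witt_mult.rep_eq scaleC_witt.rep_eq mult_scaleC_left)
        then show ?thesis by (simp add: scaleC_ext_witt_def)
      qed
    qed
    show "Ext_Witt (witt_mult f (euler i)) 0 \<in> cspan ?G" if f: "f \<in> range tpow" for f
    proof -
      obtain m where "f = tpow m" using f by blast
      then have "Ext_Witt (witt_mult f (euler i)) 0 \<in> ?G"
        unfolding labels_def using homog_euler[of i m, symmetric] by blast
      then show ?thesis by (rule complex_vector.span_base)
    qed
  qed simp
  have D: "Ext_Witt D 0 \<in> cspan ?G" for D :: "'n witt"
  proof -
    show ?thesis
      by (subst witt_expand, subst clinear_sum[OF clinear_Ext_Witt_witt]) (rule complex_vector.span_sum, rule W)
  qed
  have A: "Ext_Witt 0 a \<in> cspan ?G" for a :: "'s \<otimes> 'n laurent"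
  proof (induction a rule: tensor_induct)
    case (pure s f)
    have 1: "Ext_Witt 0 (s \<otimes> tpow m) \<in> cspan ?G" for m and s :: 's
    proof (rule clinear_cspan_into[of "\<lambda>s. Ext_Witt 0 (s \<otimes> tpow m)" F])
      show "clinear (\<lambda>s. Ext_Witt 0 (s \<otimes> tpow m))"
        by (rule clinearI)
           (simp_all add: tensor_add_left tensor_scale_left clinear_add[OF clinear_Ext_Witt_abelian]
             clinear_scale[OF clinear_Ext_Witt_abelian])
      fix s assume "s \<in> F"
      then have "Ext_Witt 0 (s \<otimes> tpow m) \<in> ?G"
        unfolding labels_def using homog_abelian[of s m, symmetric] by blast
      then show "Ext_Witt 0 (s \<otimes> tpow m) \<in> cspan ?G" by (rule complex_vector.span_base)
    qed (simp_all add: F)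
    show ?case
    proof (rule clinear_cspan_into[of "\<lambda>f. Ext_Witt 0 (s \<otimes> f)", OF _ _ _ laurent_span[of f]])
      show "clinear (\<lambda>f. Ext_Witt 0 (s \<otimes> f))"
        by (rule clinearI)
           (simp_all add: tensor_add_right tensor_scale_right clinear_add[OF clinear_Ext_Witt_abelian]
             clinear_scale[OF clinear_Ext_Witt_abelian])
    qed (use 1 in auto)
  next
    case (add s t)
    then show ?case by (simp add: clinear_add[OF clinear_Ext_Witt_abelian] complex_vector.span_add)
  qed
  have "X \<in> cspan ?G" for X
  proof -
    have "Ext_Witt (witt_part X) 0 + Ext_Witt 0 (abelian_part X) = X" by (simp add: plus_ext_witt_def)
    with complex_vector.span_add[OF D[of "witt_part X"] A[of "abelian_part X"]] show ?thesis by (simp only:)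
  qed
  then show ?thesis by blast
qed

lemma current_span:
  assumes F: "cspan F = (UNIV :: 's::complex_vector set)"
  shows "cspan {homog e m \<otimes> b | e m b. e \<in> labels F \<and> m \<in> UNIV} = (UNIV :: ('s, 'n::finite, 'b::comm_complex_algebra) current set)"
    (is "cspan ?G = _")
proof -
  have "t \<in> cspan ?G" for t
  proof (induction t rule: tensor_induct)
    case (pure x b)
    have "x \<in> cspan {homog e m | e m. e \<in> labels F}" unfolding homog_span[OF F] by (rule UNIV_I)
    then show ?case
    proof (rule clinear_cspan_into[OF clinear_tensor_left, rotated 2])
      fix x assume "x \<in> {homog e m :: ('s, 'n) ext_witt | e m. e \<in> labels F}"
      then have "x \<otimes> b \<in> ?G" by blast
      then show "x \<otimes> b \<in> cspan ?G" by (rule complex_vector.span_base)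
    qed simp
  qed (rule complex_vector.span_add)
  then show ?thesis by blast
qed

lemma lie_module_on_span_induct:
  assumes mod: "lie_module_on (cspan G) \<rho>" and W: "csubspace W"
    and G: "\<And>x. x \<in> G \<Longrightarrow> \<rho> x w \<in> W" and x: "x \<in> cspan G"
  shows "\<rho> x w \<in> W"
proof -
  have "x \<in> cspan G \<and> \<rho> x w \<in> W"
    using x
  proof (induction rule: complex_vector.span_induct_alt)
    case base
    have "\<rho> (0 *\<^sub>C 0) w = 0 *\<^sub>C \<rho> 0 w"
      using mod complex_vector.span_zero[of G] unfolding lie_module_on_def by blast
    then show ?case using complex_vector.subspace_0[OF W] complex_vector.span_zero[of G] by simp
  next
    case (step c x y)
    have xG: "x \<in> cspan G" "c *\<^sub>C x \<in> cspan G"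
      using complex_vector.span_base[OF step(1)] complex_vector.span_scale[OF complex_vector.span_base[OF step(1)]] by auto
    have "\<rho> (c *\<^sub>C x + y) w = c *\<^sub>C \<rho> x w + \<rho> y w"
      using mod xG step(2) unfolding lie_module_on_def by simp
    then show ?case
      using G[OF step(1)] step(2) xG W
      by (simp add: complex_vector.span_add complex_vector.subspace_add complex_vector.subspace_scale)
  qed
  then show ?thesis by blast
qed

lemma current_module_of_irreducible:
  fixes \<rho> :: "('s::complex_vector, 'n::finite, 'b::comm_complex_algebra) current \<Rightarrow> 'v::complex_vector \<Rightarrow> 'v"
  assumes irr: "irreducible_on P \<rho>"
    and P: "P = cspan {homog e m \<otimes> b | e m b. e \<in> E \<and> m \<in> K}"
    and K: "additive_subgroup K"
  shows "current_module E K (\<lambda>e. pairing (fst e)) (\<lambda>e m b. \<rho> (homog e m \<otimes> b))"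
proof -
  have mod: "lie_module_on P \<rho>" using irr by (simp add: irreducible_on_def)
  have K': "0 \<in> K" "\<And>k l. k \<in> K \<Longrightarrow> l \<in> K \<Longrightarrow> k - l \<in> K" using K by (auto simp: additive_subgroup_def)
  have Kadd: "k + l \<in> K" if "k \<in> K" "l \<in> K" for k l
    using K'(2)[OF that(1) K'(2)[OF K'(1) that(2)]] by simp
  have gen: "homog e m \<otimes> b \<in> P" if "e \<in> E" "m \<in> K" for e m b
    unfolding P using that by (intro complex_vector.span_base) blast
  have lin: "clinear (\<rho> x)" if "x \<in> P" for x using mod that by (simp add: lie_module_on_def)
  have add: "\<rho> (x + y) v = \<rho> x v + \<rho> y v" if "x \<in> P" "y \<in> P" for x y v
    using mod that by (simp add: lie_module_on_def)
  have scale: "\<rho> (c *\<^sub>C x) v = c *\<^sub>C \<rho> x v" if "x \<in> P" for x c v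
    using mod that by (simp add: lie_module_on_def)
  have br: "\<rho> (lie x y) v = \<rho> x (\<rho> y v) - \<rho> y (\<rho> x v)" if "x \<in> P" "y \<in> P" for x y v
    using mod that by (simp add: lie_module_on_def)
  have Psub: "csubspace P" by (simp add: P)
  show ?thesis
  proof (rule current_module.intro)
    show "clinear (\<rho> (homog e k \<otimes> b))" if "e \<in> E" "k \<in> K" for e k b
      by (rule lin[OF gen[OF that]])
    show "\<rho> (homog e k \<otimes> (b + c)) v = \<rho> (homog e k \<otimes> b) v + \<rho> (homog e k \<otimes> c) v"
      if "e \<in> E" "k \<in> K" for e k b c v
      by (simp add: tensor_add_right add gen that)
    show "\<rho> (homog e k \<otimes> (x *\<^sub>C b)) v = x *\<^sub>C \<rho> (homog e k \<otimes> b) v"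
      if "e \<in> E" "k \<in> K" for e k b x v
      by (simp add: tensor_scale_right scale gen that)
  next
    fix e e' k l and b c :: 'b and v
    assume e: "e \<in> E" "e' \<in> E" and k: "k \<in> K" "l \<in> K"
    have kl: "k + l \<in> K" by (rule Kadd[OF k])
    have "lie (homog e l \<otimes> c) (homog e' k \<otimes> b)
      = pairing (fst e) k *\<^sub>C (homog e' (k + l) \<otimes> (b * c)) + (- pairing (fst e') l) *\<^sub>C (homog e (k + l) \<otimes> (b * c))"
      by (simp add: lie_current lie_homog tensor_diff_left tensor_scale_left mult.commute)
    then have "\<rho> (lie (homog e l \<otimes> c) (homog e' k \<otimes> b)) v
      = pairing (fst e) k *\<^sub>C \<rho> (homog e' (k + l) \<otimes> (b * c)) v - pairing (fst e') l *\<^sub>C \<rho> (homog e (k + l) \<otimes> (b * c)) v"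
      by (simp only: add scale gen e kl complex_vector.subspace_scale[OF Psub]) simp
    then show "\<rho> (homog e l \<otimes> c) (\<rho> (homog e' k \<otimes> b) v) = \<rho> (homog e' k \<otimes> b) (\<rho> (homog e l \<otimes> c) v)
      + (pairing (fst e) k *\<^sub>C \<rho> (homog e' (k + l) \<otimes> (b * c)) v - pairing (fst e') l *\<^sub>C \<rho> (homog e (k + l) \<otimes> (b * c)) v)"
      using br[OF gen[OF e(1) k(2)] gen[OF e(2) k(1)], of c b v] by (simp add: algebra_simps)
  next
    fix W :: "'v set"
    assume W: "csubspace W" and st: "\<And>e k b w. e \<in> E \<Longrightarrow> k \<in> K \<Longrightarrow> w \<in> W \<Longrightarrow> \<rho> (homog e k \<otimes> b) w \<in> W"
    have "\<rho> x w \<in> W" if "x \<in> P" "w \<in> W" for x w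
      by (rule lie_module_on_span_induct[OF mod[unfolded P] W _ that(1)[unfolded P]]) (use st that(2) in blast)
    then show "W = {0} \<or> W = UNIV" using irr W unfolding irreducible_on_def by (metis image_subsetI)
  qed (use K' pairing_add in auto)
qed

section \<open>Highest weight modules\<close>

text \<open>\<open>lv\<close> is the coefficient of \<open>\<beta>\<close>. Being additive, it is the pairing with a vector \<open>u\<close>, so that \<open>D(u, 0)\<close> is the
derivation that measures the level: it is \<open>d\<^sub>\<beta>\<close> in coordinates adapted to \<open>K\<close> and \<open>\<beta>\<close>.\<close>

lemma level_function:
  assumes K: "additive_subgroup K"
    and dec: "\<forall>m :: int ^ 'n::finite. \<exists>!p. fst p \<in> K \<and> m = fst p + snd p *s \<beta>"
  obtains lv :: "int ^ 'n \<Rightarrow> int" and u :: "complex ^ 'n"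
  where "\<And>k l. lv (k + l) = lv k + lv l" "\<And>m. lv m = 0 \<longleftrightarrow> m \<in> K" "lv \<beta> = 1"
    "\<And>m. m - lv m *s \<beta> \<in> K" "\<And>m. pairing u m = of_int (lv m)"
proof -
  have K': "0 \<in> K" "\<And>k l. k \<in> K \<Longrightarrow> l \<in> K \<Longrightarrow> k - l \<in> K" using K by (auto simp: additive_subgroup_def)
  have Kadd: "k + l \<in> K" if "k \<in> K" "l \<in> K" for k l
    using K'(2)[OF that(1) K'(2)[OF K'(1) that(2)]] by simp
  have "\<exists>d. m - d *s \<beta> \<in> K" for m
  proof -
    obtain p where "fst p \<in> K" "m = fst p + snd p *s \<beta>" using dec by metis
    then have "m - snd p *s \<beta> \<in> K" by simp
    then show ?thesis by blast
  qed
  then obtain lv where lv: "\<And>m. m - lv m *s \<beta> \<in> K" by metis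
  have uniq: "lv m = d" if "m - d *s \<beta> \<in> K" for m d
  proof -
    have "(m - d *s \<beta>, d) = (m - lv m *s \<beta>, lv m)"
      by (rule ex1E[OF spec[OF dec, of m]]) (use that lv[of m] in auto)
    then show ?thesis by simp
  qed
  have add: "lv (k + l) = lv k + lv l" for k l
  proof (rule uniq)
    have "k + l - (lv k + lv l) *s \<beta> = (k - lv k *s \<beta>) + (l - lv l *s \<beta>)"
      by (simp add: vec_eq_iff algebra_simps)
    then show "k + l - (lv k + lv l) *s \<beta> \<in> K" using Kadd[OF lv[of k] lv[of l]] by (simp only:)
  qed
  have zero: "lv m = 0 \<longleftrightarrow> m \<in> K" for m
    using lv[of m] uniq[of m 0] by (auto simp: vec_eq_iff[symmetric])
  have beta: "lv \<beta> = 1" by (rule uniq) (simp add: K')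
  define u :: "complex ^ 'n" where "u = (\<chi> i. of_int (lv (axis i 1)))"
  have "pairing u m = of_int (lv m)" for m
    by (subst additive_int_vec[OF add]) (simp add: pairing_def u_def mult.commute)
  then show ?thesis using that add zero beta lv by blast
qed

lemma lie_module_on_sum:
  assumes mod: "lie_module_on P \<rho>" and P: "csubspace P" and x: "\<And>i. i \<in> A \<Longrightarrow> x i \<in> P" and A: "finite A"
  shows "\<rho> (\<Sum>i\<in>A. c i *\<^sub>C x i) v = (\<Sum>i\<in>A. c i *\<^sub>C \<rho> (x i) v)"
proof -
  have scale: "\<rho> (c *\<^sub>C x) v = c *\<^sub>C \<rho> x v" if "x \<in> P" for x c using mod that by (simp add: lie_module_on_def)
  have zero: "\<rho> 0 v = 0" using scale[of 0 0] complex_vector.subspace_0[OF P] by simp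
  have add: "\<rho> (x + y) v = \<rho> x v + \<rho> y v" if "x \<in> P" "y \<in> P" for x y
    using mod that by (simp add: lie_module_on_def)
  show ?thesis
    using A x
  proof (induction A)
    case (insert i A)
    have "c i *\<^sub>C x i \<in> P" "(\<Sum>i\<in>A. c i *\<^sub>C x i) \<in> P"
      using insert.prems by (auto intro!: complex_vector.subspace_sum complex_vector.subspace_scale P)
    then show ?case using insert by (simp add: add scale)
  qed (simp add: zero)
qed

lemma homog_in_graded_sum:
  fixes e :: "(complex ^ 'n::finite) \<times> 's::complex_vector" and b :: "'b::comm_complex_algebra"
  assumes "m \<in> R"
  shows "homog e m \<otimes> b \<in> graded_sum R"
proof -
  have piece: "graded_piece m \<subseteq> (graded_sum R :: ('s, 'n, 'b) current set)"
  proof -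
    have "graded_piece m \<subseteq> (\<Union>r\<in>R. graded_piece r :: ('s, 'n, 'b) current set)" using assms by auto
    then show ?thesis
      unfolding graded_sum_def by (rule order_trans[OF _ complex_vector.span_superset])
  qed
  have "homog (axis i 1, 0) m \<otimes> b \<in> graded_piece m" for i :: 'n
    unfolding homog_euler graded_piece_def by (intro complex_vector.span_base) blast
  then have s1: "(\<Sum>i\<in>UNIV. fst e $ i *\<^sub>C (homog (axis i 1, 0) m \<otimes> b)) \<in> graded_piece m"
    unfolding graded_piece_def by (intro complex_vector.span_sum complex_vector.span_scale)
  have s2: "homog (0, snd e) m \<otimes> b \<in> graded_piece m"
    unfolding homog_abelian graded_piece_def by (intro complex_vector.span_base) blast
  have eq: "homog e m \<otimes> b = (\<Sum>i\<in>UNIV. fst e $ i *\<^sub>C (homog (axis i 1, 0) m \<otimes> b)) + homog (0, snd e) m \<otimes> b"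
  proof -
    have "homog e m = homog (fst e, 0) m + homog (0, snd e) m"
      by (simp add: homog_def plus_ext_witt_def tensor_zero_left)
    moreover have "homog (fst e, 0 :: 's) m \<otimes> b = (\<Sum>i\<in>UNIV. fst e $ i *\<^sub>C (homog (axis i 1, 0) m \<otimes> b))"
      by (subst homog_expand) (simp only: clinear_sum[OF clinear_tensor_left] tensor_scale_left)
    ultimately show ?thesis by (simp only: tensor_add_left)
  qed
  have sub: "csubspace (graded_piece m :: ('s, 'n, 'b) current set)" by (simp add: graded_piece_def)
  from complex_vector.subspace_add[OF sub s1 s2] have "homog e m \<otimes> b \<in> graded_piece m"
    by (simp only: eq)
  then show ?thesis by (rule subsetD[OF piece])
qed

lemma graded_sum_eq_span_superset:
  fixes E :: "((complex ^ 'n::finite) \<times> 's::complex_vector) set"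
  assumes "cspan F = (UNIV :: 's set)" "labels F \<subseteq> E"
  shows "(graded_sum R :: ('s, 'n, 'b::comm_complex_algebra) current set)
    = cspan {homog e m \<otimes> b | e m b. e \<in> E \<and> m \<in> R}" (is "_ = cspan ?G")
proof
  show "graded_sum R \<subseteq> cspan ?G"
    unfolding graded_sum_eq_span[OF assms(1)] by (rule complex_vector.span_mono) (use assms(2) in blast)
  have "csubspace (graded_sum R :: ('s, 'n, 'b) current set)" by (simp add: graded_sum_def)
  then show "cspan ?G \<subseteq> graded_sum R"
    by (intro complex_vector.span_minimal) (auto intro: homog_in_graded_sum)
qed

text \<open>The map \<open>z \<mapsto> 1 \<otimes> z\<close> identifies the module \<open>Z\<close> with the top component of the quotient. Its kernel is a
submodule of \<open>Z\<close>; it is not all of \<open>Z\<close>, because then the induced module, being generated by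
\<open>1 \<otimes> Z\<close>, would have quotient \<open>0\<close>.\<close>

lemma top_of_quotient_of_induced:
  fixes \<sigma> :: "'g::lie_algebra \<Rightarrow> 'z::complex_vector \<Rightarrow> 'z" and \<rho> :: "'g \<Rightarrow> 'v::complex_vector \<Rightarrow> 'v"
  assumes \<sigma>: "irreducible_on P0 \<sigma>" and \<rho>: "irreducible_on UNIV \<rho>"
    and ind: "quotient_of_induced P (extend_by_zero P0 P1 \<sigma>) \<rho>"
    and P: "P0 \<subseteq> P" "P1 \<subseteq> P" "csubspace P0" "csubspace P1" "P0 \<inter> P1 \<subseteq> {0}"
  obtains \<iota> where "clinear \<iota>" "inj \<iota>" "\<And>x z. x \<in> P0 \<Longrightarrow> \<rho> x (\<iota> z) = \<iota> (\<sigma> x z)"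
    "\<And>x z. x \<in> P1 \<Longrightarrow> \<rho> x (\<iota> z) = 0"
proof -
  obtain \<phi> where \<phi>: "clinear \<phi>" "surj \<phi>" "\<forall>t\<in>induced_rels P (extend_by_zero P0 P1 \<sigma>). \<phi> t = 0"
      "\<And>x t. \<phi> (induced_action x t) = \<rho> x (\<phi> t)"
    using ind unfolding quotient_of_induced_def by metis
  define \<iota> where "\<iota> z = \<phi> (1 \<otimes> z)" for z
  have lin: "clinear \<iota>"
    unfolding \<iota>_def
    by (rule clinearI) (simp_all add: tensor_add_right tensor_scale_right clinear_add[OF \<phi>(1)] clinear_scale[OF \<phi>(1)])
  have act: "\<rho> x (\<iota> z) = \<iota> (extend_by_zero P0 P1 \<sigma> x z)" if "x \<in> P" for x z
  proof -
    have "(1 * uea_gen x) \<otimes> z - 1 \<otimes> extend_by_zero P0 P1 \<sigma> x z \<in> induced_rels P (extend_by_zero P0 P1 \<sigma>)"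
      unfolding induced_rels_def using that by (intro complex_vector.span_base) blast
    then have "\<phi> ((1 * uea_gen x) \<otimes> z - 1 \<otimes> extend_by_zero P0 P1 \<sigma> x z) = 0" using \<phi>(3) by blast
    then have "\<phi> (uea_gen x \<otimes> z) = \<iota> (extend_by_zero P0 P1 \<sigma> x z)"
      by (simp add: clinear_diff[OF \<phi>(1)] \<iota>_def)
    moreover have "\<rho> x (\<iota> z) = \<phi> (uea_gen x \<otimes> z)"
      unfolding \<iota>_def \<phi>(4)[symmetric] by (simp add: induced_action_tensor)
    ultimately show ?thesis by simp
  qed
  have ext0: "extend_by_zero P0 P1 \<sigma> x = \<sigma> x" if x: "x \<in> P0" for x
  proof -
    have "(THE y. y \<in> P0 \<and> x - y \<in> P1) = x"
    proof (rule the_equality)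
      show "x \<in> P0 \<and> x - x \<in> P1" using x complex_vector.subspace_0[OF P(4)] by simp
      fix y assume y: "y \<in> P0 \<and> x - y \<in> P1"
      then have "x - y \<in> P0" using x complex_vector.subspace_diff[OF P(3)] by simp
      then have "x - y = 0" using y P(5) by auto
      then show "y = x" by simp
    qed
    then show ?thesis by (simp add: extend_by_zero_def)
  qed
  have ext1: "extend_by_zero P0 P1 \<sigma> x = \<sigma> 0" if x: "x \<in> P1" for x
  proof -
    have "(THE y. y \<in> P0 \<and> x - y \<in> P1) = 0"
    proof (rule the_equality)
      show "0 \<in> P0 \<and> x - 0 \<in> P1" using x complex_vector.subspace_0[OF P(3)] by simp
      fix y assume y: "y \<in> P0 \<and> x - y \<in> P1"
      then have "x - (x - y) \<in> P1" using x complex_vector.subspace_diff[OF P(4)] by blast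
      then show "y = 0" using y P(5) by auto
    qed
    then show ?thesis by (simp add: extend_by_zero_def)
  qed
  have mod: "lie_module_on P0 \<sigma>" using \<sigma> by (simp add: irreducible_on_def)
  have \<sigma>0: "\<sigma> 0 z = 0" for z
  proof -
    have "\<sigma> (0 *\<^sub>C 0) z = 0 *\<^sub>C \<sigma> 0 z"
      using mod complex_vector.subspace_0[OF P(3)] unfolding lie_module_on_def by metis
    then show ?thesis by simp
  qed
  have P0: "\<rho> x (\<iota> z) = \<iota> (\<sigma> x z)" if "x \<in> P0" for x z using act[of x z] P(1) that by (auto simp: ext0)
  have P1: "\<rho> x (\<iota> z) = 0" if "x \<in> P1" for x z
    using act[of x z] P(2) that by (auto simp: ext1 \<sigma>0 clinear_0[OF lin])
  have \<rho>_lin: "clinear (\<rho> x)" for x using \<rho> by (simp add: irreducible_on_def lie_module_on_def)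
  have "\<not> (\<forall>z. \<iota> z = 0)"
  proof
    assume z0: "\<forall>z. \<iota> z = 0"
    \<comment> \<open>The enveloping algebra is spanned by words, on which \<open>\<phi>\<close> is computed letter by letter.\<close>
    have "\<phi> (u \<otimes> z) = 0" for u z
    proof (induction u rule: uea.abs_induct)
      case (1 p)
      show ?case
      proof (induction p rule: poly_mapping_add_induct)
        case (single ws c)
        show ?case
        proof (induction ws)
          case Nil
          have "abs_uea (Poly_Mapping.single [] c) = c *\<^sub>C (1 :: 'g uea)"
          proof -
            have "Poly_Mapping.single [] c = c *\<^sub>C (1 :: 'g list \<Rightarrow>\<^sub>0 complex)"
              by (simp add: scaleC_single flip: single_one) (simp add: zero_list_def)
            then show ?thesis by (simp add: scaleC_uea.abs_eq one_uea_def)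
          qed
          then show ?case using z0 by (simp add: tensor_scale_left clinear_scale[OF \<phi>(1)] \<iota>_def)
        next
          case (Cons x ws)
          have "abs_uea (Poly_Mapping.single (x # ws) c) = uea_gen x * abs_uea (Poly_Mapping.single ws c)"
            by (simp add: uea_gen.abs_eq times_uea.abs_eq letter_def mult_single plus_list_def)
          then have "\<phi> (abs_uea (Poly_Mapping.single (x # ws) c) \<otimes> z)
              = \<rho> x (\<phi> (abs_uea (Poly_Mapping.single ws c) \<otimes> z))"
            using \<phi>(4)[of x "abs_uea (Poly_Mapping.single ws c) \<otimes> z"] by (simp add: induced_action_tensor)
          then show ?case using Cons by (simp add: clinear_0[OF \<rho>_lin])
        qed
      next
        case (add p q)
        have "abs_uea (p + q) = abs_uea p + abs_uea q" by (simp add: plus_uea.abs_eq)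
        then show ?case using add by (simp add: tensor_add_left clinear_add[OF \<phi>(1)])
      qed
    qed
    then have "\<phi> t = 0" for t
      by (induction t rule: tensor_induct) (simp_all add: clinear_add[OF \<phi>(1)])
    then have "v = 0" for v :: 'v using \<phi>(2) by (metis surjD)
    then show False using \<rho> unfolding irreducible_on_def by blast
  qed
  moreover have "{z. \<iota> z = 0} = {0} \<or> {z. \<iota> z = 0} = UNIV"
  proof -
    have "csubspace {z. \<iota> z = 0}"
      by (rule complex_vector.subspaceI) (simp_all add: clinear_0[OF lin] clinear_add[OF lin] clinear_scale[OF lin])
    moreover have "\<sigma> x ` {z. \<iota> z = 0} \<subseteq> {z. \<iota> z = 0}" if "x \<in> P0" for x
      using P0[OF that, symmetric] by (auto simp: clinear_0[OF \<rho>_lin])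
    ultimately show ?thesis using \<sigma> unfolding irreducible_on_def by blast
  qed
  ultimately have ker: "{z. \<iota> z = 0} = {0}" by auto
  have "inj \<iota>"
  proof (rule injI)
    fix x y assume "\<iota> x = \<iota> y"
    then have "x - y \<in> {z. \<iota> z = 0}" by (simp add: clinear_diff[OF lin])
    then have "x - y \<in> {0}" by (simp only: ker)
    then show "x = y" by simp
  qed
  from that[OF lin this P0 P1] show ?thesis .
qed

lemma witt_mult_tpow_zero: "witt_mult (tpow 0) D = D"
  by (rule witt_eqI) (simp add: witt_mult.rep_eq tpow_def)

lemma weight_space_homog:
  "weight_space \<rho> \<mu> = {v. \<forall>i. \<rho> (homog (axis i 1, 0) 0 \<otimes> 1) v = \<mu> $ i *\<^sub>C v}"
  by (simp add: weight_space_def homog_euler witt_mult_tpow_zero)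

text \<open>The bracket with \<open>D(u, 0)\<close> is zero on the part of level \<open>0\<close> and has positive eigenvalues on the positive
part.\<close>

lemma degree_zero_positive_part_disjoint:
  fixes K :: "(int ^ 'n::finite) set"
  assumes F: "cspan F = (UNIV :: 's::complex_vector set)"
    and lv: "\<And>k l. lv (k + l) = lv k + lv l" "\<And>m. lv m = 0 \<longleftrightarrow> m \<in> K" "lv \<beta> = 1"
    and u: "\<And>m. pairing u m = of_int (lv m)"
  shows "graded_sum K \<inter> positive_part K \<beta> \<subseteq> {0 :: ('s, 'n, 'b::comm_complex_algebra) current}"
proof -
  define h :: "('s, 'n, 'b) current" where "h = homog (u, 0) 0 \<otimes> 1"
  have lin: "clinear (lie h)" by (rule clinearI) (simp_all add: lie_add_right lie_scale_right)
  have eig: "lie h (homog e m \<otimes> b) = of_int (lv m) *\<^sub>C (homog e m \<otimes> b)" for e m b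
    by (simp add: h_def lie_current lie_homog u tensor_scale_left)
  have lv_scale: "lv (int d *s \<beta>) = int d" for d
  proof (induction d)
    case 0
    have "lv 0 = 0" using lv(1)[of 0 0] by simp
    then show ?case by simp
  next
    case (Suc d)
    have "int (Suc d) *s \<beta> = int d *s \<beta> + \<beta>" by (simp add: vec_eq_iff algebra_simps)
    then show ?case using Suc by (simp only: lv(1,3))
  qed
  have K0: "lie h x = 0 *\<^sub>C x" if "x \<in> graded_sum K" for x
  proof -
    have "lie h x = 0"
      by (rule clinear_zero_on_cspan[OF lin _ that[unfolded graded_sum_eq_span[OF F]]]) (use eig lv(2) in auto)
    then show ?thesis by simp
  qed
  let ?A = "{of_int d :: complex | d. d \<ge> 1}"
  have pos: "positive_part K \<beta> \<subseteq> cspan {x. \<exists>a\<in>?A. lie h x = a *\<^sub>C x}"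
    unfolding positive_part_def graded_sum_eq_span[OF F]
  proof (rule complex_vector.span_mono, safe)
    fix e r and d :: nat and b :: 'b assume r: "r \<in> K" and d: "d \<ge> 1"
    have "lv (r + int d *s \<beta>) = int d" using r lv(1,2) lv_scale by simp
    then have "lie h (homog e (r + int d *s \<beta>) \<otimes> b) = of_int (int d) *\<^sub>C (homog e (r + int d *s \<beta>) \<otimes> b)"
      by (simp only: eig)
    moreover have "(of_int (int d) :: complex) \<in> ?A" using d by (intro CollectI exI[of _ "int d"]) auto
    ultimately show "\<exists>a\<in>?A. lie h (homog e (r + int d *s \<beta>) \<otimes> b) = a *\<^sub>C (homog e (r + int d *s \<beta>) \<otimes> b)"
      by blast
  qed
  show ?thesis
  proof
    fix x :: "('s, 'n, 'b) current" assume x: "x \<in> graded_sum K \<inter> positive_part K \<beta>"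
    then have "x \<in> cspan {x. \<exists>a\<in>?A. lie h x = a *\<^sub>C x}" using pos by auto
    then have "x = 0"
      by (rule eigenvectors_sum_distinct[OF lin _ K0]) (use x in auto)
    then show "x \<in> {0}" by simp
  qed
qed

theorem theorem4p9:
  fixes K :: "(int ^ 'n::finite) set" and \<beta> :: "int ^ 'n"
    and \<sigma> :: "('s::lie_algebra, 'n, 'b::comm_complex_algebra) current \<Rightarrow> 'z::complex_vector \<Rightarrow> 'z"
    and \<rho> :: "('s, 'n, 'b) current \<Rightarrow> 'v::complex_vector \<Rightarrow> 'v"
  assumes "CARD('n) \<ge> 2"
    and "finite_dim (UNIV :: 's set)" and "\<forall>x y :: 's. lie x y = 0"
    and "finitely_generated_algebra TYPE('b)"
    and "additive_subgroup K"
    and "\<forall>m. \<exists>!p. fst p \<in> K \<and> m = fst p + snd p *s \<beta>"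
    and "irreducible_on (graded_sum K) \<sigma>" and "weight_module \<sigma>"
    and "irreducible_highest_weight_module K \<beta> \<sigma> \<rho>"
    and "\<forall>\<mu>. finite_dim (weight_space \<rho> \<mu>)"
  shows "single_point_evaluation \<rho>"
proof -
  note \<sigma> = assms(7)
  have \<rho>: "irreducible_on UNIV \<rho>"
    and ind: "quotient_of_induced (parabolic K \<beta>) (extend_by_zero (graded_sum K) (positive_part K \<beta>) \<sigma>) \<rho>"
    using assms(9) by (simp_all add: irreducible_highest_weight_module_def)
  have K: "0 \<in> K" "\<And>k l. k \<in> K \<Longrightarrow> l \<in> K \<Longrightarrow> k - l \<in> K" using assms(5) by (auto simp: additive_subgroup_def)
  obtain F :: "'s set" where F: "finite F" "cspan F = UNIV"
    using assms(2) unfolding finite_dim_def by blast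
  obtain lv u where lv: "\<And>k l. lv (k + l) = lv k + lv l" "\<And>m. lv m = 0 \<longleftrightarrow> m \<in> K" "lv \<beta> = 1"
      "\<And>m. m - lv m *s \<beta> \<in> K" and u: "\<And>m. pairing u m = of_int (lv m)"
    using level_function[OF assms(5,6)] by metis
  \<comment> \<open>The label of \<open>D(u, 0)\<close> is adjoined because this element measures levels, and its multiples of level \<open>-1\<close> are used below to descend from the top.\<close>
  define E where "E = insert (u, 0 :: 's) (labels F)"
  have finE: "finite E" by (simp add: E_def finite_labels F(1))
  have uE: "(u, 0) \<in> E" and axisE: "(axis i 1, 0) \<in> E" for i by (auto simp: E_def labels_def)
  have sumE: "graded_sum R = cspan {homog e m \<otimes> (b :: 'b) | e m b. e \<in> E \<and> m \<in> R}" for R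
    by (rule graded_sum_eq_span_superset[OF F(2)]) (auto simp: E_def)
  have UNIV_E: "(UNIV :: ('s, 'n, 'b) current set) = cspan {homog e m \<otimes> b | e m b. e \<in> E \<and> m \<in> UNIV}"
  proof -
    have "graded_sum UNIV = (UNIV :: ('s, 'n, 'b) current set)"
      unfolding graded_sum_eq_span[OF F(2)] by (rule current_span[OF F(2)])
    then show ?thesis by (simp only: sumE)
  qed
  let ?q = "\<lambda>e :: (complex ^ 'n) \<times> 's. pairing (fst e)"
  let ?a = "\<lambda>e m b. \<sigma> (homog e m \<otimes> b)" and ?R = "\<lambda>e m b. \<rho> (homog e m \<otimes> b)"
  interpret Z: current_module E K ?q ?a
    by (rule current_module_of_irreducible[OF \<sigma> sumE assms(5)])
  interpret V: current_module E UNIV ?q ?R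
    by (rule current_module_of_irreducible[OF \<rho> UNIV_E]) (simp add: additive_subgroup_def)
  have modZ: "lie_module_on (graded_sum K) \<sigma>" using \<sigma> by (simp add: irreducible_on_def)
  have modV: "lie_module_on UNIV \<rho>" using \<rho> by (simp add: irreducible_on_def)
  have \<rho>_add: "\<rho> (x + y) v = \<rho> x v + \<rho> y v" and \<rho>_scale: "\<rho> (c *\<^sub>C x) v = c *\<^sub>C \<rho> x v" for x y c v
    using modV by (simp_all add: lie_module_on_def)
  have gs: "csubspace (graded_sum R :: ('s, 'n, 'b) current set)" for R by (simp add: graded_sum_def)
  obtain \<iota> where \<iota>: "clinear \<iota>" "inj \<iota>" "\<And>x z. x \<in> graded_sum K \<Longrightarrow> \<rho> x (\<iota> z) = \<iota> (\<sigma> x z)"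
    "\<And>x z. x \<in> positive_part K \<beta> \<Longrightarrow> \<rho> x (\<iota> z) = 0"
  proof (rule top_of_quotient_of_induced[OF \<sigma> \<rho> ind])
    show "graded_sum K \<subseteq> (parabolic K \<beta> :: ('s, 'n, 'b) current set)"
      "positive_part K \<beta> \<subseteq> (parabolic K \<beta> :: ('s, 'n, 'b) current set)"
      unfolding parabolic_def using complex_vector.span_superset[of "graded_sum K \<union> positive_part K \<beta> :: ('s, 'n, 'b) current set"]
      by auto
    show "graded_sum K \<inter> positive_part K \<beta> \<subseteq> {0 :: ('s, 'n, 'b) current}"
      by (rule degree_zero_positive_part_disjoint[OF F(2) lv(1-3) u])
    show "csubspace (positive_part K \<beta> :: ('s, 'n, 'b) current set)"
      by (simp add: positive_part_def gs)
  qed (simp_all add: gs)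
  have top_K: "?R e m b (\<iota> z) = \<iota> (?a e m b z)" if "m \<in> K" for e m b z
    by (rule \<iota>(3)) (rule homog_in_graded_sum[OF that])
  have top_pos: "?R e m b (\<iota> z) = 0" if "lv m > 0" for e m b z
  proof (rule \<iota>(4), unfold positive_part_def, rule homog_in_graded_sum, intro CollectI exI conjI)
    show "m = (m - lv m *s \<beta>) + int (nat (lv m)) *s \<beta>" using that by simp
    show "m - lv m *s \<beta> \<in> K" by (rule lv)
    show "1 \<le> nat (lv m)" using that by simp
  qed
  obtain z1 :: 'z and \<mu> where z1: "z1 \<in> weight_space \<sigma> \<mu>" "z1 \<noteq> 0"
  proof -
    obtain z :: 'z where z: "z \<noteq> 0" using \<sigma> unfolding irreducible_on_def by blast
    have "\<exists>\<mu>. \<exists>z1\<in>weight_space \<sigma> \<mu>. z1 \<noteq> 0"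
    proof (rule ccontr)
      assume "\<not> ?thesis"
      then have "(\<Union>\<mu>. weight_space \<sigma> \<mu>) \<subseteq> {0}" by blast
      then have "cspan (\<Union>\<mu>. weight_space \<sigma> \<mu>) \<subseteq> {0}"
        by (rule complex_vector.span_minimal) simp
      then show False using assms(8) z unfolding weight_module_def by auto
    qed
    then show ?thesis using that by blast
  qed
  have hu: "homog (u, 0) 0 \<otimes> (1 :: 'b) = (\<Sum>i\<in>UNIV. u $ i *\<^sub>C (homog (axis i 1, 0 :: 's) 0 \<otimes> 1))"
    by (subst homog_expand) (simp only: clinear_sum[OF clinear_tensor_left] tensor_scale_left)
  define \<alpha> where "\<alpha> = (\<Sum>i\<in>UNIV. u $ i * \<mu> $ i)"
  \<comment> \<open>\<open>D(u, 0)\<close> commutes with everything of level \<open>0\<close>, hence acts on \<open>Z\<close> by a scalar.\<close>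
  have Hz: "?a (u, 0) 0 1 z = \<alpha> *\<^sub>C z" for z
  proof -
    have "?a (u, 0) 0 1 z1 = (\<Sum>i\<in>UNIV. u $ i *\<^sub>C \<sigma> (homog (axis i 1, 0) 0 \<otimes> 1) z1)"
      unfolding hu by (rule lie_module_on_sum[OF modZ gs homog_in_graded_sum[OF K(1)]]) simp
    also have "\<dots> = \<alpha> *\<^sub>C z1"
      using z1(1) by (simp add: weight_space_homog \<alpha>_def complex_vector.scale_sum_left)
    finally have z1_eig: "?a (u, 0) 0 1 z1 = \<alpha> *\<^sub>C z1" .
    let ?W = "{z \<in> UNIV. ?a (u, 0) 0 1 z = \<alpha> *\<^sub>C z}"
    have "?W = {0} \<or> ?W = UNIV"
    proof (rule Z.irreducible)
      show "csubspace ?W" by (rule csubspace_eigenspace[OF Z.a_clinear[OF uE K(1)]]) simp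
      fix e k b w assume e: "e \<in> E" and k: "k \<in> K" and w: "w \<in> ?W"
      have "pairing u k = 0" using k lv(2) u by simp
      then have "?a (u, 0) 0 1 (?a e k b w) = ?a e k b (?a (u, 0) 0 1 w)"
        using Z.bracket[OF uE e k K(1), of 1 b w] by simp
      then show "?a e k b w \<in> ?W" using w by (simp add: clinear_scale[OF Z.a_clinear[OF e k]])
    qed
    then show ?thesis using z1_eig z1(2) by blast
  qed
  define P where "P r = weight_space \<sigma> (\<mu> - (\<chi> i. of_int (r $ i)))" for r :: "int ^ 'n"
  have P_iff: "v \<in> P r \<longleftrightarrow> (\<forall>i. ?a (axis i 1, 0) 0 1 v = (\<mu> $ i - of_int (r $ i)) *\<^sub>C v)" for v r
    by (simp add: P_def weight_space_homog)
  have P_shift: "?a e l c v \<in> P (r - l)" if "e \<in> E" "l \<in> K" "v \<in> P r" for e l r c v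
    unfolding P_iff
  proof
    fix i
    have "?a (axis i 1, 0) 0 1 (?a e l c v) = ?a e l c (?a (axis i 1, 0) 0 1 v) + of_int (l $ i) *\<^sub>C ?a e l c v"
      using Z.bracket[OF axisE that(1,2) K(1), of i 1 c v] by (simp add: pairing_axis)
    also have "\<dots> = (\<mu> $ i - of_int ((r - l) $ i)) *\<^sub>C ?a e l c v"
      using that(3) unfolding P_iff
      by (simp add: clinear_scale[OF Z.a_clinear[OF that(1,2)]] scaleC_add_left[symmetric])
    finally show "?a (axis i 1, 0) 0 1 (?a e l c v) = (\<mu> $ i - of_int ((r - l) $ i)) *\<^sub>C ?a e l c v" .
  qed
  have P_span: "cspan (\<Union>r\<in>K. P r) = UNIV"
  proof -
    have "cspan (\<Union>r\<in>K. P r) = {0} \<or> cspan (\<Union>r\<in>K. P r) = UNIV"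
    proof (rule Z.irreducible)
      fix e k b w assume e: "e \<in> E" and k: "k \<in> K" and w: "w \<in> cspan (\<Union>r\<in>K. P r)"
      show "?a e k b w \<in> cspan (\<Union>r\<in>K. P r)"
      proof (rule clinear_cspan_into[OF Z.a_clinear[OF e k] _ _ w])
        fix x assume "x \<in> (\<Union>r\<in>K. P r)"
        then obtain r where "r \<in> K" "x \<in> P r" by blast
        then have "?a e k b x \<in> (\<Union>r\<in>K. P r)" using P_shift[OF e k] K(2)[OF _ k] by blast
        then show "?a e k b x \<in> cspan (\<Union>r\<in>K. P r)" by (rule complex_vector.span_base)
      qed simp
    qed simp
    moreover have "z1 \<in> cspan (\<Union>r\<in>K. P r)"
    proof -
      have "z1 \<in> P 0" using z1(1) unfolding P_iff by (simp add: weight_space_homog)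
      then have "z1 \<in> (\<Union>r\<in>K. P r)" using K(1) by blast
      then show ?thesis by (rule complex_vector.span_base)
    qed
    ultimately show ?thesis using z1(2) by auto
  qed
  have "\<exists>k\<in>K. k \<noteq> 0"
  proof -
    obtain i j :: 'n where ij: "i \<noteq> j"
      using assms(1) card_le_Suc0_iff_eq[of "UNIV :: 'n set"] by fastforce
    show ?thesis
    proof (rule ccontr)
      assume "\<not> ?thesis"
      then have *: "m = lv m *s \<beta>" for m using lv(4)[of m] by auto
      have "lv (axis i 1) * \<beta> $ i = 1" "lv (axis i 1) * \<beta> $ j = 0" "lv (axis j 1) * \<beta> $ j = 1"
        using arg_cong[OF *[of "axis i 1"], of "\<lambda>v. v $ i"] arg_cong[OF *[of "axis i 1"], of "\<lambda>v. v $ j"]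
          arg_cong[OF *[of "axis j 1"], of "\<lambda>v. v $ j"] ij
        by (simp_all add: axis_def)
      then show False by auto
    qed
  qed
  moreover have "\<exists>e\<in>E. ?q e l \<noteq> 0" if l: "l \<noteq> 0" for l
  proof -
    obtain i where "l $ i \<noteq> 0" using l by (auto simp: vec_eq_iff)
    then show ?thesis using axisE[of i] by (intro bexI[of _ "(axis i 1, 0)"]) (simp_all add: pairing_axis)
  qed
  ultimately interpret Z: covered_module E K ?q ?a P
    by (intro covered_module.intro Z.current_module_axioms covered_module_axioms.intro P_shift P_span) auto
  \<comment> \<open>With \<open>x = (t\<^sup>r\<^sup>-\<^sup>\<beta> u \<otimes> b) v\<close>, the vectors \<open>(t\<^sup>\<beta>\<^sup>+\<^sup>k e \<otimes> c) x\<close> of the top component are, up to multiples of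
    the function for \<open>u\<close>, the values of the function in the cover attached to \<open>t\<^sup>r e \<otimes> b\<close> and \<open>v\<close>. All these \<open>x\<close> lie
    in one weight space of \<open>\<rho>\<close>, of weight \<open>\<mu> - \<beta>\<close>. So the cover is contained in a sum of linear images \<open>\<Theta> e\<close> of a
    finite dimensional space.\<close>
  have fd: "finite_dim Z.cover"
  proof -
    obtain \<kappa> where \<kappa>: "clinear \<kappa>" "\<And>z. \<kappa> (\<iota> z) = z"
    proof -
      interpret vector_space_pair "scaleC :: complex \<Rightarrow> 'z \<Rightarrow> 'z" "scaleC :: complex \<Rightarrow> 'v \<Rightarrow> 'v" ..
      show ?thesis
        using linear_injective_left_inverse[OF \<iota>(1,2)] that by (auto simp: fun_eq_iff)
    qed
    define \<Theta> where "\<Theta> e x = (\<lambda>k c. if k \<in> K then \<kappa> (?R e (\<beta> + k) c x) else 0)" for e x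
    have \<Theta>_lin: "clinear (\<Theta> e)" if "e \<in> E" for e
    proof (rule clinearI)
      note R = V.a_clinear[OF that UNIV_I]
      show "\<Theta> e (x + y) = \<Theta> e x + \<Theta> e y" for x y
        by (simp add: \<Theta>_def fun_eq_iff clinear_add[OF R] clinear_add[OF \<kappa>(1)])
      show "\<Theta> e (c *\<^sub>C x) = c *\<^sub>C \<Theta> e x" for c x
        by (simp add: \<Theta>_def fun_eq_iff clinear_scale[OF R] clinear_scale[OF \<kappa>(1)])
    qed
    let ?wt = "\<mu> - (\<chi> i. of_int (\<beta> $ i))"
    let ?S = "cspan (\<Union>e\<in>E. \<Theta> e ` weight_space \<rho> ?wt)"
    have "Z.cover \<subseteq> ?S"
      unfolding Z.cover_def
    proof (rule complex_vector.span_minimal, safe)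
      fix e r b v assume e: "e \<in> E" and r: "r \<in> K" and v: "v \<in> P r"
      define x where "x = ?R (u, 0) (r - \<beta>) b (\<iota> v)"
      have "x \<in> weight_space \<rho> ?wt"
        unfolding weight_space_homog
      proof safe
        fix i
        have "?R (axis i 1, 0) 0 1 x = ?R (u, 0) (r - \<beta>) b (?R (axis i 1, 0) 0 1 (\<iota> v)) + of_int (r $ i - \<beta> $ i) *\<^sub>C x"
          unfolding x_def using V.bracket[OF axisE uE UNIV_I UNIV_I, of i 0 1 "r - \<beta>" b "\<iota> v"]
          by (simp add: pairing_axis)
        also have "?R (axis i 1, 0) 0 1 (\<iota> v) = (\<mu> $ i - of_int (r $ i)) *\<^sub>C \<iota> v"
          using v unfolding top_K[OF K(1)] P_iff by (simp add: clinear_scale[OF \<iota>(1)])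
        also have "?R (u, 0) (r - \<beta>) b ((\<mu> $ i - of_int (r $ i)) *\<^sub>C \<iota> v) = (\<mu> $ i - of_int (r $ i)) *\<^sub>C x"
          unfolding x_def by (rule clinear_scale[OF V.a_clinear[OF uE UNIV_I]])
        finally show "?R (axis i 1, 0) 0 1 x = ?wt $ i *\<^sub>C x"
          by (simp add: scaleC_add_left[symmetric])
      qed
      then have \<Theta>_in: "\<Theta> e' x \<in> ?S" if "e' \<in> E" for e'
        using that by (intro complex_vector.span_base) blast
      have \<Theta>_x: "\<Theta> e' x = ?q e' (r - \<beta>) *\<^sub>C Z.cover_fun (u, 0) r b v - Z.cover_fun e' r b v" if e': "e' \<in> E" for e'
      proof (intro ext)
        fix k c
        show "\<Theta> e' x k c = (?q e' (r - \<beta>) *\<^sub>C Z.cover_fun (u, 0) r b v - Z.cover_fun e' r b v) k c"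
        proof (cases "k \<in> K")
          case True
          have lvk: "lv (\<beta> + k) = 1" using True lv by simp
          have rk: "r + k \<in> K" using K r True Z.K_add by blast
          have idx: "r - \<beta> + (\<beta> + k) = r + k" by simp
          have "?R e' (\<beta> + k) c x = ?R (u, 0) (r - \<beta>) b (?R e' (\<beta> + k) c (\<iota> v))
            + (?q e' (r - \<beta>) *\<^sub>C ?R (u, 0) (r + k) (b * c) (\<iota> v) - ?q (u, 0) (\<beta> + k) *\<^sub>C ?R e' (r + k) (b * c) (\<iota> v))"
            unfolding x_def V.bracket[OF e' uE UNIV_I UNIV_I] idx by (rule refl)
          also have "?R e' (\<beta> + k) c (\<iota> v) = 0" by (rule top_pos) (simp add: lvk)
          also have "?R (u, 0) (r - \<beta>) b 0 = 0" by (rule clinear_0[OF V.a_clinear[OF uE UNIV_I]])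
          finally have "\<kappa> (?R e' (\<beta> + k) c x)
            = ?q e' (r - \<beta>) *\<^sub>C ?a (u, 0) (r + k) (b * c) v - ?a e' (r + k) (b * c) v"
            by (simp add: top_K[OF rk] u lvk scaleC_one clinear_diff[OF \<kappa>(1)] clinear_scale[OF \<kappa>(1)] \<kappa>(2))
          then show ?thesis using True by (simp add: \<Theta>_def Z.cover_fun_def)
        next
          case False
          then show ?thesis by (simp add: \<Theta>_def Z.cover_fun_def)
        qed
      qed
      have "lv (r - \<beta>) = - 1" using r lv(1)[of "r - \<beta>" \<beta>] lv(2)[of r] lv(3) by simp
      then have "?q (u, 0) (r - \<beta>) = - 1" by (simp add: u)
      \<comment> \<open>For \<open>e = u\<close> both terms of the bracket are multiples of the same function.\<close>
      then have "\<Theta> (u, 0) x = (- 2) *\<^sub>C Z.cover_fun (u, 0) r b v"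
        using \<Theta>_x[OF uE] complex_vector.scale_left_diff_distrib[of "- 1" 1 "Z.cover_fun (u, 0) r b v"]
        by (simp add: scaleC_one)
      then have "Z.cover_fun (u, 0) r b v = (- (1/2)) *\<^sub>C \<Theta> (u, 0) x" by (simp add: scaleC_one)
      then have cu: "Z.cover_fun (u, 0) r b v \<in> ?S" using \<Theta>_in[OF uE] by (simp only: complex_vector.span_scale)
      have "Z.cover_fun e r b v = ?q e (r - \<beta>) *\<^sub>C Z.cover_fun (u, 0) r b v - \<Theta> e x"
        unfolding \<Theta>_x[OF e] by simp
      also have "\<dots> \<in> ?S" by (intro complex_vector.span_diff complex_vector.span_scale cu \<Theta>_in[OF e])
      finally show "Z.cover_fun e r b v \<in> ?S" .
    qed
    moreover have "finite_dim ?S"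
      by (rule finite_dim_cspan, rule finite_dim_UN[OF finE], rule finite_dim_image[OF \<Theta>_lin]) (use assms(10) in auto)
    ultimately show ?thesis by (rule finite_dim_subset[rotated])
  qed
  have "\<exists>\<eta>. algebra_hom \<eta> \<and> (\<forall>b. \<eta> b = 0 \<longrightarrow> b \<in> Z.ann)"
  proof (cases "\<exists>e\<in>E. \<exists>k\<in>K. \<exists>b v. ?a e k b v \<noteq> 0")
    case True
    then show ?thesis using Z.evaluation_of_finite_dim_cover[OF fd] by blast
  next
    case False
    then have "b \<in> Z.ann" for b by (simp add: Z.ann_def)
    then show ?thesis using algebra_hom_exists[OF assms(4)] by blast
  qed
  then obtain \<eta> where \<eta>: "algebra_hom \<eta>" "\<And>b. \<eta> b = 0 \<Longrightarrow> b \<in> Z.ann" by blast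
  have vanish: "?R e m b v = 0" if b: "b \<in> Z.ann" and e: "e \<in> E" for e m b v
  proof (rule V.vanishing_spreads_from_top[where lv = lv and H = "?R (u, 0) 0 1" and T = "range \<iota>"
        and ?t0.0 = "\<iota> z1" and \<alpha> = \<alpha> and J = Z.ann])
    show "clinear (?R (u, 0) 0 1)" by (rule V.a_clinear[OF uE UNIV_I])
    show "?R (u, 0) 0 1 (?R e m b v) = ?R e m b (?R (u, 0) 0 1 v) + of_int (lv m) *\<^sub>C ?R e m b v"
      if "e \<in> E" for e m b v
      using V.bracket[OF uE that UNIV_I UNIV_I, of 0 1 m b v] by (simp add: u)
    show "\<iota> z1 \<noteq> 0" using z1(2) \<iota>(1,2) by (metis clinear_0 injD)
    show "?R (u, 0) 0 1 t = \<alpha> *\<^sub>C t" if t: "t \<in> range \<iota>" for t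
    proof -
      obtain z where "t = \<iota> z" using t by blast
      then show ?thesis by (simp add: top_K[OF K(1)] Hz clinear_scale[OF \<iota>(1)])
    qed
    show "?R e m b t = 0" if "e \<in> E" "t \<in> range \<iota>" "lv m > 0" for e m b t
      using that(2) top_pos[OF that(3), of e b] by auto
    show "?R e m b t = 0" if "e \<in> E" "b \<in> Z.ann" "t \<in> range \<iota>" "lv m = 0" for e m b t
    proof -
      obtain z where "t = \<iota> z" using \<open>t \<in> range \<iota>\<close> by blast
      moreover have "m \<in> K" using that(4) lv(2) by blast
      ultimately show ?thesis
        using Z.annD[OF that(2,1), of m 1 z] by (simp add: top_K clinear_0[OF \<iota>(1)])
    qed
  qed (use lv(1) b e Z.ann_mult in auto)
  have "\<rho> (x \<otimes> b) v = \<eta> b *\<^sub>C \<rho> (x \<otimes> 1) v" for x b v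
  proof -
    let ?d = "b - \<eta> b *\<^sub>C 1"
    have "\<eta> ?d = 0"
      using \<eta>(1) unfolding algebra_hom_def by (simp add: clinear_diff clinear_scale scaleC_complex_def)
    then have d: "?d \<in> Z.ann" by (rule \<eta>(2))
    have lin: "clinear (\<lambda>x. \<rho> (x \<otimes> ?d) v)"
      by (rule clinearI) (simp_all add: tensor_add_left tensor_scale_left \<rho>_add \<rho>_scale)
    have lab: "labels F \<subseteq> E" by (auto simp: E_def)
    have "\<rho> (x \<otimes> ?d) v = 0"
      by (rule clinear_zero_on_cspan[OF lin, of "{homog e m | e m. e \<in> labels F}"])
         (use vanish[OF d] lab homog_span[OF F(2), where ?'n = 'n] in auto)
    moreover have "x \<otimes> b = x \<otimes> ?d + \<eta> b *\<^sub>C (x \<otimes> 1)"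
      by (simp add: tensor_scale_right[symmetric] tensor_add_right[symmetric])
    ultimately show ?thesis by (simp add: \<rho>_add \<rho>_scale)
  qed
  then show ?thesis unfolding single_point_evaluation_def using \<eta>(1) by blast
qed

end
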